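(* Let $N\ge2$, let $\Omega\subset\mathbb{R}^N$ be a bounded domain and fix $q\in\partial\Omega$. Suppose that $\partial\Omega$ is of class $C^2$ in a neighborhood of $q$. Let $B_R(p)\subset\Omega$ be a ball (of radius $R$ centered at $p$) such that $\partial B_R(p)\cap\partial\Omega=\{q\}$, and suppose that $\kappa_j(q)<1/R$ for $j=1,\dots,N-1$. Let $f\in C(\partial\Omega)$ be non-negative, let $u=u(x,t)$ be the solution of $$u_t=\Delta u\ \text{ in }\Omega\times(0,\infty),\quad u=0\ \text{ on }\Omega\times\{0\},\quad u=f\ \text{ on }\partial\Omega\times(0,\infty),$$ and, for $\varepsilon>0$, let $U_\varepsilon$ be the solution of $$\varepsilon^2\Delta U_\varepsilon-U_\varepsilon=0\ \text{ in }\Omega,\quad U_\varepsilon=f\ \text{ on }\partial\Omega.$$ Then $$\lim_{t\to0^+}(4\pi^2t)^{-\frac{N-1}{4}}\int_{\partial B_R(p)}u(x,t)\,dS_x=\frac{f(q)/\Gamma\left(\frac{N+3}{4}\right)}{\sqrt{\prod_{i=1}^{N-1}\bigl[1/R-\kappa_i(q)\bigr]}}$$ and $$\lim_{\varepsilon\to0^+}(2\pi\varepsilon)^{-\frac{N-1}{2}}\int_{\partial B_R(p)}U_\varepsilon(x)\,dS_x=\frac{f(q)}{\sqrt{\prod_{i=1}^{N-1}\bigl[1/R-\kappa_i(q)\bigr]}}.$$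
   Context: $\kappa_1,\dots,\kappa_{N-1}$ are the principal curvatures of $\partial\Omega$ with respect to the interior normal (so that the boundary of a ball of radius $\rho$ has all $\kappa_i=1/\rho$). $\Gamma(\cdot)$ is Euler's Gamma function. $dS_x$ is surface measure. Solutions are bounded classical solutions attaining the data continuously (for the parabolic problem, continuously on $\overline{\Omega}\times[0,\infty)$ except on $\partial\Omega\times\{0\}$). *)

theory Defs
  imports "HOL-Analysis.Analysis"
begin

definition grad :: "('a::euclidean_space \<Rightarrow> real) \<Rightarrow> 'a \<Rightarrow> 'a" where
  "grad f x = (\<Sum>b\<in>Basis. frechet_derivative f (at x) b *\<^sub>R b)"

text \<open>The Hessian of \<open>f\<close> at \<open>x\<close> as a linear map, namely the derivative of the gradient.\<close>

definition hess :: "('a::euclidean_space \<Rightarrow> real) \<Rightarrow> 'a \<Rightarrow> 'a \<Rightarrow> 'a" where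
  "hess f x = frechet_derivative (grad f) (at x)"

definition laplacian :: "('a::euclidean_space \<Rightarrow> real) \<Rightarrow> 'a \<Rightarrow> real" where
  "laplacian f x = (\<Sum>b\<in>Basis. hess f x b \<bullet> b)"

text \<open>Meant for open \<open>S\<close>. Continuity of \<open>f\<close> and of its gradient follows from
  differentiability.\<close>

definition C2_on :: "'a::euclidean_space set \<Rightarrow> ('a \<Rightarrow> real) \<Rightarrow> bool" where
  "C2_on S f \<longleftrightarrow>
     (\<forall>x\<in>S. f differentiable (at x)) \<and>
     (\<forall>x\<in>S. grad f differentiable (at x)) \<and>
     (\<forall>h. continuous_on S (\<lambda>x. hess f x h))"

text \<open>Class \<open>C\<^sup>2\<^sup>,\<^sup>1\<close> on the cylinder over an open set: \<open>\<partial>\<^sub>t u\<close> and the spatial derivatives of \<open>u\<close> up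
  to second order exist and are jointly continuous for positive times.\<close>

definition C21_on :: "'a::euclidean_space set \<Rightarrow> ('a \<Rightarrow> real \<Rightarrow> real) \<Rightarrow> bool" where
  "C21_on S u \<longleftrightarrow>
     (\<forall>t>0. C2_on S (\<lambda>x. u x t)) \<and>
     (\<forall>x\<in>S. \<forall>t>0. u x differentiable (at t)) \<and>
     continuous_on (S \<times> {0<..}) (\<lambda>(x, t). u x t) \<and>
     continuous_on (S \<times> {0<..}) (\<lambda>(x, t). grad (\<lambda>y. u y t) x) \<and>
     (\<forall>h. continuous_on (S \<times> {0<..}) (\<lambda>(x, t). hess (\<lambda>y. u y t) x h)) \<and>
     continuous_on (S \<times> {0<..}) (\<lambda>(x, t). deriv (u x) t)"

definition heat_solution ::
  "'a::euclidean_space set \<Rightarrow> ('a \<Rightarrow> real) \<Rightarrow> ('a \<Rightarrow> real \<Rightarrow> real) \<Rightarrow> bool" where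
  "heat_solution \<Omega> f u \<longleftrightarrow>
     C21_on \<Omega> u \<and>
     (\<forall>x\<in>\<Omega>. \<forall>t>0. deriv (u x) t = laplacian (\<lambda>y. u y t) x) \<and>
     (\<forall>x\<in>\<Omega>. u x 0 = 0) \<and>
     (\<forall>x\<in>frontier \<Omega>. \<forall>t>0. u x t = f x) \<and>
     continuous_on (closure \<Omega> \<times> {0..} - frontier \<Omega> \<times> {0}) (\<lambda>(x, t). u x t) \<and>
     bounded ((\<lambda>(x, t). u x t) ` (\<Omega> \<times> {0<..}))"

definition resolvent_solution ::
  "'a::euclidean_space set \<Rightarrow> ('a \<Rightarrow> real) \<Rightarrow> real \<Rightarrow> ('a \<Rightarrow> real) \<Rightarrow> bool" where
  "resolvent_solution \<Omega> f \<epsilon> U \<longleftrightarrow>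
     C2_on \<Omega> U \<and>
     (\<forall>x\<in>\<Omega>. \<epsilon>\<^sup>2 * laplacian U x - U x = 0) \<and>
     (\<forall>x\<in>frontier \<Omega>. U x = f x) \<and>
     continuous_on (closure \<Omega>) U \<and>
     bounded (U ` \<Omega>)"

text \<open>Inside the ball of radius \<open>r\<close> around \<open>q\<close>, the set \<open>\<Omega>\<close> is the strict epigraph, in the unit
  direction \<open>\<nu>\<close>, of a \<open>C\<^sup>2\<close> function on the hyperplane orthogonal to \<open>\<nu>\<close>. The function \<open>\<phi>\<close> is total
  on the ambient space, but only its values on that hyperplane matter.\<close>

definition C2_epigraph_near ::
  "'a::euclidean_space set \<Rightarrow> 'a \<Rightarrow> real \<Rightarrow> 'a \<Rightarrow> ('a \<Rightarrow> real) \<Rightarrow> bool" where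
  "C2_epigraph_near \<Omega> q r \<nu> \<phi> \<longleftrightarrow>
     0 < r \<and> norm \<nu> = 1 \<and> C2_on (ball 0 r) \<phi> \<and>
     (\<forall>x\<in>ball q r.
        x \<in> \<Omega> \<longleftrightarrow> \<phi> ((x - q) - ((x - q) \<bullet> \<nu>) *\<^sub>R \<nu>) < (x - q) \<bullet> \<nu>)"

definition C2_boundary_near :: "'a::euclidean_space set \<Rightarrow> 'a \<Rightarrow> bool" where
  "C2_boundary_near \<Omega> q \<longleftrightarrow> q \<in> frontier \<Omega> \<and> (\<exists>r \<nu> \<phi>. C2_epigraph_near \<Omega> q r \<nu> \<phi>)"

text \<open>If the boundary near \<open>q\<close> is written as a graph over its tangent hyperplane at \<open>q\<close>, with
  \<open>\<Omega>\<close> above the graph (so that \<open>\<nu>\<close> is the interior unit normal), then the principal curvatures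
  at \<open>q\<close> are the eigenvalues of the tangential Hessian of the graph function at \<open>0\<close>. The
  orthonormal tangential eigenbasis \<open>e\<close> lists them with multiplicity, as \<open>\<kappa> 1, \<dots>, \<kappa> (N - 1)\<close>.
  For a ball of radius \<open>\<rho>\<close> the graph function is \<open>\<rho> - sqrt (\<rho>\<^sup>2 - \<bar>y\<bar>\<^sup>2)\<close>, which gives
  \<open>\<kappa> i = 1 / \<rho>\<close>.\<close>

definition principal_curvatures ::
  "'a::euclidean_space set \<Rightarrow> 'a \<Rightarrow> (nat \<Rightarrow> real) \<Rightarrow> bool" where
  "principal_curvatures \<Omega> q \<kappa> \<longleftrightarrow>
     q \<in> frontier \<Omega> \<and>
     (\<exists>r \<nu> \<phi> e. C2_epigraph_near \<Omega> q r \<nu> \<phi> \<and>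
        (\<forall>v. v \<bullet> \<nu> = 0 \<longrightarrow> grad \<phi> 0 \<bullet> v = 0) \<and>
        (\<forall>i\<in>{1..DIM('a) - 1}. e i \<bullet> \<nu> = 0) \<and>
        (\<forall>i\<in>{1..DIM('a) - 1}. \<forall>j\<in>{1..DIM('a) - 1}. e i \<bullet> e j = (if i = j then 1 else 0)) \<and>
        (\<forall>i\<in>{1..DIM('a) - 1}. \<forall>v. v \<bullet> \<nu> = 0 \<longrightarrow> hess \<phi> 0 (e i) \<bullet> v = \<kappa> i * (e i \<bullet> v)))"

text \<open>Surface measure on the sphere of radius \<open>R > 0\<close> around \<open>p\<close>, on the Borel subsets of that
  sphere. As usual in the construction of polar coordinates, the area of \<open>A\<close> is \<open>N / R\<close> times the
  Lebesgue measure of the cone over \<open>A\<close> with apex \<open>p\<close>; that is, surface measure is \<open>N / R\<close> times the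
  image of Lebesgue measure on the punctured ball under radial projection.\<close>

definition sphere_measure :: "'a::euclidean_space \<Rightarrow> real \<Rightarrow> 'a measure" where
  "sphere_measure p R =
     density
       (distr (restrict_space lborel (ball p R - {p})) (restrict_space borel (sphere p R))
          (\<lambda>x. p + R *\<^sub>R sgn (x - p)))
       (\<lambda>_. ennreal (real DIM('a) / R))"

lemma radial_projection_measurable:
  fixes p :: "'a::euclidean_space"
  assumes "0 < R"
  shows "(\<lambda>x. p + R *\<^sub>R sgn (x - p))
    \<in> restrict_space lborel (ball p R - {p}) \<rightarrow>\<^sub>M restrict_space borel (sphere p R)"
proof -
  have "sphere p R \<inter> space borel = sphere p R" by simp
  moreover have "dist p (p + R *\<^sub>R sgn (x - p)) = R" if "x \<noteq> p" for x
    using that assms by (simp add: dist_norm norm_sgn)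
  ultimately show ?thesis
    unfolding sgn_div_norm
    by (intro measurable_restrict_space2 measurable_restrict_space1)
       (auto simp: space_restrict_space sgn_div_norm)
qed

lemma emeasure_sphere_measure_cone:
  fixes p :: "'a::euclidean_space"
  assumes R: "0 < R" and A: "A \<in> sets (restrict_space borel (sphere p R))"
  shows "emeasure (sphere_measure p R) A =
    ennreal (real DIM('a) / R) * emeasure lborel {p + s *\<^sub>R (x - p) | s x. 0 < s \<and> s < 1 \<and> x \<in> A}"
proof -
  let ?g = "\<lambda>x. p + R *\<^sub>R sgn (x - p)"
  let ?M = "restrict_space lborel (ball p R - {p})"
  have AS: "A \<subseteq> sphere p R"
    using sets.sets_into_space[OF A] by (simp add: space_restrict_space)
  have "?g -` A \<inter> (ball p R - {p}) = {p + s *\<^sub>R (x - p) | s x. 0 < s \<and> s < 1 \<and> x \<in> A}" (is "?L = ?C")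
  proof (intro equalityI subsetI)
    fix y assume y: "y \<in> ?L"
    then have "y \<noteq> p" "norm (y - p) < R" by (auto simp: dist_norm norm_minus_commute)
    then have "y = p + (norm (y - p) / R) *\<^sub>R (?g y - p)" "0 < norm (y - p) / R" "norm (y - p) / R < 1"
      using R by (auto simp: sgn_div_norm)
    then show "y \<in> ?C" using y by blast
  next
    fix y assume "y \<in> ?C"
    then obtain s x where s: "0 < s" "s < 1" and x: "x \<in> A" and y: "y = p + s *\<^sub>R (x - p)" by auto
    have nx: "norm (x - p) = R" using x AS by (auto simp: dist_norm norm_minus_commute)
    have "y - p = s *\<^sub>R (x - p)" by (simp add: y)
    moreover have "x \<noteq> p" using nx R by auto
    ultimately have "norm (y - p) = s * R" "y \<noteq> p" using s nx by auto
    then have "?g y = x" "y \<noteq> p" "norm (y - p) < R"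
      using s R by (simp_all add: sgn_div_norm y field_simps)
    then show "y \<in> ?L" using x by (simp add: dist_norm norm_minus_commute)
  qed
  moreover have "emeasure (sphere_measure p R) A
    = ennreal (real DIM('a) / R) * emeasure (distr ?M (restrict_space borel (sphere p R)) ?g) A"
    unfolding sphere_measure_def using A by (subst emeasure_density_const) auto
  moreover have "emeasure (distr ?M (restrict_space borel (sphere p R)) ?g) A
    = emeasure lborel (?g -` A \<inter> (ball p R - {p}))"
    using radial_projection_measurable[OF R, of p] A
    by (subst emeasure_distr)
       (auto simp: space_restrict_space Int_absorb2 intro!: emeasure_restrict_space)
  ultimately show ?thesis by simp
qed

end

theory Submission
  imports Defs "HOL-Probability.Probability" "HOL-Real_Asymp.Real_Asymp"
begin

text \<open>Write \<open>l\<close> for the length scale, \<open>l = \<epsilon>\<close> or \<open>l = \<surd>t\<close>. At a point at distance \<open>d\<close> from the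
  boundary both solutions are at most a constant times \<open>exp (- c d / l)\<close>, by comparison with sums
  of hyperbolic cosines. Near \<open>q\<close> the distance from a point \<open>x\<close> of the sphere to \<open>\<partial>\<Omega>\<close> is comparable
  to \<open>\<bar>x - q\<bar>\<^sup>2\<close>, so the integral concentrates at \<open>\<bar>x - q\<bar> \<approx> \<tau>\<close> with \<open>\<tau>\<^sup>2 = l\<close>. In a ball of radius
  \<open>K l\<close> around such a point the boundary lies within \<open>o(l)\<close> of a hyperplane, since its slope
  there is only \<open>O(\<tau>)\<close>; comparison with the explicit half-space solutions shows that the
  solution tends to \<open>f q\<close> times \<open>exp (- s)\<close>, respectively \<open>erfc (s / 2)\<close>, where
  \<open>s = \<Sum>\<^sub>i (1/R - \<kappa>\<^sub>i) z\<^sub>i\<^sup>2 / 2\<close> and \<open>z\<close> is the rescaled tangential position. Dominated convergence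
  leaves a Gaussian integral in the first case. The second follows from the first because both
  profiles are mixtures of indicators of the sublevel sets of the same quadratic form, whose
  volumes are homogeneous.\<close>

section \<open>Laplacians by one-dimensional derivatives and maximum principles\<close>

text \<open>The boundary is smooth only near \<open>q\<close> and \<open>f\<close> is merely
  continuous, so no single explicit barrier is at hand. The comparison is confined to balls of
  radius \<open>K l\<close>; on their spherical part nothing is known beyond boundedness, which
  costs an error of order \<open>1 / K^2\<close>. Hence the order of limits: \<open>l\<close> tends
  to 0 for fixed \<open>K\<close> and \<eta>, then \<open>K\<close> grows and \<eta> shrinks.
  Strictness of \<kappa>_j < 1/R acts twice. It separates the boundary quadratically from the ball,
  which turns interior decay into a Gaussian majorant, and it makes the limiting form positive
  definite, so that its Gaussian integral is finite. The N-1 tangential directions are scaled by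
  \<tau>, so the integral has size \<tau>^(N-1), that is \<epsilon>^((N-1)/2) or t^((N-1)/4); the
  Gaussian integral supplies the powers of 2 pi. The height in the cone that defines surface measure
  survives as a parameter; integrating it out gives \<open>R / N\<close>, which cancels the density
  \<open>N / R\<close>. By the duplication formula, \<open>Gamma ((N + 3) / 4)\<close> is the
  quotient of the moments of order (N-1)/2 of the two mixing densities.\<close>

text \<open>The derivatives along the line are those of a real function, so that barriers can be
  differentiated, and interior maxima tested, without computing any Hessian.\<close>

definition has_dd2 :: "('a::euclidean_space \<Rightarrow> real) \<Rightarrow> 'a \<Rightarrow> 'a \<Rightarrow> real \<Rightarrow> bool" where
  "has_dd2 w y b d \<longleftrightarrow> (\<exists>w1. (\<forall>\<^sub>F h in nhds 0. ((\<lambda>h. w (y + h *\<^sub>R b)) has_real_derivative w1 h) (at h)) \<and>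
     (w1 has_real_derivative d) (at 0))"

definition has_laplacian :: "('a::euclidean_space \<Rightarrow> real) \<Rightarrow> 'a \<Rightarrow> real \<Rightarrow> bool" where
  "has_laplacian w y l \<longleftrightarrow> (\<exists>d. (\<forall>b\<in>Basis. has_dd2 w y b (d b)) \<and> l = (\<Sum>b\<in>Basis. d b))"

lemma has_dd2_add:
  assumes "has_dd2 v y b d" "has_dd2 w y b e"
  shows "has_dd2 (\<lambda>x. v x + w x) y b (d + e)"
proof -
  obtain v1 w1 where v: "\<forall>\<^sub>F h in nhds 0. ((\<lambda>h. v (y + h *\<^sub>R b)) has_real_derivative v1 h) (at h)"
      "(v1 has_real_derivative d) (at 0)"
    and w: "\<forall>\<^sub>F h in nhds 0. ((\<lambda>h. w (y + h *\<^sub>R b)) has_real_derivative w1 h) (at h)"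
      "(w1 has_real_derivative e) (at 0)"
    using assms unfolding has_dd2_def by auto
  have "\<forall>\<^sub>F h in nhds 0. ((\<lambda>h. v (y + h *\<^sub>R b) + w (y + h *\<^sub>R b)) has_real_derivative v1 h + w1 h) (at h)"
    using v(1) w(1) by eventually_elim (rule DERIV_add)
  with DERIV_add[OF v(2) w(2)] show ?thesis
    unfolding has_dd2_def by (intro exI[of _ "\<lambda>h. v1 h + w1 h"] conjI)
qed

lemma has_dd2_cmult:
  assumes "has_dd2 v y b d"
  shows "has_dd2 (\<lambda>x. c * v x) y b (c * d)"
proof -
  obtain v1 where v: "\<forall>\<^sub>F h in nhds 0. ((\<lambda>h. v (y + h *\<^sub>R b)) has_real_derivative v1 h) (at h)"
      "(v1 has_real_derivative d) (at 0)"
    using assms unfolding has_dd2_def by auto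
  have "\<forall>\<^sub>F h in nhds 0. ((\<lambda>h. c * v (y + h *\<^sub>R b)) has_real_derivative c * v1 h) (at h)"
    using v(1) by eventually_elim (rule DERIV_cmult)
  with DERIV_cmult[OF v(2)] show ?thesis
    unfolding has_dd2_def by (intro exI[of _ "\<lambda>h. c * v1 h"] conjI)
qed

lemma has_laplacian_add:
  assumes "has_laplacian v y l" "has_laplacian w y m"
  shows "has_laplacian (\<lambda>x. v x + w x) y (l + m)"
proof -
  obtain d e where "\<forall>b\<in>Basis. has_dd2 v y b (d b)" "l = (\<Sum>b\<in>Basis. d b)"
    "\<forall>b\<in>Basis. has_dd2 w y b (e b)" "m = (\<Sum>b\<in>Basis. e b)"
    using assms unfolding has_laplacian_def by blast
  then show ?thesis unfolding has_laplacian_def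
    by (intro exI[of _ "\<lambda>b. d b + e b"]) (simp add: has_dd2_add sum.distrib)
qed

lemma has_laplacian_cmult:
  assumes "has_laplacian v y l"
  shows "has_laplacian (\<lambda>x. c * v x) y (c * l)"
proof -
  obtain d where "\<forall>b\<in>Basis. has_dd2 v y b (d b)" "l = (\<Sum>b\<in>Basis. d b)"
    using assms unfolding has_laplacian_def by blast
  then show ?thesis unfolding has_laplacian_def
    by (intro exI[of _ "\<lambda>b. c * d b"]) (simp add: has_dd2_cmult sum_distrib_left)
qed

lemma has_laplacian_diff:
  assumes "has_laplacian v y l" "has_laplacian w y m"
  shows "has_laplacian (\<lambda>x. v x - w x) y (l - m)"
  using has_laplacian_add[OF assms(1) has_laplacian_cmult[OF assms(2), of "-1"]] by simp

lemma has_laplacian_const: "has_laplacian (\<lambda>x. c) y 0"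
proof -
  have "has_dd2 (\<lambda>x. c) y b 0" for b
    unfolding has_dd2_def by (intro exI[of _ "\<lambda>_. 0"]) auto
  then show ?thesis unfolding has_laplacian_def by (intro exI[of _ "\<lambda>_. 0"]) simp
qed

lemma has_laplacian_sum:
  assumes "finite I" "\<And>i. i \<in> I \<Longrightarrow> has_laplacian (v i) y (l i)"
  shows "has_laplacian (\<lambda>x. \<Sum>i\<in>I. v i x) y (\<Sum>i\<in>I. l i)"
  using assms by (induction I rule: finite_induct) (auto intro: has_laplacian_const has_laplacian_add)

text \<open>The barriers below are built from functions of one linear coordinate. Differentiating
  twice along \<open>b\<close> gives \<open>g''\<close> times
  \<open>(b \<bullet> e)\<^sup>2\<close>, and by Parseval these weights sum to the squared norm of
  \<open>e\<close>.\<close>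

lemma has_laplacian_inner:
  fixes y e :: "'a::euclidean_space"
  assumes g: "\<And>s. (g has_real_derivative g' s) (at s)"
    and g': "\<And>s. (g' has_real_derivative g'' s) (at s)"
  shows "has_laplacian (\<lambda>x. g ((x - o') \<bullet> e)) y (g'' ((y - o') \<bullet> e) * (norm e)\<^sup>2)"
proof -
  have "has_dd2 (\<lambda>x. g ((x - o') \<bullet> e)) y b (g'' ((y - o') \<bullet> e) * (b \<bullet> e)\<^sup>2)" for b :: 'a
    unfolding has_dd2_def
  proof (intro exI[of _ "\<lambda>h. g' ((y + h *\<^sub>R b - o') \<bullet> e) * (b \<bullet> e)"] conjI always_eventually allI)
    have aff: "((\<lambda>h. (y + h *\<^sub>R b - o') \<bullet> e) has_real_derivative (b \<bullet> e)) (at h)" for h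
      by (auto intro!: derivative_eq_intros simp: inner_diff_left inner_add_left)
    show "((\<lambda>h. g ((y + h *\<^sub>R b - o') \<bullet> e)) has_real_derivative g' ((y + h *\<^sub>R b - o') \<bullet> e) * (b \<bullet> e)) (at h)" for h
      using DERIV_chain2[OF g aff] .
    have "((\<lambda>h. g' ((y + h *\<^sub>R b - o') \<bullet> e)) has_real_derivative g'' ((y - o') \<bullet> e) * (b \<bullet> e)) (at 0)"
      using DERIV_chain2[OF g' aff, of 0] by simp
    from DERIV_cmult_right[OF this, of "b \<bullet> e"]
    show "((\<lambda>h. g' ((y + h *\<^sub>R b - o') \<bullet> e) * (b \<bullet> e)) has_real_derivative g'' ((y - o') \<bullet> e) * (b \<bullet> e)\<^sup>2) (at 0)"
      by (simp add: power2_eq_square mult_ac)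
  qed
  moreover have "(\<Sum>b\<in>Basis. (b \<bullet> e)\<^sup>2) = (norm e)\<^sup>2"
    unfolding power2_norm_eq_inner by (subst euclidean_inner) (simp add: power2_eq_square inner_commute)
  ultimately show ?thesis
    unfolding has_laplacian_def
    by (intro exI[of _ "\<lambda>b. g'' ((y - o') \<bullet> e) * (b \<bullet> e)\<^sup>2"]) (simp flip: sum_distrib_left)
qed

lemma has_laplacian_norm_power2:
  fixes y a :: "'a::euclidean_space"
  shows "has_laplacian (\<lambda>x. (norm (x - a))\<^sup>2) y (2 * real DIM('a))"
proof -
  have "has_laplacian (\<lambda>x. ((x - a) \<bullet> i)\<^sup>2) y (2 * (norm i)\<^sup>2)" for i
    by (rule has_laplacian_inner[where g="\<lambda>s. s\<^sup>2" and g'="\<lambda>s. 2 * s" and g''="\<lambda>_. 2"])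
       (auto intro!: derivative_eq_intros)
  then have "has_laplacian (\<lambda>x. \<Sum>i\<in>Basis. ((x - a) \<bullet> i)\<^sup>2) y (\<Sum>i\<in>(Basis::'a set). 2 * (norm i)\<^sup>2)"
    by (intro has_laplacian_sum finite_Basis)
  moreover have "(\<lambda>x. \<Sum>i\<in>Basis. ((x - a) \<bullet> i)\<^sup>2) = (\<lambda>x. (norm (x - a))\<^sup>2)"
    unfolding power2_norm_eq_inner by (subst euclidean_inner) (simp add: power2_eq_square)
  ultimately show ?thesis by (simp add: mult.commute)
qed

section \<open>Classical derivatives as derivatives along lines\<close>

lemma frechet_derivative_eq_grad:
  fixes f :: "'a::euclidean_space \<Rightarrow> real"
  assumes "f differentiable (at x)"
  shows "frechet_derivative f (at x) h = grad f x \<bullet> h"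
proof -
  have lin: "linear (frechet_derivative f (at x))"
    using assms by (rule linear_frechet_derivative)
  have "frechet_derivative f (at x) h = (\<Sum>b\<in>Basis. (h \<bullet> b) * frechet_derivative f (at x) b)"
    by (subst euclidean_representation[of h, symmetric])
       (simp add: linear_sum[OF lin] linear_scale[OF lin])
  then show ?thesis
    by (simp add: grad_def inner_sum_right inner_commute mult.commute)
qed

lemma DERIV_along_line:
  fixes f :: "'a::euclidean_space \<Rightarrow> real"
  assumes "f differentiable (at (y + h *\<^sub>R b))"
  shows "((\<lambda>h. f (y + h *\<^sub>R b)) has_real_derivative grad f (y + h *\<^sub>R b) \<bullet> b) (at h)"
proof -
  have 1: "((\<lambda>h. y + h *\<^sub>R b) has_derivative (\<lambda>k. k *\<^sub>R b)) (at h)"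
    by (auto intro!: derivative_eq_intros)
  have "(f has_derivative frechet_derivative f (at (y + h *\<^sub>R b))) (at (y + h *\<^sub>R b))"
    using assms frechet_derivative_works by blast
  from has_derivative_compose[OF 1 this] frechet_derivative_eq_grad[OF assms]
  have "((\<lambda>h. f (y + h *\<^sub>R b)) has_derivative (\<lambda>k. grad f (y + h *\<^sub>R b) \<bullet> (k *\<^sub>R b))) (at h)"
    by simp
  then show ?thesis
    by (simp add: has_field_derivative_def mult.commute[of _ "_ \<bullet> _"])
qed

text \<open>The bridge from the notions of solution, which speak of the derivative of the gradient,
  to \<open>has_laplacian\<close>: along a basis line the second derivative is
  \<open>hess f y b \<bullet> b\<close>, and openness keeps the nearby points of the line in
  \<open>S\<close>.\<close>

lemma C2_on_has_laplacian:
  assumes "open S" "C2_on S f" "y \<in> S"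
  shows "has_laplacian f y (laplacian f y)"
proof -
  have "has_dd2 f y b (hess f y b \<bullet> b)" for b
    unfolding has_dd2_def
  proof (intro exI[of _ "\<lambda>h. grad f (y + h *\<^sub>R b) \<bullet> b"] conjI)
    have "((\<lambda>h. y + h *\<^sub>R b) \<longlongrightarrow> y + 0 *\<^sub>R b) (nhds 0)"
      by (intro tendsto_intros filterlim_ident)
    then have "\<forall>\<^sub>F h in nhds 0. y + h *\<^sub>R b \<in> S"
      using assms by (auto dest: topological_tendstoD)
    then show "\<forall>\<^sub>F h in nhds 0. ((\<lambda>h. f (y + h *\<^sub>R b)) has_real_derivative grad f (y + h *\<^sub>R b) \<bullet> b) (at h)"
      by eventually_elim (use assms in \<open>auto intro!: DERIV_along_line simp: C2_on_def\<close>)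
    have 1: "((\<lambda>h. y + h *\<^sub>R b) has_derivative (\<lambda>k. k *\<^sub>R b)) (at 0)"
      by (auto intro!: derivative_eq_intros)
    have g: "grad f differentiable (at y)" using assms by (auto simp: C2_on_def)
    then have "(grad f has_derivative hess f y) (at (y + 0 *\<^sub>R b))"
      using frechet_derivative_works by (auto simp: hess_def)
    from has_derivative_inner_left[OF has_derivative_compose[OF 1 this], of b]
    have "((\<lambda>h. grad f (y + h *\<^sub>R b) \<bullet> b) has_derivative (\<lambda>k. hess f y (k *\<^sub>R b) \<bullet> b)) (at 0)" .
    moreover have "linear (hess f y)"
      using linear_frechet_derivative[OF g] by (simp add: hess_def)
    ultimately show "((\<lambda>h. grad f (y + h *\<^sub>R b) \<bullet> b) has_real_derivative hess f y b \<bullet> b) (at 0)"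
      by (simp add: has_field_derivative_def linear_scale mult.commute[of _ "_ \<bullet> _"])
  qed
  then show ?thesis unfolding has_laplacian_def laplacian_def
    by (intro exI[of _ "\<lambda>b. hess f y b \<bullet> b"]) simp
qed

text \<open>One coordinate direction at a time: at a maximum the first derivative vanishes, and a
  positive second derivative would make it positive just to the right, so that the mean value
  theorem would yield a larger value.\<close>

lemma has_laplacian_local_max:
  fixes w :: "'a::euclidean_space \<Rightarrow> real"
  assumes w: "has_laplacian w y l" and D: "open D" "y \<in> D" and max: "\<And>z. z \<in> D \<Longrightarrow> w z \<le> w y"
  shows "l \<le> 0"
proof -
  have dd: "d \<le> 0" if dd2: "has_dd2 w y b d" for b d
  proof (rule ccontr)
    assume "\<not> d \<le> 0"
    obtain w1 where w1: "\<forall>\<^sub>F h in nhds 0. ((\<lambda>h. w (y + h *\<^sub>R b)) has_real_derivative w1 h) (at h)"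
      "(w1 has_real_derivative d) (at 0)" using dd2 unfolding has_dd2_def by auto
    have "((\<lambda>h. y + h *\<^sub>R b) \<longlongrightarrow> y + 0 *\<^sub>R b) (nhds 0)"
      by (intro tendsto_intros filterlim_ident)
    then have "\<forall>\<^sub>F h in nhds 0. y + h *\<^sub>R b \<in> D"
      using D by (auto dest: topological_tendstoD)
    with w1(1) have "\<forall>\<^sub>F h in nhds 0. ((\<lambda>h. w (y + h *\<^sub>R b)) has_real_derivative w1 h) (at h) \<and> y + h *\<^sub>R b \<in> D"
      by eventually_elim auto
    then obtain \<delta> where \<delta>: "\<delta> > 0"
      and der: "\<And>h. \<bar>h\<bar> < \<delta> \<Longrightarrow> ((\<lambda>h. w (y + h *\<^sub>R b)) has_real_derivative w1 h) (at h)"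
      and inD: "\<And>h. \<bar>h\<bar> < \<delta> \<Longrightarrow> y + h *\<^sub>R b \<in> D"
      unfolding eventually_nhds_metric by (auto simp: dist_real_def)
    have "w1 0 = 0"
      using DERIV_local_max[OF der[of 0] \<delta>] max[OF inD] \<delta> by (auto simp: abs_minus_commute)
    moreover obtain \<delta>' where \<delta>': "\<delta>' > 0" "\<And>h. 0 < h \<Longrightarrow> h < \<delta>' \<Longrightarrow> w1 0 < w1 h"
      using DERIV_pos_inc_right[OF w1(2)] \<open>\<not> d \<le> 0\<close> by auto
    ultimately have pos: "0 < w1 h" if "0 < h" "h < min \<delta> \<delta>'" for h using that by auto
    define k where "k = min \<delta> \<delta>' / 2"
    have k: "0 < k" "k < \<delta>" "k < \<delta>'" using \<delta> \<delta>' by (auto simp: k_def)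
    have "\<exists>z. 0 < z \<and> z < k \<and> w (y + k *\<^sub>R b) - w (y + 0 *\<^sub>R b) = (k - 0) * w1 z"
      by (rule MVT2) (use k in \<open>auto intro!: der\<close>)
    then obtain z where z: "0 < z" "z < k" "w (y + k *\<^sub>R b) - w y = k * w1 z" by auto
    then have "w (y + k *\<^sub>R b) > w y" using k pos[of z] by (smt (verit) mult_pos_pos)
    with max[OF inD, of k] k show False by simp
  qed
  obtain d where "\<forall>b\<in>Basis. has_dd2 w y b (d b)" "l = (\<Sum>b\<in>Basis. d b)"
    using w unfolding has_laplacian_def by auto
  then show ?thesis using dd by (auto intro!: sum_nonpos)
qed

text \<open>Positivity of the Laplacian is asked for only where \<open>v\<close> is positive. For
  differences governed by \<open>\<epsilon>\<^sup>2 * laplacian v \<ge> v\<close> this is what the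
  zeroth-order term provides, so the comparison functions need no strictness of their own.\<close>

lemma elliptic_max_principle:
  fixes v :: "'a::euclidean_space \<Rightarrow> real"
  assumes D: "open D" "bounded D" and cont: "continuous_on (closure D) v"
    and bd: "\<And>y. y \<in> frontier D \<Longrightarrow> v y \<le> 0"
    and lap: "\<And>y. y \<in> D \<Longrightarrow> v y > 0 \<Longrightarrow> \<exists>l>0. has_laplacian v y l"
    and x: "x \<in> closure D"
  shows "v x \<le> 0"
proof (rule ccontr)
  assume "\<not> v x \<le> 0"
  have "\<exists>y\<in>closure D. \<forall>z\<in>closure D. v z \<le> v y"
    using x cont D(2) by (intro continuous_attains_sup) (auto simp: compact_closure)
  then obtain y where y: "y \<in> closure D" "\<And>z. z \<in> closure D \<Longrightarrow> v z \<le> v y" by blast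
  have "v y > 0" using y(2)[OF x] \<open>\<not> v x \<le> 0\<close> by simp
  then have "y \<in> D" using bd[of y] y(1) D(1) by (auto simp: frontier_def interior_open)
  then obtain l where "l > 0" "has_laplacian v y l" using lap \<open>v y > 0\<close> by blast
  moreover have "l \<le> 0"
    by (rule has_laplacian_local_max[OF \<open>has_laplacian v y l\<close> D(1) \<open>y \<in> D\<close>])
       (use y(2) closure_subset in blast)
  ultimately show False by simp
qed

text \<open>Lateral and initial values may disagree along the edge at time 0, so the initial
  inequality is asked for eventually and uniformly in space, and the maximum is taken over
  \<open>{s0..t}\<close>, away from time 0. Subtracting \<open>\<delta> * s\<close> makes up for
  \<open>d \<le> l\<close> not being strict.\<close>

lemma parabolic_max_principle:
  fixes v :: "'a::euclidean_space \<Rightarrow> real \<Rightarrow> real"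
  assumes D: "open D" "bounded D" and cont: "continuous_on (closure D \<times> {0<..T}) (\<lambda>(y, s). v y s)"
    and bd: "\<And>y s. y \<in> frontier D \<Longrightarrow> 0 < s \<Longrightarrow> s \<le> T \<Longrightarrow> v y s \<le> 0"
    and init: "\<forall>\<^sub>F s in at_right 0. \<forall>y\<in>closure D. v y s \<le> 0"
    and sub: "\<And>y s. y \<in> D \<Longrightarrow> 0 < s \<Longrightarrow> s \<le> T \<Longrightarrow>
      \<exists>l d. has_laplacian (\<lambda>z. v z s) y l \<and> (v y has_real_derivative d) (at s) \<and> d \<le> l"
    and x: "x \<in> closure D" "0 < t" "t \<le> T"
  shows "v x t \<le> 0"
proof (rule ccontr)
  assume neg: "\<not> v x t \<le> 0"
  obtain s1 where s1: "s1 > 0" "\<And>s y. 0 < s \<Longrightarrow> s < s1 \<Longrightarrow> y \<in> closure D \<Longrightarrow> v y s \<le> 0"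
    using init unfolding eventually_at_right_field by auto
  define s0 where "s0 = min (s1 / 2) (t / 2)"
  have s0: "0 < s0" "s0 \<le> t" using s1 x by (auto simp: s0_def)
  \<comment> \<open>With this slope half of the positive value at \<open>(x, t)\<close> survives the
    subtraction of \<open>\<delta> * s\<close>.\<close>
  define \<delta> where "\<delta> = v x t / (2 * t)"
  have \<delta>: "\<delta> > 0" using neg x by (simp add: \<delta>_def)
  define V where "V = (\<lambda>(y, s). v y s - \<delta> * s)"
  have "compact (closure D \<times> {s0..t})"
    using D by (intro compact_Times) (auto simp: compact_closure)
  moreover have "continuous_on (closure D \<times> {s0..t}) V"
  proof -
    have "continuous_on (closure D \<times> {s0..t}) (\<lambda>z. v (fst z) (snd z))"
      using cont[unfolded case_prod_unfold] by (rule continuous_on_subset) (use s0 x in auto)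
    then show ?thesis unfolding V_def case_prod_unfold by (intro continuous_intros)
  qed
  moreover have "(x, t) \<in> closure D \<times> {s0..t}" using x s0 by auto
  ultimately obtain z where z: "z \<in> closure D \<times> {s0..t}" "\<And>z'. z' \<in> closure D \<times> {s0..t} \<Longrightarrow> V z' \<le> V z"
    using continuous_attains_sup[of "closure D \<times> {s0..t}" V] by blast
  obtain y s where ys: "z = (y, s)" by force
  have y: "y \<in> closure D" and s: "s0 \<le> s" "s \<le> t" using z(1) ys by auto
  have max: "v y' s' - \<delta> * s' \<le> v y s - \<delta> * s" if "y' \<in> closure D" "s0 \<le> s'" "s' \<le> t" for y' s'
    using z(2)[of "(y', s')"] that ys by (simp add: V_def)
  have "v x t - \<delta> * t > 0" using neg x by (simp add: \<delta>_def)
  then have pos: "v y s - \<delta> * s > 0" using max[of x t] x s0 by auto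
  have "\<delta> * s > 0" using \<delta> s s0 by simp
  with pos have vpos: "v y s > 0" by simp
  have yD: "y \<in> D" using bd[of y s] y D(1) vpos s s0 x by (auto simp: frontier_def interior_open)
  have "s \<noteq> s0"
    using s1(2)[of s y] vpos s0 y s1(1) x by (auto simp: s0_def min_def split: if_splits)
  then have ss: "s > s0" using s by simp
  obtain l d where l: "has_laplacian (\<lambda>z. v z s) y l" and d: "(v y has_real_derivative d) (at s)" and dl: "d \<le> l"
    using sub[OF yD, of s] s s0 x by auto
  have "l \<le> 0"
    by (rule has_laplacian_local_max[OF l D(1) yD])
       (use max[of _ s] s closure_subset[of D] in auto)
  \<comment> \<open>The maximum may lie at the last time, so only earlier times are compared: a
    derivative below \<delta> would make \<open>v y s - \<delta> * s\<close> larger a little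
    earlier.\<close>
  moreover have "d \<ge> \<delta>"
  proof (rule ccontr)
    assume "\<not> d \<ge> \<delta>"
    have "((\<lambda>s. v y s - \<delta> * s) has_real_derivative d - \<delta>) (at s)"
      using d by (auto intro!: derivative_eq_intros)
    with \<open>\<not> d \<ge> \<delta>\<close> obtain e where e: "e > 0" "\<And>h. 0 < h \<Longrightarrow> h < e \<Longrightarrow> v y s - \<delta> * s < v y (s - h) - \<delta> * (s - h)"
      using DERIV_neg_dec_left[of "\<lambda>s. v y s - \<delta> * s" "d - \<delta>" s] by auto
    define h where "h = min e (s - s0) / 2"
    have "0 < h" "h < e" "s0 \<le> s - h" using e ss by (auto simp: h_def min_def field_simps)
    with e(2)[of h] max[of y "s - h"] y s show False by auto
  qed
  ultimately show False using \<delta> dl by simp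
qed

section \<open>Half-space profiles and the elliptic problem\<close>

text \<open>Below, \<open>erfc2 r\<close> is \<open>erfc (r / 2)\<close>.\<close>

definition erfc2_kernel :: "real \<Rightarrow> real" where
  "erfc2_kernel r = exp (- r\<^sup>2 / 4) / sqrt pi"

definition erfc2 :: "real \<Rightarrow> real" where
  "erfc2 r = (LINT s|lborel. indicator {r<..} s * erfc2_kernel s)"

text \<open>Variance 2 is that of the one-dimensional heat kernel at time 1; the factor 2 gives each
  half-line mass 1, which makes \<open>erfc2\<close> equal to 1 on the boundary of the
  half-space.\<close>

lemma erfc2_kernel_eq: "erfc2_kernel r = 2 * normal_density 0 (sqrt 2) r"
  by (simp add: erfc2_kernel_def normal_density_def real_sqrt_mult)

lemma borel_measurable_erfc2_kernel [measurable]: "erfc2_kernel \<in> borel_measurable borel"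
  unfolding erfc2_kernel_def[abs_def] by measurable

lemma erfc2_kernel_nonneg: "0 \<le> erfc2_kernel r" by (simp add: erfc2_kernel_def)

lemma erfc2_kernel_le_1: "erfc2_kernel r \<le> 1"
proof -
  have "1 \<le> sqrt pi" using pi_gt3 by simp
  then show ?thesis by (simp add: erfc2_kernel_def divide_le_eq order.trans[of _ 1])
qed

lemma integrable_erfc2_kernel: "integrable lborel erfc2_kernel"
  unfolding erfc2_kernel_eq[abs_def] by simp

lemma integral_erfc2_kernel: "(LINT s|lborel. erfc2_kernel s) = 2"
  unfolding erfc2_kernel_eq[abs_def] by simp

lemma integrable_indicator_erfc2_kernel: "A \<in> sets borel \<Longrightarrow> integrable lborel (\<lambda>s. indicator A s * erfc2_kernel s)"
  using integrable_mult_indicator[OF _ integrable_erfc2_kernel, of A] by simp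

lemma DERIV_erfc2_kernel: "(erfc2_kernel has_real_derivative - (r / 2) * erfc2_kernel r) (at r)"
  unfolding erfc2_kernel_def[abs_def] by (auto intro!: derivative_eq_intros simp: field_simps power2_eq_square)

lemma continuous_on_erfc2_kernel: "continuous_on A erfc2_kernel"
  by (rule DERIV_continuous_on[OF DERIV_subset[OF DERIV_erfc2_kernel]]) auto

lemma erfc2_nonneg: "0 \<le> erfc2 r"
  unfolding erfc2_def by (intro integral_nonneg_AE) (simp add: erfc2_kernel_nonneg)

lemma erfc2_antimono: "r \<le> s \<Longrightarrow> erfc2 s \<le> erfc2 r"
  unfolding erfc2_def
  by (intro integral_mono integrable_indicator_erfc2_kernel) (auto simp: indicator_def erfc2_kernel_nonneg)

lemma erfc2_le_2: "erfc2 r \<le> 2"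
proof -
  have "erfc2 r \<le> (LINT s|lborel. erfc2_kernel s)" unfolding erfc2_def
    by (intro integral_mono integrable_indicator_erfc2_kernel integrable_erfc2_kernel) (auto simp: indicator_def erfc2_kernel_nonneg)
  then show ?thesis by (simp add: integral_erfc2_kernel)
qed

lemma erfc2_0: "erfc2 0 = 1"
proof -
  have "erfc2 0 = (LINT s|lborel. indicator {0<..} (-s) * erfc2_kernel (-s))"
    unfolding erfc2_def
    using lborel_integral_real_affine[of "-1" "\<lambda>s. indicator {0<..} s * erfc2_kernel s" 0] by simp
  also have "\<dots> = (LINT s|lborel. indicator {..<0} s * erfc2_kernel s)"
    by (intro Bochner_Integration.integral_cong) (auto simp: indicator_def erfc2_kernel_def)
  finally have "2 * erfc2 0 = (LINT s|lborel. indicator {0<..} s * erfc2_kernel s) + (LINT s|lborel. indicator {..<0} s * erfc2_kernel s)"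
    by (simp add: erfc2_def)
  also have "\<dots> = (LINT s|lborel. indicator {0<..} s * erfc2_kernel s + indicator {..<0} s * erfc2_kernel s)"
    by (rule Bochner_Integration.integral_add[symmetric]) (auto intro!: integrable_indicator_erfc2_kernel)
  also have "\<dots> = (LINT s|lborel. erfc2_kernel s)"
  proof (rule integral_cong_AE)
    show "AE s in lborel. indicator {0<..} s * erfc2_kernel s + indicator {..<0} s * erfc2_kernel s = erfc2_kernel s"
      using AE_lborel_singleton[of "0::real"] by eventually_elim (auto simp: indicator_def)
  qed (auto simp: erfc2_kernel_def[abs_def])
  finally show ?thesis by (simp add: integral_erfc2_kernel)
qed

text \<open>The half-line integral is split at a moving point of the window from
  \<open>r - 1\<close> to \<open>r + 1\<close>, which reduces the claim to the fundamental theorem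
  of calculus on a compact interval.\<close>

lemma DERIV_erfc2: "(erfc2 has_real_derivative - erfc2_kernel r) (at r)"
proof -
  define a b where "a = r - 1" and "b = r + 1"
  have split: "erfc2 x = erfc2 a - integral {a..x} erfc2_kernel" if "x \<in> {a..b}" for x
  proof -
    have "erfc2 a = (LINT s|lborel. indicator {a..x} s * erfc2_kernel s + indicator {x<..} s * erfc2_kernel s)"
      unfolding erfc2_def
    proof (rule integral_cong_AE)
      show "AE s in lborel. indicator {a<..} s * erfc2_kernel s = indicator {a..x} s * erfc2_kernel s + indicator {x<..} s * erfc2_kernel s"
        using AE_lborel_singleton[of a] by eventually_elim (use that in \<open>auto simp: indicator_def\<close>)
    qed (auto simp: erfc2_kernel_def[abs_def])
    also have "\<dots> = (LINT s|lborel. indicator {a..x} s * erfc2_kernel s) + erfc2 x"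
      unfolding erfc2_def by (rule Bochner_Integration.integral_add) (auto intro!: integrable_indicator_erfc2_kernel)
    also have "(LINT s|lborel. indicator {a..x} s * erfc2_kernel s) = integral {a..x} erfc2_kernel"
      using set_borel_integral_eq_integral(2)[of "{a..x}" erfc2_kernel] integrable_indicator_erfc2_kernel[of "{a..x}"]
      by (simp add: set_lebesgue_integral_def set_integrable_def)
    finally show ?thesis by simp
  qed
  have "((\<lambda>x. integral {a..x} erfc2_kernel) has_real_derivative erfc2_kernel r) (at r within {a..b})"
    by (rule integral_has_real_derivative[OF continuous_on_erfc2_kernel]) (auto simp: a_def b_def)
  then have "((\<lambda>x. integral {a..x} erfc2_kernel) has_real_derivative erfc2_kernel r) (at r)"
    by (simp add: at_within_Icc_at a_def b_def)
  then have 1: "((\<lambda>x. erfc2 a - integral {a..x} erfc2_kernel) has_real_derivative - erfc2_kernel r) (at r)"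
    by (auto intro!: derivative_eq_intros)
  have "\<forall>\<^sub>F x in nhds r. x \<in> {a<..<b}"
    by (rule eventually_nhds_in_open) (auto simp: a_def b_def)
  then have 2: "\<forall>\<^sub>F x in nhds r. erfc2 x = erfc2 a - integral {a..x} erfc2_kernel"
    by eventually_elim (rule split, simp)
  show ?thesis using DERIV_cong_ev[OF refl 2 refl, of "- erfc2_kernel r"] 1 by blast
qed

lemma continuous_on_erfc2: "continuous_on A erfc2"
  by (rule DERIV_continuous_on[OF DERIV_subset[OF DERIV_erfc2]]) auto

text \<open>The kernel is at most 1, so \<open>erfc2\<close> is 1-Lipschitz, and its values lie
  between 0 and 2. Both bounds matter, since \<open>r\<close> will be a height divided by
  \<open>sqrt s\<close>: the Lipschitz bound at later times, the bound 1 near time 0.\<close>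

lemma abs_1_minus_erfc2_le: "\<bar>1 - erfc2 r\<bar> \<le> min 1 \<bar>r\<bar>"
proof -
  have "norm (erfc2 r - erfc2 0) \<le> 1 * norm (r - 0)"
    by (rule field_differentiable_bound[of UNIV erfc2 "\<lambda>r. - erfc2_kernel r"])
       (auto simp: erfc2_kernel_nonneg erfc2_kernel_le_1 intro: DERIV_erfc2)
  then show ?thesis using erfc2_nonneg[of r] erfc2_le_2[of r] by (auto simp: erfc2_0)
qed

lemma erfc2_at_top: "(erfc2 \<longlongrightarrow> 0) at_top"
proof -
  have "((\<lambda>r. LINT s|lborel. indicator {r<..} s * erfc2_kernel s) \<longlongrightarrow> (LINT s::real|lborel. (0::real))) at_top"
  proof (rule integral_dominated_convergence_at_top[where w=erfc2_kernel])
    show "AE s in lborel. ((\<lambda>r. indicator {r<..} s * erfc2_kernel s) \<longlongrightarrow> 0) at_top"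
    proof (intro AE_I2 tendsto_eventually)
      fix s :: real
      show "\<forall>\<^sub>F r in at_top. indicator {r<..} s * erfc2_kernel s = 0"
        using eventually_ge_at_top[of s] by eventually_elim (auto simp: indicator_def)
    qed
  qed (auto simp: indicator_def erfc2_kernel_nonneg integrable_erfc2_kernel)
  then show ?thesis by (simp add: erfc2_def[abs_def])
qed

section \<open>Elliptic comparison with the half-space profile in small balls\<close>

lemma frontier_Int_ball_cases:
  fixes \<Omega> :: "'a::euclidean_space set"
  assumes "open \<Omega>" "0 < r"
  shows "y \<in> closure (\<Omega> \<inter> ball x r) \<Longrightarrow> y \<in> closure \<Omega> \<and> y \<in> cball x r"
    and "y \<in> frontier (\<Omega> \<inter> ball x r) \<Longrightarrow> y \<in> frontier \<Omega> \<and> y \<in> cball x r \<or> y \<in> closure \<Omega> \<and> dist x y = r"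
proof -
  have sub: "closure (\<Omega> \<inter> ball x r) \<subseteq> closure \<Omega> \<inter> cball x r"
    using closure_mono[of "\<Omega> \<inter> ball x r" \<Omega>] closure_mono[of "\<Omega> \<inter> ball x r" "ball x r"] assms by auto
  then show "y \<in> closure (\<Omega> \<inter> ball x r) \<Longrightarrow> y \<in> closure \<Omega> \<and> y \<in> cball x r" by blast
  assume "y \<in> frontier (\<Omega> \<inter> ball x r)"
  then have "y \<in> closure \<Omega>" "y \<in> cball x r" "y \<notin> \<Omega> \<inter> ball x r"
    using sub assms by (auto simp: frontier_def interior_open open_Int)
  then show "y \<in> frontier \<Omega> \<and> y \<in> cball x r \<or> y \<in> closure \<Omega> \<and> dist x y = r"
    using assms by (auto simp: frontier_def interior_open)
qed

text \<open>The quadratic part of the barrier is at least \<open>M1\<close> on the lateral boundary and small, of order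
  \<open>1 / K\<^sup>2\<close>, at the center of the ball.\<close>

lemma resolvent_half_space_approx:
  fixes \<Omega> :: "'a::euclidean_space set"
  assumes \<Omega>: "open \<Omega>" "bounded \<Omega>" and sol: "resolvent_solution \<Omega> f \<epsilon> U" and \<epsilon>: "0 < \<epsilon>"
    and M: "\<And>y. y \<in> closure \<Omega> \<Longrightarrow> \<bar>U y\<bar> \<le> M" and \<nu>: "norm \<nu> = 1"
    and K: "0 < K" and \<eta>: "0 < \<eta>" "\<eta> \<le> 1"
    and fr: "\<And>y. y \<in> frontier \<Omega> \<Longrightarrow> y \<in> cball x (K * \<epsilon>) \<Longrightarrow> \<bar>(y - a) \<bullet> \<nu>\<bar> \<le> \<eta> * \<epsilon> \<and> \<bar>f y - c\<bar> \<le> \<eta>"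
    and ins: "\<And>y. y \<in> closure \<Omega> \<Longrightarrow> y \<in> cball x (K * \<epsilon>) \<Longrightarrow> - \<eta> * \<epsilon> \<le> (y - a) \<bullet> \<nu>"
    and x: "x \<in> closure \<Omega>"
  shows "\<bar>U x - c * exp (- ((x - a) \<bullet> \<nu>) / \<epsilon>)\<bar>
    \<le> \<eta> + \<bar>c\<bar> * (exp \<eta> - 1) + (M + 3 * \<bar>c\<bar>) * 2 * real DIM('a) / K\<^sup>2"
proof -
  define D where "D = \<Omega> \<inter> ball x (K * \<epsilon>)"
  define E where "E = (\<lambda>y. exp (- ((y - a) \<bullet> \<nu>) / \<epsilon>))"
  \<comment> \<open>On the spherical part of the boundary the profile is at most
    \<open>exp \<eta> \<le> 3\<close>, whence the factor 3.\<close>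
  define M1 where "M1 = M + 3 * \<bar>c\<bar>"
  \<comment> \<open>The error on the part lying in \<open>frontier \<Omega>\<close>: the data differ
    from \<open>c\<close> by at most \<eta>, the profile from 1 by at most
    \<open>exp \<eta> - 1\<close>.\<close>
  define \<gamma> where "\<gamma> = \<eta> + \<bar>c\<bar> * (exp \<eta> - 1)"
  \<comment> \<open>The constant \<open>2 * real DIM('a) * \<epsilon>\<^sup>2\<close> offsets
    \<open>\<epsilon>\<^sup>2\<close> times the Laplacian of the squared norm, so that
    \<open>S\<close> is a supersolution of the equation.\<close>
  define S where "S = (\<lambda>y. \<gamma> + M1 / (K\<^sup>2 * \<epsilon>\<^sup>2) * ((norm (y - x))\<^sup>2 + 2 * real DIM('a) * \<epsilon>\<^sup>2))"
  have K\<epsilon>: "0 < K * \<epsilon>" using K \<epsilon> by simp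
  have M0: "0 \<le> M" using M[OF x] by linarith
  have M1: "0 \<le> M1" using M0 by (simp add: M1_def)
  have \<gamma>: "0 \<le> \<gamma>" using \<eta> by (simp add: \<gamma>_def)
  have exp\<eta>: "exp \<eta> \<le> 3" using exp_le \<eta> by (meson exp_le_cancel_iff order.trans)
  have D: "open D" "bounded D" using \<Omega> by (auto simp: D_def intro: bounded_subset)
  have xD: "x \<in> closure D"
    using open_Int_closure_subset[of "ball x (K * \<epsilon>)" \<Omega>] x K\<epsilon> by (auto simp: D_def Int_commute)
  have U: "C2_on \<Omega> U" "continuous_on (closure \<Omega>) U" "\<And>y. y \<in> \<Omega> \<Longrightarrow> \<epsilon>\<^sup>2 * laplacian U y = U y"
      "\<And>y. y \<in> frontier \<Omega> \<Longrightarrow> U y = f y"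
    using sol unfolding resolvent_solution_def by auto
  have lapE: "has_laplacian E y (E y / \<epsilon>\<^sup>2)" for y
  proof -
    have "has_laplacian (\<lambda>y. exp (- ((y - a) \<bullet> \<nu>) / \<epsilon>)) y (exp (- ((y - a) \<bullet> \<nu>) / \<epsilon>) / \<epsilon>\<^sup>2 * (norm \<nu>)\<^sup>2)"
      by (rule has_laplacian_inner[where g="\<lambda>s. exp (- s / \<epsilon>)" and g'="\<lambda>s. - exp (- s / \<epsilon>) / \<epsilon>"
            and g''="\<lambda>s. exp (- s / \<epsilon>) / \<epsilon>\<^sup>2"])
         (use \<epsilon> in \<open>auto intro!: derivative_eq_intros simp: field_simps power2_eq_square\<close>)
    then show ?thesis by (simp add: E_def \<nu>)
  qed
  have S\<gamma>: "\<gamma> \<le> S y" for y using M1 by (simp add: S_def)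
  \<comment> \<open>The signs 1 and -1 give the upper and the lower estimate.\<close>
  have main: "\<sigma> * (U x - c * E x) - S x \<le> 0" if \<sigma>: "\<bar>\<sigma>\<bar> = 1" for \<sigma>
  proof (rule elliptic_max_principle[OF D _ _ _ xD, of "\<lambda>y. \<sigma> * (U y - c * E y) - S y"])
    show "continuous_on (closure D) (\<lambda>y. \<sigma> * (U y - c * E y) - S y)"
      unfolding S_def E_def
      by (intro continuous_intros continuous_on_subset[OF U(2)])
         (use frontier_Int_ball_cases(1)[OF \<Omega>(1) K\<epsilon>] \<epsilon> in \<open>auto simp: D_def\<close>)
  next
    fix y assume "y \<in> frontier D"
    then consider "y \<in> frontier \<Omega>" "y \<in> cball x (K * \<epsilon>)" | "y \<in> closure \<Omega>" "dist x y = K * \<epsilon>"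
      using frontier_Int_ball_cases(2)[OF \<Omega>(1) K\<epsilon>] by (auto simp: D_def)
    then have "\<bar>U y - c * E y\<bar> \<le> S y"
    proof cases
      case 1
      have z: "\<bar>(y - a) \<bullet> \<nu>\<bar> \<le> \<eta> * \<epsilon>" "\<bar>U y - c\<bar> \<le> \<eta>" using fr[OF 1] U(4)[OF 1(1)] by auto
      have "- ((y - a) \<bullet> \<nu>) / \<epsilon> \<le> \<eta>" "- \<eta> \<le> - ((y - a) \<bullet> \<nu>) / \<epsilon>"
        using z(1) \<epsilon> by (auto simp: field_simps abs_le_iff)
      then have "E y \<le> exp \<eta>" "exp (- \<eta>) \<le> E y" by (simp_all add: E_def)
      moreover have "1 - exp (- \<eta>) \<le> exp \<eta> - 1"
        using exp_ge_add_one_self[of \<eta>] exp_ge_add_one_self[of "- \<eta>"] by linarith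
      ultimately have "\<bar>1 - E y\<bar> \<le> exp \<eta> - 1" by (auto simp: abs_le_iff)
      then have "\<bar>c * (1 - E y)\<bar> \<le> \<bar>c\<bar> * (exp \<eta> - 1)" by (simp add: abs_mult mult_left_mono)
      moreover have "U y - c * E y = (U y - c) + c * (1 - E y)" by (simp add: algebra_simps)
      ultimately have "\<bar>U y - c * E y\<bar> \<le> \<gamma>" using z(2) by (simp add: \<gamma>_def)
      then show ?thesis using S\<gamma>[of y] by linarith
    next
      case 2
      have "- ((y - a) \<bullet> \<nu>) / \<epsilon> \<le> \<eta>" using ins[OF 2(1)] 2(2) \<epsilon> by (auto simp: field_simps)
      then have "E y \<le> exp \<eta>" by (simp add: E_def)
      moreover have "0 \<le> E y" by (simp add: E_def)
      ultimately have "\<bar>E y\<bar> \<le> 3" using exp\<eta> by linarith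
      then have "\<bar>c * E y\<bar> \<le> 3 * \<bar>c\<bar>" by (simp add: abs_mult mult_left_mono mult.commute[of 3])
      then have "\<bar>U y - c * E y\<bar> \<le> M1" using M[OF 2(1)] by (auto simp: M1_def)
      also have "M1 = M1 / (K\<^sup>2 * \<epsilon>\<^sup>2) * (norm (y - x))\<^sup>2"
        using 2(2) K \<epsilon> by (simp add: dist_norm norm_minus_commute power_mult_distrib)
      also have "\<dots> \<le> M1 / (K\<^sup>2 * \<epsilon>\<^sup>2) * ((norm (y - x))\<^sup>2 + 2 * real DIM('a) * \<epsilon>\<^sup>2)"
        using M1 by (intro mult_left_mono) auto
      also have "\<dots> \<le> S y" using \<gamma> by (simp add: S_def)
      finally show ?thesis .
    qed
    then show "\<sigma> * (U y - c * E y) - S y \<le> 0" using \<sigma> by (auto simp: abs_if split: if_splits)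
  next
    fix y assume y: "y \<in> D" and pos: "\<sigma> * (U y - c * E y) - S y > 0"
    then have y\<Omega>: "y \<in> \<Omega>" by (simp add: D_def)
    define l where "l = \<sigma> * (laplacian U y - c * (E y / \<epsilon>\<^sup>2)) - (0 + M1 / (K\<^sup>2 * \<epsilon>\<^sup>2) * (2 * real DIM('a) + 0))"
    have "has_laplacian (\<lambda>y. \<sigma> * (U y - c * E y) - S y) y l"
      unfolding S_def l_def
      by (intro has_laplacian_diff has_laplacian_add has_laplacian_cmult has_laplacian_const
          has_laplacian_norm_power2 lapE C2_on_has_laplacian[OF \<Omega>(1) U(1) y\<Omega>])
    moreover have "\<epsilon>\<^sup>2 * l = \<sigma> * (U y - c * E y) - M1 / K\<^sup>2 * (2 * real DIM('a))"
      unfolding l_def U(3)[OF y\<Omega>, symmetric] using \<epsilon> K by (simp add: field_simps)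
    moreover have "M1 / K\<^sup>2 * (2 * real DIM('a)) = M1 / (K\<^sup>2 * \<epsilon>\<^sup>2) * (2 * real DIM('a) * \<epsilon>\<^sup>2)"
      using \<epsilon> by simp
    moreover have "\<dots> \<le> S y"
      using \<gamma> M1 mult_left_mono[of "2 * real DIM('a) * \<epsilon>\<^sup>2" "(norm (y - x))\<^sup>2 + 2 * real DIM('a) * \<epsilon>\<^sup>2" "M1 / (K\<^sup>2 * \<epsilon>\<^sup>2)"]
      by (simp add: S_def)
    ultimately have "\<epsilon>\<^sup>2 * l > 0" using pos by linarith
    then have "l > 0" using \<epsilon> by (simp add: zero_less_mult_iff)
    then show "\<exists>l>0. has_laplacian (\<lambda>y. \<sigma> * (U y - c * E y) - S y) y l"
      using \<open>has_laplacian _ y l\<close> by blast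
  qed
  have "\<bar>U x - c * E x\<bar> \<le> S x" using main[of 1] main[of "-1"] by (simp add: abs_le_iff)
  also have "S x = \<gamma> + M1 * 2 * real DIM('a) / K\<^sup>2" using \<epsilon> K by (simp add: S_def)
  finally show ?thesis by (simp add: E_def \<gamma>_def M1_def)
qed

section \<open>Exponential interior decay in the elliptic case\<close>

lemma exists_Basis_ge_norm:
  fixes z :: "'a::euclidean_space"
  shows "\<exists>b\<in>Basis. norm z / sqrt (real DIM('a)) \<le> \<bar>z \<bullet> b\<bar>"
proof (rule ccontr)
  assume "\<not> ?thesis"
  then have lt: "\<And>b. b \<in> Basis \<Longrightarrow> \<bar>z \<bullet> b\<bar> < norm z / sqrt (real DIM('a))" by force
  have "(z \<bullet> b)\<^sup>2 < (norm z)\<^sup>2 / real DIM('a)" if "b \<in> Basis" for b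
  proof -
    have "\<bar>z \<bullet> b\<bar>\<^sup>2 < (norm z / sqrt (real DIM('a)))\<^sup>2" using lt[OF that] by (intro power_strict_mono) auto
    then show ?thesis by (simp add: power_divide)
  qed
  then have "(\<Sum>b\<in>Basis. (z \<bullet> b)\<^sup>2) < (\<Sum>b\<in>(Basis::'a set). (norm z)\<^sup>2 / real DIM('a))"
    by (intro sum_strict_mono) auto
  also have "\<dots> = (norm z)\<^sup>2" by simp
  also have "\<dots> = (\<Sum>b\<in>Basis. (z \<bullet> b)\<^sup>2)"
    unfolding power2_norm_eq_inner by (subst euclidean_inner) (simp add: power2_eq_square)
  finally show False by simp
qed

text \<open>A substitute for the radial solution that grows away from the centre: each summand is
  reproduced by \<open>l\<^sup>2\<close> times the Laplacian, and no radial derivatives are needed.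
  The factor 2 makes \<open>2 * cosh s\<close> at least \<open>exp \<bar>s\<bar>\<close>.\<close>

definition cosh_sum :: "real \<Rightarrow> 'a::euclidean_space \<Rightarrow> real" where
  "cosh_sum l z = (\<Sum>b\<in>Basis. 2 * cosh (z \<bullet> b / l))"

lemma cosh_sum_0: "cosh_sum l (0::'a::euclidean_space) = 2 * real DIM('a)"
  by (simp add: cosh_sum_def)

lemma continuous_on_cosh_sum:
  "continuous_on A g \<Longrightarrow> continuous_on A (\<lambda>x. cosh_sum l (g x))"
  unfolding cosh_sum_def cosh_def divide_inverse by (intro continuous_intros)

text \<open>The square root of the dimension is the price of replacing the norm by the largest
  coordinate; it persists in all decay rates below.\<close>

lemma cosh_sum_ge_exp:
  fixes z :: "'a::euclidean_space"
  assumes "0 < l"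
  shows "exp (norm z / (sqrt (real DIM('a)) * l)) \<le> cosh_sum l z"
proof -
  obtain b where b: "b \<in> Basis" "norm z / sqrt (real DIM('a)) \<le> \<bar>z \<bullet> b\<bar>"
    using exists_Basis_ge_norm by blast
  have "norm z / (sqrt (real DIM('a)) * l) \<le> \<bar>z \<bullet> b\<bar> / l"
    using b(2) assms by (simp add: divide_simps)
  then have "exp (norm z / (sqrt (real DIM('a)) * l)) \<le> exp (\<bar>z \<bullet> b\<bar> / l)" by simp
  also have "\<dots> \<le> 2 * cosh (z \<bullet> b / l)"
    by (auto simp: cosh_def abs_if)
  also have "\<dots> \<le> cosh_sum l z"
    unfolding cosh_sum_def using b(1) by (intro member_le_sum) auto
  finally show ?thesis .
qed

lemma has_laplacian_cosh_sum:
  fixes y x :: "'a::euclidean_space"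
  assumes "0 < l"
  shows "has_laplacian (\<lambda>y. cosh_sum l (y - x)) y (cosh_sum l (y - x) / l\<^sup>2)"
proof -
  have "has_laplacian (\<lambda>y. 2 * cosh ((y - x) \<bullet> b / l)) y (2 * cosh ((y - x) \<bullet> b / l) / l\<^sup>2 * (norm b)\<^sup>2)" for b
    by (rule has_laplacian_inner[where g="\<lambda>s. 2 * cosh (s / l)" and g'="\<lambda>s. 2 * sinh (s / l) / l"
          and g''="\<lambda>s. 2 * cosh (s / l) / l\<^sup>2"])
       (use assms in \<open>auto intro!: derivative_eq_intros simp: power2_eq_square\<close>)
  then have "has_laplacian (\<lambda>y. \<Sum>b\<in>Basis. 2 * cosh ((y - x) \<bullet> b / l)) y
      (\<Sum>b\<in>(Basis::'a set). 2 * cosh ((y - x) \<bullet> b / l) / l\<^sup>2 * (norm b)\<^sup>2)"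
    by (intro has_laplacian_sum finite_Basis)
  then show ?thesis by (simp add: cosh_sum_def sum_divide_distrib)
qed

text \<open>The barrier, a multiple of \<open>cosh_sum\<close>, solves the same equation, is at
  least \<open>M\<close> on the sphere of radius \<open>d\<close> by the choice of \<open>A\<close>,
  and is only \<open>2 * real DIM('a) * A\<close> at the centre. Since the difference solves the
  equation too, its Laplacian is positive wherever it is.\<close>

lemma resolvent_interior_decay:
  fixes \<Omega> :: "'a::euclidean_space set"
  assumes \<Omega>: "open \<Omega>" and sol: "resolvent_solution \<Omega> f \<epsilon> U" and \<epsilon>: "0 < \<epsilon>"
    and M: "\<And>y. y \<in> \<Omega> \<Longrightarrow> \<bar>U y\<bar> \<le> M" and d: "0 < d" and ball: "cball x d \<subseteq> \<Omega>"
  shows "\<bar>U x\<bar> \<le> 2 * real DIM('a) * M * exp (- d / (sqrt (real DIM('a)) * \<epsilon>))"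
proof -
  define A where "A = M * exp (- d / (sqrt (real DIM('a)) * \<epsilon>))"
  define S where "S = (\<lambda>y. A * cosh_sum \<epsilon> (y - x))"
  have "x \<in> \<Omega>" using ball d by auto
  from M[OF this] have "0 \<le> M" by linarith
  then have A: "0 \<le> A" by (simp add: A_def)
  have U: "C2_on \<Omega> U" "continuous_on (closure \<Omega>) U" "\<And>y. y \<in> \<Omega> \<Longrightarrow> \<epsilon>\<^sup>2 * laplacian U y = U y"
    using sol unfolding resolvent_solution_def by auto
  have main: "\<sigma> * U x - S x \<le> 0" if \<sigma>: "\<bar>\<sigma>\<bar> = 1" for \<sigma>
  proof (rule elliptic_max_principle[of "ball x d" "\<lambda>y. \<sigma> * U y - S y"])
    show "continuous_on (closure (ball x d)) (\<lambda>y. \<sigma> * U y - S y)"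
      unfolding S_def using d ball closure_subset[of \<Omega>]
      by (intro continuous_intros continuous_on_cosh_sum continuous_on_subset[OF U(2)]) auto
  next
    fix y assume "y \<in> frontier (ball x d)"
    then have y: "norm (y - x) = d" "y \<in> cball x d" using d by (auto simp: dist_norm norm_minus_commute)
    have "\<bar>U y\<bar> \<le> M * 1" using M y(2) ball by auto
    also have "\<dots> = A * exp (norm (y - x) / (sqrt (real DIM('a)) * \<epsilon>))"
      by (simp add: A_def y(1) exp_minus)
    also have "\<dots> \<le> S y" unfolding S_def by (intro mult_left_mono cosh_sum_ge_exp \<epsilon> A)
    finally show "\<sigma> * U y - S y \<le> 0" using \<sigma> by (auto simp: abs_if split: if_splits)
  next
    fix y assume y: "y \<in> ball x d" and pos: "\<sigma> * U y - S y > 0"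
    then have y\<Omega>: "y \<in> \<Omega>" using ball by auto
    define l where "l = \<sigma> * laplacian U y - A * (cosh_sum \<epsilon> (y - x) / \<epsilon>\<^sup>2)"
    have "has_laplacian (\<lambda>y. \<sigma> * U y - S y) y l"
      unfolding S_def l_def
      by (intro has_laplacian_diff has_laplacian_cmult has_laplacian_cosh_sum \<epsilon>
          C2_on_has_laplacian[OF \<Omega>(1) U(1) y\<Omega>])
    moreover have "\<epsilon>\<^sup>2 * l = \<sigma> * U y - S y"
      unfolding l_def S_def U(3)[OF y\<Omega>, symmetric] using \<epsilon> by (simp add: field_simps)
    ultimately show "\<exists>l>0. has_laplacian (\<lambda>y. \<sigma> * U y - S y) y l"
      using pos by (metis mult_less_cancel_left_pos mult_zero_right zero_less_power \<epsilon>)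
  qed (use d in auto)
  have "\<bar>U x\<bar> \<le> S x" using main[of 1] main[of "-1"] by (simp add: abs_le_iff)
  then show ?thesis by (simp add: S_def A_def cosh_sum_0 mult_ac)
qed

section \<open>The heat equation\<close>

text \<open>Over a compact subset of the open set the solution is continuous down to time 0 and
  vanishes there; uniform continuity on \<open>C \<times> {0..1}\<close> makes the smallness
  independent of the point.\<close>

lemma heat_solution_initial_uniform:
  fixes \<Omega> :: "'a::euclidean_space set"
  assumes \<Omega>: "open \<Omega>" and sol: "heat_solution \<Omega> f u" and C: "compact C" "C \<subseteq> \<Omega>" and e: "0 < e"
  shows "\<forall>\<^sub>F s in at_right 0. \<forall>y\<in>C. \<bar>u y s\<bar> \<le> e"
proof -
  have fr: "y \<notin> frontier \<Omega>" if "y \<in> C" for y using that C \<Omega> by (auto simp: frontier_def interior_open)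
  have cont: "continuous_on (closure \<Omega> \<times> {0..} - frontier \<Omega> \<times> {0}) (\<lambda>(x, t). u x t)"
    and init: "\<And>y. y \<in> \<Omega> \<Longrightarrow> u y 0 = 0"
    using sol unfolding heat_solution_def by auto
  have "continuous_on (C \<times> {0..1}) (\<lambda>(x, t). u x t)"
    by (rule continuous_on_subset[OF cont]) (use C fr closure_subset[of \<Omega>] in auto)
  then have "uniformly_continuous_on (C \<times> {0..1}) (\<lambda>(x, t). u x t)"
    by (intro compact_uniformly_continuous compact_Times C) auto
  then obtain d where d: "d > 0" and
    ud: "\<And>p q. p \<in> C \<times> {0..1} \<Longrightarrow> q \<in> C \<times> {0..1} \<Longrightarrow> dist q p < d \<Longrightarrow>
      dist ((\<lambda>(x, t). u x t) q) ((\<lambda>(x, t). u x t) p) < e"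
    using e unfolding uniformly_continuous_on_def by meson
  have "\<forall>\<^sub>F s in at_right (0::real). s \<in> {0<..<min d 1}"
    using d by (intro eventually_at_right_real) auto
  then show ?thesis
  proof eventually_elim
    case (elim s)
    show ?case
    proof
      fix y assume y: "y \<in> C"
      have "dist (y, s) (y, 0) < d" using elim by (simp add: dist_Pair_Pair dist_real_def)
      from ud[OF _ _ this] y elim have "dist (u y s) (u y 0) < e" by auto
      then show "\<bar>u y s\<bar> \<le> e" using init[of y] y C by (auto simp: dist_real_def)
    qed
  qed
qed

lemma heat_solution_DERIV_time:
  assumes "heat_solution \<Omega> f u" "y \<in> \<Omega>" "0 < s"
  shows "(u y has_real_derivative laplacian (\<lambda>z. u z s) y) (at s)"
proof -
  have "u y differentiable (at s)" "deriv (u y) s = laplacian (\<lambda>z. u z s) y"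
    using assms unfolding heat_solution_def C21_on_def by auto
  then show ?thesis by (metis DERIV_imp_deriv real_differentiable_def)
qed

lemma continuous_on_heat_solution:
  assumes "heat_solution \<Omega> f u" "A \<subseteq> closure \<Omega> \<times> {0<..}"
  shows "continuous_on A (\<lambda>z. u (fst z) (snd z))"
proof -
  have "continuous_on (closure \<Omega> \<times> {0..} - frontier \<Omega> \<times> {0}) (\<lambda>z. u (fst z) (snd z))"
    using assms unfolding heat_solution_def case_prod_unfold by auto
  then show ?thesis by (rule continuous_on_subset) (use assms(2) in auto)
qed

text \<open>The value agrees with the time derivative in \<open>DERIV_erfc2_time\<close>:
  \<open>erfc2 (z / sqrt s)\<close> is the self-similar solution in the half-space with boundary
  value 1 and initial value 0.\<close>

lemma has_laplacian_erfc2: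
  assumes "norm \<nu> = 1" "0 < s"
  shows "has_laplacian (\<lambda>y. erfc2 ((y - a) \<bullet> \<nu> / sqrt s)) y
    (((y - a) \<bullet> \<nu>) / (2 * s * sqrt s) * erfc2_kernel ((y - a) \<bullet> \<nu> / sqrt s))"
proof -
  have "has_laplacian (\<lambda>y. erfc2 ((y - a) \<bullet> \<nu> / sqrt s)) y
     (((y - a) \<bullet> \<nu> / (2 * s * sqrt s) * erfc2_kernel ((y - a) \<bullet> \<nu> / sqrt s)) * (norm \<nu>)\<^sup>2)"
  proof (rule has_laplacian_inner[where g="\<lambda>z. erfc2 (z / sqrt s)" and g'="\<lambda>z. - erfc2_kernel (z / sqrt s) / sqrt s"
            and g''="\<lambda>z. z / (2 * s * sqrt s) * erfc2_kernel (z / sqrt s)"])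
    fix z
    have z: "((\<lambda>z. z / sqrt s) has_real_derivative 1 / sqrt s) (at z)"
      by (rule DERIV_cdivide[OF DERIV_ident])
    show "((\<lambda>z. erfc2 (z / sqrt s)) has_real_derivative - erfc2_kernel (z / sqrt s) / sqrt s) (at z)"
      using DERIV_chain2[OF DERIV_erfc2 z] by simp
    have "((\<lambda>z. - erfc2_kernel (z / sqrt s) / sqrt s) has_real_derivative
        - (- (z / sqrt s / 2) * erfc2_kernel (z / sqrt s) * (1 / sqrt s)) / sqrt s) (at z)"
      by (intro DERIV_cdivide DERIV_minus DERIV_chain2[OF DERIV_erfc2_kernel z])
    moreover have "- (- (z / sqrt s / 2) * erfc2_kernel (z / sqrt s) * (1 / sqrt s)) / sqrt s
        = z / (2 * s * sqrt s) * erfc2_kernel (z / sqrt s)"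
    proof -
      define r where "r = sqrt s"
      have "r > 0" "s = r\<^sup>2" using assms by (auto simp: r_def)
      then show ?thesis by (simp add: field_simps power2_eq_square)
    qed
    ultimately show "((\<lambda>z. - erfc2_kernel (z / sqrt s) / sqrt s) has_real_derivative
        z / (2 * s * sqrt s) * erfc2_kernel (z / sqrt s)) (at z)" by metis
  qed
  then show ?thesis using assms by simp
qed

lemma DERIV_erfc2_time:
  assumes "0 < s"
  shows "((\<lambda>s. erfc2 (z / sqrt s)) has_real_derivative z / (2 * s * sqrt s) * erfc2_kernel (z / sqrt s)) (at s)"
proof -
  have "((\<lambda>s. z / sqrt s) has_real_derivative - z / (2 * s * sqrt s)) (at s)"
    using assms by (auto intro!: derivative_eq_intros simp: field_simps)
  from DERIV_chain2[OF DERIV_erfc2 this] show ?thesis by (simp add: mult_ac)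
qed

text \<open>The one-dimensional heat kernel at time \<open>s\<close> without the factor
  \<open>1 / sqrt (4 * pi)\<close>: heat released uniformly on a hyperplane, as a function of the
  height \<open>z\<close>.\<close>

definition gauss_slab :: "real \<Rightarrow> real \<Rightarrow> real" where
  "gauss_slab s z = exp (- z\<^sup>2 / (4 * s)) / sqrt s"

lemma has_laplacian_gauss_slab:
  assumes "norm \<nu> = 1" "0 < s"
  shows "has_laplacian (\<lambda>y. gauss_slab s ((y - a) \<bullet> \<nu>)) y
    ((((y - a) \<bullet> \<nu>)\<^sup>2 / (4 * s\<^sup>2) - 1 / (2 * s)) * gauss_slab s ((y - a) \<bullet> \<nu>))"
proof -
  have "has_laplacian (\<lambda>y. gauss_slab s ((y - a) \<bullet> \<nu>)) y
     (((((y - a) \<bullet> \<nu>)\<^sup>2 / (4 * s\<^sup>2) - 1 / (2 * s)) * gauss_slab s ((y - a) \<bullet> \<nu>)) * (norm \<nu>)\<^sup>2)"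
    by (rule has_laplacian_inner[where g="gauss_slab s" and g'="\<lambda>z. - z / (2 * s) * gauss_slab s z"
            and g''="\<lambda>z. (z\<^sup>2 / (4 * s\<^sup>2) - 1 / (2 * s)) * gauss_slab s z"])
      (use assms in \<open>auto intro!: derivative_eq_intros simp: gauss_slab_def[abs_def] field_simps power2_eq_square\<close>)
  then show ?thesis using assms by simp
qed

text \<open>The shift \<open>b\<close> serves to let the Gaussian start with positive width. The
  value is the one in \<open>has_laplacian_gauss_slab\<close> at time \<open>s + b\<close>, so the
  shifted kernel solves the heat equation.\<close>

lemma DERIV_gauss_slab_time:
  assumes "0 < s + b"
  shows "((\<lambda>s. gauss_slab (s + b) z) has_real_derivative
    (z\<^sup>2 / (4 * (s + b)\<^sup>2) - 1 / (2 * (s + b))) * gauss_slab (s + b) z) (at s)"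
proof -
  define r where "r = sqrt (s + b)"
  have r: "r > 0" "s + b = r\<^sup>2" using assms by (auto simp: r_def)
  define e where "e = exp (- z\<^sup>2 / (4 * (s + b)))"
  have "((\<lambda>s. - z\<^sup>2 / (4 * (s + b))) has_real_derivative z\<^sup>2 / (4 * (s + b)\<^sup>2)) (at s)"
  proof -
    have "((\<lambda>s. - z\<^sup>2 / 4 * inverse (s + b)) has_real_derivative - z\<^sup>2 / 4 * (- 1 * inverse ((s + b)\<^sup>2))) (at s)"
      using assms by (auto intro!: derivative_eq_intros simp: power2_eq_square)
    then show ?thesis by (simp add: field_simps)
  qed
  then have 1: "((\<lambda>s. exp (- z\<^sup>2 / (4 * (s + b)))) has_real_derivative e * (z\<^sup>2 / (4 * (s + b)\<^sup>2))) (at s)"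
    unfolding e_def by (rule DERIV_chain2[OF DERIV_exp])
  have "((\<lambda>s. s + b) has_real_derivative 1) (at s)"
    by (auto intro!: derivative_eq_intros)
  from DERIV_chain2[OF DERIV_real_sqrt[OF assms] this]
  have 2: "((\<lambda>s. sqrt (s + b)) has_real_derivative inverse r / 2) (at s)"
    by (simp add: r_def)
  have "((\<lambda>s. gauss_slab (s + b) z) has_real_derivative
      (e * (z\<^sup>2 / (4 * (s + b)\<^sup>2)) * r - e * (inverse r / 2)) / (r * r)) (at s)"
    using DERIV_divide[OF 1 2] assms by (simp add: gauss_slab_def e_def r_def)
  moreover have "(e * (z\<^sup>2 / (4 * (s + b)\<^sup>2)) * r - e * (inverse r / 2)) / (r * r)
      = (z\<^sup>2 / (4 * (s + b)\<^sup>2) - 1 / (2 * (s + b))) * (e / r)"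
    unfolding r(2) using r(1) by (simp add: field_simps power2_eq_square)
  ultimately show ?thesis by (simp add: gauss_slab_def e_def r_def)
qed

text \<open>The boundary data jump at time \<open>0\<close>. The slab around the hyperplane in which the boundary may
  lie has thickness \<open>2 \<eta> \<surd>t\<close>, and a Gaussian of total mass \<open>O(\<eta> \<surd>t)\<close> released there dominates the
  difference of the solutions until it is \<open>O(\<eta>)\<close> at time \<open>t\<close>.\<close>

lemma heat_half_space_approx:
  fixes \<Omega> :: "'a::euclidean_space set"
  assumes \<Omega>: "open \<Omega>" "bounded \<Omega>" and sol: "heat_solution \<Omega> f u" and t: "0 < t"
    and M: "\<And>y s. y \<in> closure \<Omega> \<Longrightarrow> 0 < s \<Longrightarrow> \<bar>u y s\<bar> \<le> M" and \<nu>: "norm \<nu> = 1"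
    and K: "0 < K" and \<eta>: "0 < \<eta>"
    and fr: "\<And>y. y \<in> frontier \<Omega> \<Longrightarrow> y \<in> cball x (K * sqrt t) \<Longrightarrow> \<bar>(y - a) \<bullet> \<nu>\<bar> \<le> \<eta> * sqrt t \<and> \<bar>f y - c\<bar> \<le> \<eta>"
    and ins: "\<And>y. y \<in> closure \<Omega> \<Longrightarrow> y \<in> cball x (K * sqrt t) \<Longrightarrow> - \<eta> * sqrt t \<le> (y - a) \<bullet> \<nu>"
    and x: "x \<in> closure \<Omega>"
  shows "\<bar>u x t - c * erfc2 ((x - a) \<bullet> \<nu> / sqrt t)\<bar>
    \<le> \<eta> + (M + 2 * \<bar>c\<bar>) * 2 * real DIM('a) / K\<^sup>2 + 5 * (M + 2 * \<bar>c\<bar>) * \<eta>"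
proof -
  define l where "l = sqrt t"
  have l: "0 < l" "t = l\<^sup>2" using t by (auto simp: l_def)
  define D where "D = \<Omega> \<inter> ball x (K * l)"
  define \<zeta> where "\<zeta> = (\<lambda>y. (y - a) \<bullet> \<nu>)"
  define E where "E = (\<lambda>y s. erfc2 (\<zeta> y / sqrt s))"
  \<comment> \<open>\<open>erfc2\<close> is bounded by 2, also at negative heights, whence the
    factor 2.\<close>
  define M1 where "M1 = M + 2 * \<bar>c\<bar>"
  \<comment> \<open>The Gaussian starts with width \<open>sqrt b = \<eta> * l\<close>, half the
    thickness of the slab.\<close>
  define b where "b = \<eta>\<^sup>2 * t"
  \<comment> \<open>Each summand solves the heat equation, so time derivative and Laplacian of the
    difference will coincide. The constant absorbs the oscillation of the data and the small initial
    values away from the slab, the quadratic term the spherical part of the boundary, the Gaussian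
    the jump at time 0. The 5 is the reciprocal of \<open>3 / 5 * (1 / 3)\<close>, the product of
    two lower bounds below.\<close>
  define S where "S = (\<lambda>y s. \<eta> + M1 / (K\<^sup>2 * t) * ((norm (y - x))\<^sup>2 + 2 * real DIM('a) * s)
    + 5 * M1 * \<eta> * l * gauss_slab (s + b) (\<zeta> y))"
  have b: "0 < b" using \<eta> t by (simp add: b_def)
  have sqrtb: "sqrt b = \<eta> * l" using \<eta> l by (simp add: b_def real_sqrt_mult)
  have Kl: "0 < K * l" using K l by simp
  have M0: "0 \<le> M" using M[OF x t] by linarith
  have M1: "0 \<le> M1" using M0 by (simp add: M1_def)
  have D: "open D" "bounded D" using \<Omega> by (auto simp: D_def intro: bounded_subset)
  have xD: "x \<in> closure D"
    using open_Int_closure_subset[of "ball x (K * l)" \<Omega>] x Kl by (auto simp: D_def Int_commute)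
  have clD: "y \<in> closure \<Omega>" "y \<in> cball x (K * l)" if "y \<in> closure D" for y
    using frontier_Int_ball_cases(1)[OF \<Omega>(1) Kl] that by (auto simp: D_def)
  have C2: "C2_on \<Omega> (\<lambda>z. u z s)" if "0 < s" for s
    using sol that unfolding heat_solution_def C21_on_def by auto
  have uf: "u y s = f y" if "y \<in> frontier \<Omega>" "0 < s" for y s
    using sol that unfolding heat_solution_def by auto
  have gs0: "0 \<le> gauss_slab s z" if "0 < s" for s z using that by (simp add: gauss_slab_def)
  have G0: "0 \<le> 5 * M1 * \<eta> * l * gauss_slab (s + b) (\<zeta> y)" if "0 < s" for s y
    using M1 \<eta> l b gs0[of "s + b" "\<zeta> y"] that by simp
  have Q0: "0 \<le> M1 / (K\<^sup>2 * t) * ((norm (y - x))\<^sup>2 + 2 * real DIM('a) * s)" if "0 < s" for s y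
    using M1 t that by simp
  have wM: "\<bar>u y s - c * E y s\<bar> \<le> M1" if "y \<in> closure \<Omega>" "0 < s" for y s
  proof -
    have "\<bar>E y s\<bar> \<le> 2" unfolding E_def using erfc2_nonneg erfc2_le_2 by (simp add: abs_le_iff add_nonneg_nonneg order_trans[of _ 0])
    then have "\<bar>c * E y s\<bar> \<le> 2 * \<bar>c\<bar>" by (simp add: abs_mult mult_left_mono mult.commute[of 2])
    then show ?thesis using M[OF that] by (auto simp: M1_def)
  qed
  have main: "\<sigma> * (u x t - c * E x t) - S x t \<le> 0" if \<sigma>: "\<bar>\<sigma>\<bar> = 1" for \<sigma>
  proof (rule parabolic_max_principle[OF D _ _ _ _ xD t order.refl, of "\<lambda>y s. \<sigma> * (u y s - c * E y s) - S y s"])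
    have [simp]: "s + b \<noteq> 0" "\<not> s + b < 0" "\<not> s + b \<le> 0" if "0 < s" for s using that b by auto
    show "continuous_on (closure D \<times> {0<..t}) (\<lambda>(y, s). \<sigma> * (u y s - c * E y s) - S y s)"
      unfolding S_def E_def gauss_slab_def \<zeta>_def case_prod_unfold
      by (intro continuous_intros continuous_on_heat_solution[OF sol]
          continuous_on_compose2[OF continuous_on_erfc2[of UNIV]])
         (use clD t b K in auto)
  next
    fix y s assume "y \<in> frontier D" and s: "0 < s" "s \<le> t"
    then consider "y \<in> frontier \<Omega>" "y \<in> cball x (K * l)" | "y \<in> closure \<Omega>" "dist x y = K * l"
      using frontier_Int_ball_cases(2)[OF \<Omega>(1) Kl] by (auto simp: D_def)
    then have "\<bar>u y s - c * E y s\<bar> \<le> S y s"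
    proof cases
      case 1
      have z: "\<bar>\<zeta> y\<bar> \<le> \<eta> * l" "\<bar>u y s - c\<bar> \<le> \<eta>"
        using fr[OF 1(1)] 1(2) uf[OF 1(1) s(1)] by (auto simp: \<zeta>_def l_def)
      \<comment> \<open>The ratio of the half-thickness of the slab to the diffusion length at time
        \<open>s\<close>.\<close>
      define \<rho> where "\<rho> = \<eta> * l / sqrt s"
      have \<rho>: "0 < \<rho>" using \<eta> l s by (simp add: \<rho>_def)
      have "\<bar>\<zeta> y / sqrt s\<bar> = \<bar>\<zeta> y\<bar> / sqrt s" using s by simp
      with abs_1_minus_erfc2_le[of "\<zeta> y / sqrt s"]
      have "\<bar>1 - E y s\<bar> \<le> min 1 (\<bar>\<zeta> y\<bar> / sqrt s)" unfolding E_def by metis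
      also have "\<bar>\<zeta> y\<bar> / sqrt s \<le> \<rho>" unfolding \<rho>_def using z(1) s by (simp add: divide_right_mono)
      finally have "\<bar>1 - E y s\<bar> \<le> min 1 \<rho>" by auto
      \<comment> \<open>In the slab the exponent is at least -1/4, so the exponential is at least
        1/3. The remaining factor is \<open>\<rho> / sqrt (1 + \<rho>\<^sup>2)\<close>, which is at
        least 3/5 of \<open>min 1 \<rho>\<close> because \<open>sqrt 2 < 5 / 3\<close>.\<close>
      also have "min 1 \<rho> \<le> 5 * (\<eta> * l * gauss_slab (s + b) (\<zeta> y))"
      proof -
        have "(\<zeta> y)\<^sup>2 \<le> (\<eta> * l)\<^sup>2" using z(1) by (metis abs_ge_zero power2_abs power_mono)
        then have "(\<zeta> y)\<^sup>2 \<le> b" by (simp add: b_def l power_mult_distrib)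
        then have "- 1 / 4 \<le> - (\<zeta> y)\<^sup>2 / (4 * (s + b))" using b s by (simp add: field_simps)
        then have e: "exp (- 1 / 4) \<le> exp (- (\<zeta> y)\<^sup>2 / (4 * (s + b)))" by simp
        have "exp (1/4::real) \<le> exp 1" by simp
        then have "exp (1/4::real) \<le> 3" using exp_le by linarith
        then have e3: "1 / 3 \<le> exp (- 1 / 4 :: real)" by (simp add: exp_minus field_simps)
        have "sqrt (s + b) = sqrt s * sqrt (1 + \<rho>\<^sup>2)"
          using s \<eta> l by (simp add: \<rho>_def b_def power_divide power_mult_distrib field_simps flip: real_sqrt_mult)
        then have "\<eta> * l / sqrt (s + b) = \<rho> / sqrt (1 + \<rho>\<^sup>2)" by (simp add: \<rho>_def)
        also have "\<rho> / sqrt (1 + \<rho>\<^sup>2) \<ge> min 1 \<rho> * (3 / 5)"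
        proof -
          have "(min 1 \<rho> * (3/5))\<^sup>2 * (1 + \<rho>\<^sup>2) \<le> \<rho>\<^sup>2"
          proof (cases "\<rho> \<le> 1")
            case True
            then have "\<rho>\<^sup>2 \<le> 1" using \<rho> by (simp add: power_le_one)
            then have "(3/5)\<^sup>2 * (1 + \<rho>\<^sup>2) \<le> 1" by (simp add: power2_eq_square)
            from mult_left_mono[OF this, of "\<rho>\<^sup>2"] True show ?thesis
              by (simp add: power_mult_distrib power_divide algebra_simps)
          next
            case False
            then have "1 \<le> \<rho>\<^sup>2" by simp
            then show ?thesis using False by (simp add: power2_eq_square)
          qed
          then have "sqrt ((min 1 \<rho> * (3/5))\<^sup>2 * (1 + \<rho>\<^sup>2)) \<le> sqrt (\<rho>\<^sup>2)"
            by (rule real_sqrt_le_mono)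
          then have "min 1 \<rho> * (3/5) * sqrt (1 + \<rho>\<^sup>2) \<le> \<rho>" using \<rho> by (simp add: real_sqrt_mult)
          then show ?thesis by (simp add: pos_le_divide_eq add_pos_nonneg)
        qed
        finally have "min 1 \<rho> * (3 / 5) * (1 / 3) \<le> \<eta> * l / sqrt (s + b) * exp (- (\<zeta> y)\<^sup>2 / (4 * (s + b)))"
          using order.trans[OF e3 e] \<rho> \<eta> l b s by (intro mult_mono) auto
        then show ?thesis by (simp add: gauss_slab_def field_simps)
      qed
      finally have "\<bar>c\<bar> * \<bar>1 - E y s\<bar> \<le> \<bar>c\<bar> * (5 * (\<eta> * l * gauss_slab (s + b) (\<zeta> y)))"
        by (rule mult_left_mono) simp
      also have "\<dots> \<le> M1 * (5 * (\<eta> * l * gauss_slab (s + b) (\<zeta> y)))"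
        using M0 \<eta> l b s gs0[of "s + b" "\<zeta> y"] by (intro mult_right_mono) (auto simp: M1_def)
      finally have "\<bar>c * (1 - E y s)\<bar> \<le> 5 * M1 * \<eta> * l * gauss_slab (s + b) (\<zeta> y)"
        by (simp add: abs_mult mult_ac)
      moreover have "u y s - c * E y s = (u y s - c) + c * (1 - E y s)" by (simp add: algebra_simps)
      ultimately show ?thesis using z(2) Q0[OF s(1), of y] by (simp add: S_def)
    next
      case 2
      have "\<bar>u y s - c * E y s\<bar> \<le> M1" using wM[OF 2(1) s(1)] .
      also have "M1 = M1 / (K\<^sup>2 * t) * (norm (y - x))\<^sup>2"
        using 2(2) K l by (simp add: dist_norm norm_minus_commute power_mult_distrib)
      also have "\<dots> \<le> M1 / (K\<^sup>2 * t) * ((norm (y - x))\<^sup>2 + 2 * real DIM('a) * s)"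
        using M1 t s by (intro mult_left_mono) auto
      also have "\<dots> \<le> S y s" using \<eta> G0[OF s(1), of y] by (simp add: S_def)
      finally show ?thesis .
    qed
    then show "\<sigma> * (u y s - c * E y s) - S y s \<le> 0" using \<sigma> by (auto simp: abs_if split: if_splits)
  next
    \<comment> \<open>Frontier points in the ball have height at most \<open>\<eta> * l\<close>, so
      the points at least twice as high form a compact subset of \<Omega>, on which both the
      solution and the profile become uniformly small as time tends to 0.\<close>
    define C where "C = closure D \<inter> {y. 2 * \<eta> * l \<le> \<zeta> y}"
    have "closed {y. 2 * \<eta> * l \<le> \<zeta> y}"
      unfolding \<zeta>_def by (intro closed_Collect_le continuous_intros)
    then have "compact C" unfolding C_def using D(2) by (intro compact_Int_closed) (auto simp: compact_closure)
    moreover have "C \<subseteq> \<Omega>"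
    proof
      fix y assume y: "y \<in> C"
      show "y \<in> \<Omega>"
      proof (rule ccontr)
        assume "y \<notin> \<Omega>"
        then have "y \<in> frontier \<Omega>" using clD(1)[of y] y \<Omega>(1) by (auto simp: C_def frontier_def interior_open)
        then have "\<zeta> y \<le> \<eta> * l" using fr[of y] clD(2)[of y] y by (auto simp: C_def \<zeta>_def l_def)
        moreover have "\<eta> * l > 0" using \<eta> l by simp
        ultimately show False using y by (auto simp: C_def)
      qed
    qed
    ultimately have ev1: "\<forall>\<^sub>F s in at_right 0. \<forall>y\<in>C. \<bar>u y s\<bar> \<le> \<eta> / 2"
      using heat_solution_initial_uniform[OF \<Omega>(1) sol, of C "\<eta> / 2"] \<eta> by simp
    have "filterlim (\<lambda>s. 2 * \<eta> * l / sqrt s) at_top (at_right 0)"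
      using \<eta> l by real_asymp
    from filterlim_compose[OF erfc2_at_top this]
    have "((\<lambda>s. \<bar>c\<bar> * erfc2 (2 * \<eta> * l / sqrt s)) \<longlongrightarrow> \<bar>c\<bar> * 0) (at_right 0)"
      by (intro tendsto_intros)
    then have ev2: "\<forall>\<^sub>F s in at_right 0. \<bar>c\<bar> * erfc2 (2 * \<eta> * l / sqrt s) < \<eta> / 2"
      using \<eta> by (auto dest: order_tendstoD(2)[of _ _ _ "\<eta> / 2"])
    have ev3: "\<forall>\<^sub>F s in at_right 0. s \<in> {0<..<b}"
      using b by (intro eventually_at_right_real) auto
    show "\<forall>\<^sub>F s in at_right 0. \<forall>y\<in>closure D. \<sigma> * (u y s - c * E y s) - S y s \<le> 0"
      using ev1 ev2 ev3
    proof eventually_elim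
      case (elim s)
      then have s: "0 < s" "s < b" by auto
      show ?case
      proof
        fix y assume y: "y \<in> closure D"
        have "\<bar>u y s - c * E y s\<bar> \<le> S y s"
        proof (cases "2 * \<eta> * l \<le> \<zeta> y")
          case True
          then have "y \<in> C" using y by (simp add: C_def)
          then have "\<bar>u y s\<bar> \<le> \<eta> / 2" using elim by blast
          moreover have "E y s \<le> erfc2 (2 * \<eta> * l / sqrt s)"
            unfolding E_def using True s by (intro erfc2_antimono divide_right_mono) auto
          then have "\<bar>c * E y s\<bar> \<le> \<bar>c\<bar> * erfc2 (2 * \<eta> * l / sqrt s)"
            using erfc2_nonneg by (simp add: abs_mult E_def mult_left_mono)
          ultimately have "\<bar>u y s - c * E y s\<bar> \<le> \<eta>" using elim by linarith
          then show ?thesis using G0[OF s(1), of y] Q0[OF s(1), of y] by (simp add: S_def)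
        next
          case False
          \<comment> \<open>Below height \<open>2 * \<eta> * l\<close> the Gaussian alone suffices:
            for \<open>s < b\<close> the exponent is at least -1 and \<open>sqrt (s + b)\<close> at
            most \<open>5 / 3 * (\<eta> * l)\<close>, which again gives the product 1/5.\<close>
          have "- (\<eta> * l) \<le> \<zeta> y" using ins[OF clD(1)[OF y]] clD(2)[OF y] by (simp add: \<zeta>_def l_def)
          then have "\<bar>\<zeta> y\<bar> \<le> 2 * (\<eta> * l)" using False \<eta> l by (auto simp: abs_le_iff)
          then have "\<bar>\<zeta> y\<bar>\<^sup>2 \<le> (2 * (\<eta> * l))\<^sup>2" by (intro power_mono) auto
          then have "(\<zeta> y)\<^sup>2 \<le> 4 * b" by (simp add: b_def l power_mult_distrib)
          then have "- 1 \<le> - (\<zeta> y)\<^sup>2 / (4 * (s + b))" using b s by (simp add: field_simps)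
          then have e: "exp (- 1) \<le> exp (- (\<zeta> y)\<^sup>2 / (4 * (s + b)))" by simp
          have e3: "1 / 3 \<le> exp (- 1 :: real)" using exp_le by (simp add: exp_minus field_simps)
          have "sqrt (s + b) \<le> sqrt (2 * b)" using s by simp
          also have "\<dots> \<le> sqrt ((5/3)\<^sup>2 * b)" using b by (intro real_sqrt_le_mono mult_right_mono) (auto simp: power2_eq_square)
          also have "\<dots> = 5 / 3 * (\<eta> * l)" by (simp add: real_sqrt_mult sqrtb)
          finally have "3 / 5 \<le> \<eta> * l / sqrt (s + b)" using s b by (simp add: field_simps)
          then have "3 / 5 * (1 / 3) \<le> \<eta> * l / sqrt (s + b) * exp (- (\<zeta> y)\<^sup>2 / (4 * (s + b)))"
            using order.trans[OF e3 e] \<eta> l s b by (intro mult_mono) auto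
          then have "1 \<le> 5 * (\<eta> * l * gauss_slab (s + b) (\<zeta> y))"
            by (simp add: gauss_slab_def mult_ac)
          from mult_left_mono[OF this M1]
          have "M1 \<le> 5 * M1 * \<eta> * l * gauss_slab (s + b) (\<zeta> y)" by (simp add: mult_ac)
          then show ?thesis using wM[OF clD(1)[OF y] s(1)] \<eta> Q0[OF s(1), of y] by (simp add: S_def)
        qed
        then show "\<sigma> * (u y s - c * E y s) - S y s \<le> 0" using \<sigma> by (auto simp: abs_if split: if_splits)
      qed
    qed
  next
    fix y s assume y: "y \<in> D" and s: "0 < s" "s \<le> t"
    then have y\<Omega>: "y \<in> \<Omega>" by (simp add: D_def)
    have sb: "0 < s + b" using s b by simp
    define L where "L = laplacian (\<lambda>z. u z s) y"
    define e where "e = \<zeta> y / (2 * s * sqrt s) * erfc2_kernel (\<zeta> y / sqrt s)"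
    define g where "g = ((\<zeta> y)\<^sup>2 / (4 * (s + b)\<^sup>2) - 1 / (2 * (s + b))) * gauss_slab (s + b) (\<zeta> y)"
    have "has_laplacian (\<lambda>z. u z s) y L"
      unfolding L_def by (rule C2_on_has_laplacian[OF \<Omega>(1) C2[OF s(1)] y\<Omega>])
    moreover have "has_laplacian (\<lambda>z. E z s) y e"
      unfolding E_def e_def \<zeta>_def by (rule has_laplacian_erfc2[OF \<nu> s(1)])
    moreover have "has_laplacian (\<lambda>z. gauss_slab (s + b) (\<zeta> z)) y g"
      unfolding g_def \<zeta>_def by (rule has_laplacian_gauss_slab[OF \<nu> sb])
    ultimately have "has_laplacian (\<lambda>y. \<sigma> * (u y s - c * E y s) - S y s) y
        (\<sigma> * (L - c * e) - (0 + M1 / (K\<^sup>2 * t) * (2 * real DIM('a) + 0) + 5 * M1 * \<eta> * l * g))"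
      unfolding S_def
      by (intro has_laplacian_diff has_laplacian_add has_laplacian_cmult has_laplacian_const
          has_laplacian_norm_power2)
    moreover have "((\<lambda>s. \<sigma> * (u y s - c * E y s) - S y s) has_real_derivative
        (\<sigma> * (L - c * e) - (0 + M1 / (K\<^sup>2 * t) * (2 * real DIM('a) + 0) + 5 * M1 * \<eta> * l * g))) (at s)"
    proof -
      have 1: "(u y has_real_derivative L) (at s)"
        unfolding L_def by (rule heat_solution_DERIV_time[OF sol y\<Omega> s(1)])
      have 2: "((\<lambda>s. E y s) has_real_derivative e) (at s)"
        unfolding E_def e_def by (rule DERIV_erfc2_time[OF s(1)])
      have 3: "((\<lambda>s. gauss_slab (s + b) (\<zeta> y)) has_real_derivative g) (at s)"
        unfolding g_def by (rule DERIV_gauss_slab_time[OF sb])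
      have 4: "((\<lambda>s. 2 * real DIM('a) * s) has_real_derivative 2 * real DIM('a)) (at s)"
        by (auto intro!: derivative_eq_intros)
      have 5: "((\<lambda>s. (norm (y - x))\<^sup>2 + 2 * real DIM('a) * s) has_real_derivative 2 * real DIM('a) + 0) (at s)"
        using DERIV_add[OF DERIV_const 4, of "(norm (y - x))\<^sup>2"] by simp
      show ?thesis unfolding S_def
        by (intro DERIV_diff DERIV_add[OF DERIV_add] DERIV_cmult DERIV_const 1 2 3 5)
    qed
    ultimately show "\<exists>l d. has_laplacian (\<lambda>z. \<sigma> * (u z s - c * E z s) - S z s) y l \<and>
        ((\<lambda>s. \<sigma> * (u y s - c * E y s) - S y s) has_real_derivative d) (at s) \<and> d \<le> l"
      by blast
  qed
  have "\<bar>u x t - c * E x t\<bar> \<le> S x t" using main[of 1] main[of "-1"] by (simp add: abs_le_iff)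
  also have "S x t = \<eta> + M1 * 2 * real DIM('a) / K\<^sup>2 + 5 * M1 * \<eta> * (l * gauss_slab (t + b) (\<zeta> x))"
    using t K by (simp add: S_def)
  also have "l * gauss_slab (t + b) (\<zeta> x) \<le> 1"
  proof -
    have "exp (- (\<zeta> x)\<^sup>2 / (4 * (t + b))) \<le> 1" using t b by simp
    moreover have "l \<le> sqrt (t + b)" unfolding l_def using b by simp
    ultimately have "l * exp (- (\<zeta> x)\<^sup>2 / (4 * (t + b))) \<le> sqrt (t + b) * 1"
      using l by (intro mult_mono) (use t b in auto)
    then show ?thesis using t b by (simp add: gauss_slab_def)
  qed
  then have "5 * M1 * \<eta> * (l * gauss_slab (t + b) (\<zeta> x)) \<le> 5 * M1 * \<eta> * 1"
    using M1 \<eta> by (intro mult_left_mono) auto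
  finally show ?thesis by (simp add: E_def \<zeta>_def M1_def)
qed

text \<open>The growth rate \<open>1 / t\<close> in time is the factor by which the Laplacian
  multiplies \<open>cosh_sum\<close> at length \<open>sqrt t\<close>, so the barrier solves the heat
  equation; at \<open>s = t\<close> this costs the factor \<open>exp 1\<close>. With
  \<open>M + 1\<close> in place of \<open>M\<close> the amplitude \<open>A\<close> is positive even
  for \<open>M = 0\<close>, and the smallness of \<open>u\<close> at early times can be measured
  against it.\<close>

lemma heat_interior_decay:
  fixes \<Omega> :: "'a::euclidean_space set"
  assumes \<Omega>: "open \<Omega>" and sol: "heat_solution \<Omega> f u" and t: "0 < t"
    and M: "\<And>y s. y \<in> \<Omega> \<Longrightarrow> 0 < s \<Longrightarrow> \<bar>u y s\<bar> \<le> M" and d: "0 < d" and ball: "cball x d \<subseteq> \<Omega>"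
  shows "\<bar>u x t\<bar> \<le> 2 * real DIM('a) * (M + 1) * exp 1 * exp (- d / (sqrt (real DIM('a)) * sqrt t))"
proof -
  define \<epsilon> where "\<epsilon> = sqrt t"
  have \<epsilon>: "0 < \<epsilon>" "\<epsilon>\<^sup>2 = t" using t by (auto simp: \<epsilon>_def)
  define A where "A = (M + 1) * exp (- d / (sqrt (real DIM('a)) * \<epsilon>))"
  define S where "S = (\<lambda>y s. A * exp (s / t) * cosh_sum \<epsilon> (y - x))"
  have "x \<in> \<Omega>" using ball d by auto
  from M[OF this t] have "0 \<le> M" by linarith
  then have A: "0 < A" by (simp add: A_def)
  have clS: "closure (ball x d) = cball x d" using d by simp
  have C2: "C2_on \<Omega> (\<lambda>z. u z s)" if "0 < s" for s
    using sol that unfolding heat_solution_def C21_on_def by auto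
  have SA: "A * 1 * exp (norm (y - x) / (sqrt (real DIM('a)) * \<epsilon>)) \<le> S y s" if "0 < s" for y s
    unfolding S_def using A t that cosh_sum_ge_exp[OF \<epsilon>(1), of "y - x"]
    by (intro mult_mono) auto
  have main: "\<sigma> * u x t - S x t \<le> 0" if \<sigma>: "\<bar>\<sigma>\<bar> = 1" for \<sigma>
  proof (rule parabolic_max_principle[of "ball x d" t "\<lambda>y s. \<sigma> * u y s - S y s"])
    show "continuous_on (closure (ball x d) \<times> {0<..t}) (\<lambda>(y, s). \<sigma> * u y s - S y s)"
      unfolding S_def case_prod_unfold
      by (intro continuous_intros continuous_on_cosh_sum continuous_on_heat_solution[OF sol])
         (use d t ball closure_subset[of \<Omega>] in auto)
  next
    fix y s assume "y \<in> frontier (ball x d)" and s: "0 < s" "s \<le> t"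
    then have y: "norm (y - x) = d" "y \<in> cball x d" using d by (auto simp: dist_norm norm_minus_commute)
    have "\<bar>u y s\<bar> \<le> (M + 1) * 1" using M[of y s] y(2) ball s by auto
    also have "\<dots> = A * 1 * exp (norm (y - x) / (sqrt (real DIM('a)) * \<epsilon>))"
      by (simp add: A_def y(1) exp_minus)
    also have "\<dots> \<le> S y s" by (rule SA[OF s(1)])
    finally show "\<sigma> * u y s - S y s \<le> 0" using \<sigma> by (auto simp: abs_if split: if_splits)
  next
    have "\<forall>\<^sub>F s in at_right 0. \<forall>y\<in>cball x d. \<bar>u y s\<bar> \<le> A"
      by (rule heat_solution_initial_uniform[OF \<Omega> sol _ ball A]) simp
    moreover have "\<forall>\<^sub>F s in at_right (0::real). 0 < s" by (simp add: eventually_at_right_less)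
    ultimately show "\<forall>\<^sub>F s in at_right 0. \<forall>y\<in>closure (ball x d). \<sigma> * u y s - S y s \<le> 0"
    proof eventually_elim
      case (elim s)
      show ?case
      proof
        fix y assume "y \<in> closure (ball x d)"
        then have "\<bar>u y s\<bar> \<le> A * 1" using elim clS by auto
        also have "\<dots> \<le> A * exp (norm (y - x) / (sqrt (real DIM('a)) * \<epsilon>))"
          using A \<epsilon> by (intro mult_left_mono) auto
        also have "\<dots> \<le> S y s" using SA[of s y] elim by simp
        finally show "\<sigma> * u y s - S y s \<le> 0" using \<sigma> by (auto simp: abs_if split: if_splits)
      qed
    qed
  next
    fix y s assume y: "y \<in> ball x d" and s: "0 < s" "s \<le> t"
    then have y\<Omega>: "y \<in> \<Omega>" using ball by auto
    define L where "L = laplacian (\<lambda>z. u z s) y"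
    have "has_laplacian (\<lambda>y. \<sigma> * u y s - S y s) y (\<sigma> * L - A * exp (s / t) * (cosh_sum \<epsilon> (y - x) / \<epsilon>\<^sup>2))"
      unfolding S_def L_def
      by (intro has_laplacian_diff has_laplacian_cmult has_laplacian_cosh_sum \<epsilon>
          C2_on_has_laplacian[OF \<Omega> C2[OF s(1)] y\<Omega>])
    moreover have "((\<lambda>s. \<sigma> * u y s - S y s) has_real_derivative
        \<sigma> * L - A * exp (s / t) * (cosh_sum \<epsilon> (y - x) / \<epsilon>\<^sup>2)) (at s)"
    proof -
      have "(u y has_real_derivative L) (at s)"
        unfolding L_def by (rule heat_solution_DERIV_time[OF sol y\<Omega> s(1)])
      then show ?thesis unfolding S_def \<epsilon>(2) using t
        by (auto intro!: derivative_eq_intros)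
    qed
    ultimately show "\<exists>l d. has_laplacian (\<lambda>z. \<sigma> * u z s - S z s) y l \<and>
        ((\<lambda>s. \<sigma> * u y s - S y s) has_real_derivative d) (at s) \<and> d \<le> l"
      by blast
  qed (use d t in auto)
  have "\<bar>u x t\<bar> \<le> S x t" using main[of 1] main[of "-1"] by (simp add: abs_le_iff)
  then show ?thesis using t by (simp add: S_def A_def cosh_sum_0 \<epsilon>_def mult_ac)
qed

section \<open>Gaussian integrals over sectors\<close>

text \<open>Uniqueness of Haar measure, in the form: evaluate \<open>\<integral>\<integral> 1\<^sub>A(L x) 1\<^sub>B(L x - y) dy dx\<close> in both orders,
  for the unit ball \<open>B\<close>, which \<open>L\<close> preserves.\<close>

lemma distr_lborel_orthogonal:
  fixes L :: "'a::euclidean_space \<Rightarrow> 'a"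
  assumes L: "orthogonal_transformation L"
  shows "distr lborel borel L = lborel"
proof -
  define B where "B = ball (0::'a) 1"
  have lin: "linear L" using L by (rule orthogonal_transformation_linear)
  have L_meas [measurable]: "L \<in> borel_measurable borel"
    using lin by (intro borel_measurable_continuous_onI linear_continuous_on linear_conv_bounded_linear[THEN iffD1])
  have LB: "L x \<in> B \<longleftrightarrow> x \<in> B" for x
    using orthogonal_transformation_norm[OF L] by (simp add: B_def)
  have B_meas [measurable]: "B \<in> sets borel" by (simp add: B_def)
  have Bball: "(\<integral>\<^sup>+y. indicator B (x - y) \<partial>lborel) = emeasure lborel B" for x :: 'a
  proof -
    have "(\<integral>\<^sup>+y. indicator B (x - y) \<partial>lborel) = (\<integral>\<^sup>+y. indicator (ball x 1) y \<partial>lborel)"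
      by (intro nn_integral_cong) (auto simp: B_def indicator_def dist_norm norm_minus_commute)
    also have "\<dots> = emeasure lborel B" by (simp add: B_def emeasure_ball)
    finally show ?thesis .
  qed
  have Bfin: "emeasure lborel B \<noteq> 0" "emeasure lborel B \<noteq> \<infinity>"
    unfolding B_def by (simp_all add: emeasure_ball unit_ball_vol_pos less_imp_neq[THEN not_sym])
  have eq: "emeasure (distr lborel borel L) A = emeasure lborel A" if A [measurable]: "A \<in> sets borel" for A
  proof -
    have emL: "emeasure (distr lborel borel L) A = (\<integral>\<^sup>+x. indicator A (L x) \<partial>lborel)"
      using nn_integral_distr[of L lborel borel "indicator A"] by simp
    have "emeasure (distr lborel borel L) A * emeasure lborel B
      = (\<integral>\<^sup>+x. indicator A (L x) * emeasure lborel B \<partial>lborel)"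
      by (subst nn_integral_multc) (auto simp: emL)
    also have "\<dots> = (\<integral>\<^sup>+x. \<integral>\<^sup>+y. indicator A (L x) * indicator B (L x - y) \<partial>lborel \<partial>lborel)"
      by (simp add: nn_integral_cmult Bball)
    also have "\<dots> = (\<integral>\<^sup>+y. \<integral>\<^sup>+x. indicator A (L x) * indicator B (L x - y) \<partial>lborel \<partial>lborel)"
      by (rule lborel_pair.Fubini') measurable
    also have "\<dots> = (\<integral>\<^sup>+y. \<integral>\<^sup>+x. indicator A (L x + y) * indicator B x \<partial>lborel \<partial>lborel)"
    proof (rule nn_integral_cong)
      fix y :: 'a
      \<comment> \<open>Translating \<open>x\<close> by a preimage of \<open>y\<close> turns
        \<open>L x - y \<in> B\<close> into \<open>L x \<in> B\<close>, which is
        \<open>x \<in> B\<close>.\<close>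
      obtain a where a: "L a = y" using orthogonal_transformation_surj[OF L] by (metis surjD)
      have "(\<integral>\<^sup>+x. indicator A (L x) * indicator B (L x - y) \<partial>lborel)
          = (\<integral>\<^sup>+x. indicator A (L x) * indicator B (L x - y) \<partial>distr lborel borel ((+) a) :: ennreal)"
        by (simp add: lborel_distr_plus)
      also have "\<dots> = (\<integral>\<^sup>+x. indicator A (L (a + x)) * indicator B (L (a + x) - y) \<partial>lborel)"
        by (subst nn_integral_distr) auto
      also have "\<dots> = (\<integral>\<^sup>+x. indicator A (L x + y) * indicator B x \<partial>lborel)"
        using LB by (intro nn_integral_cong) (simp add: linear_add[OF lin] a add.commute indicator_def)
      finally show "(\<integral>\<^sup>+x. indicator A (L x) * indicator B (L x - y) \<partial>lborel)
        = (\<integral>\<^sup>+x. indicator A (L x + y) * indicator B x \<partial>lborel :: ennreal)" .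
    qed
    also have "\<dots> = (\<integral>\<^sup>+x. \<integral>\<^sup>+y. indicator A (L x + y) * indicator B x \<partial>lborel \<partial>lborel)"
      by (rule lborel_pair.Fubini') measurable
    also have "\<dots> = (\<integral>\<^sup>+x. emeasure lborel A * indicator B x \<partial>lborel)"
    proof (intro nn_integral_cong)
      fix x :: 'a
      have "(\<integral>\<^sup>+y. indicator A (L x + y) \<partial>lborel) = (\<integral>\<^sup>+y. indicator A y \<partial>distr lborel borel ((+) (L x)) :: ennreal)"
        by (subst nn_integral_distr) auto
      also have "\<dots> = emeasure lborel A" by (simp add: lborel_distr_plus)
      finally show "(\<integral>\<^sup>+y. indicator A (L x + y) * indicator B x \<partial>lborel) = emeasure lborel A * indicator B x"
        by (simp add: nn_integral_multc)
    qed
    also have "\<dots> = emeasure lborel A * emeasure lborel B" by (simp add: nn_integral_cmult)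
    finally show ?thesis
      using Bfin by (simp add: mult.commute[of _ "emeasure lborel B"] ennreal_mult_cancel_left)
  qed
  show ?thesis by (rule measure_eqI) (auto simp: eq)
qed

section \<open>Stretching orthogonally to an axis\<close>

definition stretch :: "'a::euclidean_space \<Rightarrow> real \<Rightarrow> 'a \<Rightarrow> 'a" where
  "stretch b s v = (v \<bullet> b) *\<^sub>R b + s *\<^sub>R (v - (v \<bullet> b) *\<^sub>R b)"

lemma stretch_measurable [measurable]: "stretch b s \<in> borel_measurable borel"
  unfolding stretch_def[abs_def] by measurable

lemma lborel_stretch:
  fixes b :: "'a::euclidean_space"
  assumes b: "b \<in> Basis" and s: "0 < s"
  shows "lborel = density (distr lborel borel (stretch b s)) (\<lambda>_. ennreal (s ^ (DIM('a) - 1)))"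
proof -
  define c where "c = (\<lambda>j::'a. if j = b then 1 else s)"
  have "stretch b s = (\<lambda>x. 0 + (\<Sum>j\<in>Basis. (c j * (x \<bullet> j)) *\<^sub>R j))"
  proof
    fix x
    have "stretch b s x = (\<Sum>j\<in>Basis. (stretch b s x \<bullet> j) *\<^sub>R j)" by (simp add: euclidean_representation)
    also have "\<dots> = (\<Sum>j\<in>Basis. (c j * (x \<bullet> j)) *\<^sub>R j)"
      using b by (intro sum.cong) (auto simp: stretch_def c_def inner_add_left inner_diff_left inner_Basis)
    finally show "stretch b s x = 0 + (\<Sum>j\<in>Basis. (c j * (x \<bullet> j)) *\<^sub>R j)" by simp
  qed
  moreover have "(\<Prod>j\<in>Basis. \<bar>c j\<bar>) = s ^ (DIM('a) - 1)"
  proof -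
    have "(\<Prod>j\<in>Basis. \<bar>c j\<bar>) = \<bar>c b\<bar> * (\<Prod>j\<in>Basis - {b}. \<bar>c j\<bar>)" using b by (simp add: prod.remove)
    also have "(\<Prod>j\<in>Basis - {b}. \<bar>c j\<bar>) = (\<Prod>j\<in>Basis - {b}. s)"
      using s by (intro prod.cong) (auto simp: c_def)
    finally show ?thesis using b by (simp add: c_def)
  qed
  ultimately show ?thesis
    using lborel_affine_euclidean[of c 0] s by (simp add: c_def)
qed

lemma nn_integral_stretch:
  fixes b :: "'a::euclidean_space"
  assumes b: "b \<in> Basis" and s: "0 < s" and [measurable]: "f \<in> borel_measurable borel"
  shows "(\<integral>\<^sup>+v. f v \<partial>lborel) = ennreal (s ^ (DIM('a) - 1)) * (\<integral>\<^sup>+v. f (stretch b s v) \<partial>lborel)"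
  by (subst lborel_stretch[OF b s]) (simp add: nn_integral_density nn_integral_distr nn_integral_cmult)

lemma integral_stretch:
  fixes b :: "'a::euclidean_space" and f :: "'a \<Rightarrow> real"
  assumes b: "b \<in> Basis" and s: "0 < s" and [measurable]: "f \<in> borel_measurable borel"
  shows "(LINT v|lborel. f v) = s ^ (DIM('a) - 1) * (LINT v|lborel. f (stretch b s v))"
  by (subst lborel_stretch[OF b s]) (use s in \<open>simp add: integral_density integral_distr\<close>)

lemma integral_orthogonal:
  fixes L :: "'a::euclidean_space \<Rightarrow> 'a" and f :: "'a \<Rightarrow> real"
  assumes L: "orthogonal_transformation L" and [measurable]: "f \<in> borel_measurable borel"
  shows "(LINT v|lborel. f v) = (LINT v|lborel. f (L v))"
proof -
  have [measurable]: "L \<in> borel_measurable borel"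
    using orthogonal_transformation_linear[OF L]
    by (intro borel_measurable_continuous_onI linear_continuous_on linear_conv_bounded_linear[THEN iffD1])
  show ?thesis by (subst distr_lborel_orthogonal[OF L, symmetric]) (simp add: integral_distr)
qed

text \<open>Fubini with the coordinate along \<open>b\<close> outermost: below, the width of the
  Gaussian depends on this height, and only at fixed height do the other coordinates
  separate.\<close>

lemma nn_integral_lborel_split:
  fixes b :: "'a::euclidean_space"
  assumes b: "b \<in> Basis" and [measurable]: "f \<in> borel_measurable borel"
  shows "(\<integral>\<^sup>+v. f v \<partial>lborel) = (\<integral>\<^sup>+x. \<integral>\<^sup>+w. f (x *\<^sub>R b + (\<Sum>i\<in>Basis - {b}. w i *\<^sub>R i)) \<partial>(\<Pi>\<^sub>M i\<in>Basis - {b}. lborel) \<partial>lborel)"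
proof -
  interpret product_sigma_finite "\<lambda>_::'a. lborel :: real measure" ..
  have ins: "insert b (Basis - {b}) = (Basis :: 'a set)" using b by auto
  have "(\<integral>\<^sup>+v. f v \<partial>lborel) = (\<integral>\<^sup>+w. f (\<Sum>i\<in>Basis. w i *\<^sub>R i) \<partial>(\<Pi>\<^sub>M i\<in>insert b (Basis - {b}). lborel))"
    unfolding ins by (subst lborel_eq) (simp add: nn_integral_distr)
  also have "\<dots> = (\<integral>\<^sup>+x. \<integral>\<^sup>+w. f (\<Sum>i\<in>Basis. (w(b := x)) i *\<^sub>R i) \<partial>(\<Pi>\<^sub>M i\<in>Basis - {b}. lborel) \<partial>lborel)"
    by (rule product_nn_integral_insert_rev) (auto simp: ins)
  also have "\<dots> = (\<integral>\<^sup>+x. \<integral>\<^sup>+w. f (x *\<^sub>R b + (\<Sum>i\<in>Basis - {b}. w i *\<^sub>R i)) \<partial>(\<Pi>\<^sub>M i\<in>Basis - {b}. lborel) \<partial>lborel)"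
  proof (intro nn_integral_cong arg_cong[where f=f])
    fix x :: real and w :: "'a \<Rightarrow> real"
    have "(\<Sum>i\<in>Basis. (w(b := x)) i *\<^sub>R i) = x *\<^sub>R b + (\<Sum>i\<in>Basis - {b}. (w(b := x)) i *\<^sub>R i)"
      using b by (simp add: sum.remove[of Basis b])
    also have "(\<Sum>i\<in>Basis - {b}. (w(b := x)) i *\<^sub>R i) = (\<Sum>i\<in>Basis - {b}. w i *\<^sub>R i)"
      by (intro sum.cong) auto
    finally show "(\<Sum>i\<in>Basis. (w(b := x)) i *\<^sub>R i) = x *\<^sub>R b + (\<Sum>i\<in>Basis - {b}. w i *\<^sub>R i)" .
  qed
  finally show ?thesis .
qed

lemma nn_integral_exp_minus_square:
  assumes "0 < a"
  shows "(\<integral>\<^sup>+x. ennreal (exp (- a * x\<^sup>2)) \<partial>lborel) = ennreal (sqrt (pi / a))"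
proof -
  define s where "s = sqrt (1 / (2 * a))"
  have s: "0 < s" "s\<^sup>2 = 1 / (2 * a)" using assms by (auto simp: s_def)
  have eq: "exp (- a * x\<^sup>2) = sqrt (pi / a) * normal_density 0 s x" for x
    using assms by (simp add: normal_density_def s field_simps real_sqrt_divide)
  have "(\<integral>\<^sup>+x. ennreal (normal_density 0 s x) \<partial>lborel) = 1"
    using s by (subst nn_integral_eq_integral) auto
  then show ?thesis
    unfolding eq using assms by (simp add: ennreal_mult nn_integral_cmult)
qed

text \<open>Used with \<open>a i = 1 / R - k i\<close>, when it is the leading term of the height of
  the sphere above the boundary: half the difference of the two curvature forms at the touching
  point, in coordinates transported to the standard basis.\<close>

definition tangential_form :: "'a::euclidean_space \<Rightarrow> ('a \<Rightarrow> real) \<Rightarrow> 'a \<Rightarrow> real" where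
  "tangential_form b a v = (\<Sum>i\<in>Basis - {b}. a i * (v \<bullet> i)\<^sup>2) / 2"

lemma tangential_form_measurable [measurable]: "tangential_form b a \<in> borel_measurable borel"
  unfolding tangential_form_def[abs_def] by measurable

lemma tangential_form_nonneg:
  "(\<And>i. i \<in> Basis - {b} \<Longrightarrow> 0 < a i) \<Longrightarrow> 0 \<le> tangential_form b a v"
  unfolding tangential_form_def
  by (intro divide_nonneg_nonneg sum_nonneg mult_nonneg_nonneg) (auto intro: less_imp_le)

lemma tangential_form_stretch:
  assumes "b \<in> Basis" 
  shows "tangential_form b a (stretch b s v) = s\<^sup>2 * tangential_form b a v"
proof -
  have "stretch b s v \<bullet> i = s * (v \<bullet> i)" if "i \<in> Basis - {b}" for i
    using that assms by (auto simp: stretch_def inner_add_left inner_diff_left inner_Basis)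
  then show ?thesis
    by (simp add: tangential_form_def power_mult_distrib sum_distrib_left mult_ac)
qed

text \<open>A point \<open>v\<close> with height \<open>\<sigma> = v \<bullet> b\<close> is projected radially to the sphere of radius \<open>R\<close>, which
  multiplies its small tangential part by \<open>R / \<sigma>\<close>.\<close>

definition sector_integral :: "'a::euclidean_space \<Rightarrow> ('a \<Rightarrow> real) \<Rightarrow> real \<Rightarrow> (real \<Rightarrow> ennreal) \<Rightarrow> ennreal" where
  "sector_integral b a R F =
     (\<integral>\<^sup>+v. indicator {0<..<R} (v \<bullet> b) * F ((R / (v \<bullet> b))\<^sup>2 * tangential_form b a v) \<partial>lborel)"

lemma sqrt_prod: "sqrt (\<Prod>i\<in>I. a i) = (\<Prod>i\<in>I. sqrt (a i))"
  by (induction I rule: infinite_finite_induct) (auto simp: real_sqrt_mult)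

text \<open>At height \<open>x\<close> the direction \<open>i\<close> contributes the Gaussian
  integral \<open>sqrt (2 * pi) * x / R / sqrt (a i)\<close>. The resulting power of
  \<open>x / R\<close> integrates over the heights to \<open>R / real DIM('a)\<close>.\<close>

lemma sector_integral_exp:
  fixes b :: "'a::euclidean_space"
  assumes b: "b \<in> Basis" and a: "\<And>i. i \<in> Basis - {b} \<Longrightarrow> 0 < a i" and R: "0 < R"
  shows "sector_integral b a R (\<lambda>s. ennreal (exp (- s)))
    = ennreal (sqrt (2 * pi) ^ (DIM('a) - 1) / sqrt (\<Prod>i\<in>Basis - {b}. a i) * R / real DIM('a))"
proof -
  interpret product_sigma_finite "\<lambda>_::'a. lborel :: real measure" ..
  let ?n = "DIM('a) - 1"
  define P where "P = sqrt (2 * pi) ^ ?n / sqrt (\<Prod>i\<in>Basis - {b}. a i)"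
  have "0 \<le> (\<Prod>i\<in>Basis - {b}. a i)" by (intro prod_nonneg less_imp_le[OF a])
  then have P: "0 \<le> P" by (simp add: P_def)
  have "sector_integral b a R (\<lambda>s. ennreal (exp (- s)))
    = (\<integral>\<^sup>+x. \<integral>\<^sup>+w. indicator {0<..<R} x * (\<Prod>i\<in>Basis - {b}. ennreal (exp (- ((R / x)\<^sup>2 * a i / 2) * (w i)\<^sup>2)))
        \<partial>(\<Pi>\<^sub>M i\<in>Basis - {b}. lborel) \<partial>lborel)"
    unfolding sector_integral_def
  proof (subst nn_integral_lborel_split[OF b], measurable, intro nn_integral_cong)
    fix x :: real and w :: "'a \<Rightarrow> real"
    define v where "v = x *\<^sub>R b + (\<Sum>i\<in>Basis - {b}. w i *\<^sub>R i)"
    have vb: "v \<bullet> b = x" using b by (simp add: v_def inner_add_left inner_sum_left inner_Basis sum.If_cases)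
    have vi: "v \<bullet> i = w i" if "i \<in> Basis - {b}" for i
    proof -
      have "v \<bullet> i = (\<Sum>j\<in>Basis - {b}. w j * (j \<bullet> i))"
        using that b by (auto simp: v_def inner_add_left inner_sum_left inner_not_same_Basis)
      also have "\<dots> = (\<Sum>j\<in>Basis - {b}. if j = i then w j else 0)"
        using that by (intro sum.cong) (auto simp: inner_Basis)
      also have "\<dots> = w i" using that by (simp add: sum.delta)
      finally show ?thesis .
    qed
    have "exp (- ((R / x)\<^sup>2 * tangential_form b a v)) = (\<Prod>i\<in>Basis - {b}. exp (- ((R / x)\<^sup>2 * a i / 2) * (w i)\<^sup>2))"
      by (simp add: exp_sum[symmetric] tangential_form_def vi sum_negf sum_distrib_left sum_divide_distrib mult_ac)
    then show "indicator {0<..<R} (v \<bullet> b) * ennreal (exp (- ((R / (v \<bullet> b))\<^sup>2 * tangential_form b a v)))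
      = indicator {0<..<R} x * (\<Prod>i\<in>Basis - {b}. ennreal (exp (- ((R / x)\<^sup>2 * a i / 2) * (w i)\<^sup>2)))"
      by (simp add: vb prod_ennreal)
  qed
  also have "\<dots> = (\<integral>\<^sup>+x. ennreal (P / R ^ ?n) * ennreal (x ^ ?n) * indicator {0..R} x \<partial>lborel)"
  proof (rule nn_integral_cong_AE)
    show "AE x in lborel. (\<integral>\<^sup>+w. indicator {0<..<R} x * (\<Prod>i\<in>Basis - {b}. ennreal (exp (- ((R / x)\<^sup>2 * a i / 2) * (w i)\<^sup>2)))
        \<partial>(\<Pi>\<^sub>M i\<in>Basis - {b}. lborel)) = ennreal (P / R ^ ?n) * ennreal (x ^ ?n) * indicator {0..R} x"
      using AE_lborel_singleton[of "0::real"] AE_lborel_singleton[of R]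
    proof eventually_elim
      case (elim x)
      show ?case
      proof (cases "0 < x \<and> x < R")
        case True
        have "(\<integral>\<^sup>+w. (\<Prod>i\<in>Basis - {b}. ennreal (exp (- ((R / x)\<^sup>2 * a i / 2) * (w i)\<^sup>2))) \<partial>(\<Pi>\<^sub>M i\<in>Basis - {b}. lborel))
            = (\<Prod>i\<in>Basis - {b}. \<integral>\<^sup>+y. ennreal (exp (- ((R / x)\<^sup>2 * a i / 2) * y\<^sup>2)) \<partial>lborel)"
          by (rule product_nn_integral_prod) auto
        also have "\<dots> = (\<Prod>i\<in>Basis - {b}. ennreal (sqrt (pi / ((R / x)\<^sup>2 * a i / 2))))"
          using True a R by (intro prod.cong refl nn_integral_exp_minus_square) auto
        also have "\<dots> = (\<Prod>i\<in>Basis - {b}. ennreal ((sqrt (2 * pi) * x / R) / sqrt (a i)))"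
        proof (intro prod.cong refl arg_cong[where f=ennreal])
          fix i assume "i \<in> Basis - {b}"
          then have "pi / ((R / x)\<^sup>2 * a i / 2) = (2 * pi) * (x / R)\<^sup>2 / a i"
            using a[of i] True R by (simp add: field_simps)
          then show "sqrt (pi / ((R / x)\<^sup>2 * a i / 2)) = (sqrt (2 * pi) * x / R) / sqrt (a i)"
            using True R by (simp add: real_sqrt_mult real_sqrt_divide)
        qed
        also have "\<dots> = ennreal (\<Prod>i\<in>Basis - {b}. (sqrt (2 * pi) * x / R) / sqrt (a i))"
          using True R a by (intro prod_ennreal) (auto simp: less_imp_le)
        also have "(\<Prod>i\<in>Basis - {b}. (sqrt (2 * pi) * x / R) / sqrt (a i)) = P / R ^ ?n * x ^ ?n"
          using b by (simp add: prod_dividef prod.distrib P_def power_divide power_mult_distrib sqrt_prod)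
        finally show ?thesis using True P R by (simp add: ennreal_mult[symmetric] indicator_def)
      next
        case False
        then show ?thesis using elim by (auto simp: indicator_def)
      qed
    qed
  qed
  also have "\<dots> = ennreal (P / R ^ ?n) * (\<integral>\<^sup>+x. ennreal (x ^ ?n) * indicator {0..R} x \<partial>lborel)"
    by (simp add: mult.assoc nn_integral_cmult)
  also have "(\<integral>\<^sup>+x. ennreal (x ^ ?n) * indicator {0..R} x \<partial>lborel) = ennreal (R ^ DIM('a) / real DIM('a) - 0 ^ DIM('a) / real DIM('a))"
  proof (rule nn_integral_FTC_Icc)
    show "((\<lambda>x. x ^ DIM('a) / real DIM('a)) has_real_derivative x ^ ?n) (at x)" for x :: real
      by (auto intro!: derivative_eq_intros)
  qed (use R in auto)
  also have "ennreal (P / R ^ ?n) * \<dots> = ennreal (P * R / real DIM('a))"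
  proof -
    have "R ^ DIM('a) = R ^ ?n * R" by (metis DIM_positive Suc_diff_1 power_Suc2)
    then show ?thesis using P R by (simp add: ennreal_mult[symmetric] zero_power field_simps)
  qed
  finally show ?thesis by (simp add: P_def)
qed

text \<open>Tonelli leaves \<open>k r\<close> times the volume of the part of the sector where the
  form is below \<open>r\<close>. Stretching by \<open>sqrt r\<close> preserves the height and
  reduces this volume to level 1; for \<open>r \<le> 0\<close> the set is empty. All dependence on
  \<open>k\<close> is thus in a single moment.\<close>

lemma sector_integral_layer_cake:
  fixes b :: "'a::euclidean_space"
  assumes b: "b \<in> Basis" and a: "\<And>i. i \<in> Basis - {b} \<Longrightarrow> 0 < a i"
    and k [measurable]: "k \<in> borel_measurable borel"
  shows "sector_integral b a R (\<lambda>s. \<integral>\<^sup>+r. indicator {s<..} r * ennreal (k r) \<partial>lborel)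
    = (\<integral>\<^sup>+r. indicator {0<..} r * ennreal (k r) * ennreal (sqrt r ^ (DIM('a) - 1)) \<partial>lborel)
      * (\<integral>\<^sup>+v. indicator {0<..<R} (v \<bullet> b) * indicator {(R / (v \<bullet> b))\<^sup>2 * tangential_form b a v<..} (1::real) \<partial>lborel)"
proof -
  let ?q = "\<lambda>v. (R / (v \<bullet> b))\<^sup>2 * tangential_form b a v"
  define m where "m r = (\<integral>\<^sup>+v. indicator {0<..<R} (v \<bullet> b) * indicator {?q v<..} r \<partial>lborel)" for r
  have ind: "indicator {s<..} r = (if s < r then 1 else 0)" for s r :: real by (simp add: indicator_def)
  have "sector_integral b a R (\<lambda>s. \<integral>\<^sup>+r. indicator {s<..} r * ennreal (k r) \<partial>lborel)
    = (\<integral>\<^sup>+v. \<integral>\<^sup>+r. indicator {0<..<R} (v \<bullet> b) * (indicator {?q v<..} r * ennreal (k r)) \<partial>lborel \<partial>lborel)"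
    unfolding sector_integral_def by (intro nn_integral_cong nn_integral_cmult[symmetric]) simp
  also have "\<dots> = (\<integral>\<^sup>+r. \<integral>\<^sup>+v. indicator {0<..<R} (v \<bullet> b) * (indicator {?q v<..} r * ennreal (k r)) \<partial>lborel \<partial>lborel)"
    unfolding ind by (rule lborel_pair.Fubini') measurable
  also have "\<dots> = (\<integral>\<^sup>+r. ennreal (k r) * m r \<partial>lborel)"
    unfolding m_def ind by (intro nn_integral_cong) (subst nn_integral_cmult[symmetric], auto intro!: nn_integral_cong simp: mult_ac)
  also have "\<dots> = (\<integral>\<^sup>+r. indicator {0<..} r * ennreal (k r) * ennreal (sqrt r ^ (DIM('a) - 1)) * m 1 \<partial>lborel)"
  proof (rule nn_integral_cong)
    fix r :: real
    show "ennreal (k r) * m r = indicator {0<..} r * ennreal (k r) * ennreal (sqrt r ^ (DIM('a) - 1)) * m 1"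
    proof (cases "0 < r")
      case True
      have "m r = ennreal (sqrt r ^ (DIM('a) - 1)) * (\<integral>\<^sup>+v. indicator {0<..<R} (stretch b (sqrt r) v \<bullet> b) *
          indicator {?q (stretch b (sqrt r) v)<..} r \<partial>lborel)"
        unfolding m_def ind by (rule nn_integral_stretch[OF b]) (use True in auto)
      also have "(\<integral>\<^sup>+v. indicator {0<..<R} (stretch b (sqrt r) v \<bullet> b) * indicator {?q (stretch b (sqrt r) v)<..} r \<partial>lborel) = m 1"
        unfolding m_def
      proof (intro nn_integral_cong arg_cong2[where f="(*)"])
        fix v
        have vb: "stretch b (sqrt r) v \<bullet> b = v \<bullet> b"
          using b by (simp add: stretch_def inner_add_left inner_diff_left)
        then show "indicator {0<..<R} (stretch b (sqrt r) v \<bullet> b) = (indicator {0<..<R} (v \<bullet> b) :: ennreal)" by simp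
        have "?q (stretch b (sqrt r) v) < r \<longleftrightarrow> r * ?q v < r * 1"
          unfolding vb tangential_form_stretch[OF b] using True by (simp add: mult_ac)
        then show "indicator {?q (stretch b (sqrt r) v)<..} r = (indicator {?q v<..} 1 :: ennreal)"
          using True by (simp add: indicator_def)
      qed
      finally show ?thesis using True by (simp add: mult_ac)
    next
      case False
      have "0 \<le> ?q v" for v using tangential_form_nonneg[of b a, OF a] by simp
      then have "m r = 0" unfolding m_def using False
        by (intro nn_integral_zero'  AE_I2) (auto simp: indicator_def not_less intro: order.trans)
      then show ?thesis using False by simp
    qed
  qed
  also have "\<dots> = (\<integral>\<^sup>+r. indicator {0<..} r * ennreal (k r) * ennreal (sqrt r ^ (DIM('a) - 1)) \<partial>lborel) * m 1"
    by (rule nn_integral_multc) simp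
  finally show ?thesis by (simp add: m_def)
qed

section \<open>Tails and moments of the two mixing densities\<close>

lemma nn_integral_exp_tail: "(\<integral>\<^sup>+r. indicator {s<..} r * ennreal (exp (- r)) \<partial>lborel) = ennreal (exp (- s))"
proof -
  have "(\<integral>\<^sup>+r. indicator {s<..} r * ennreal (exp (- r)) \<partial>lborel) = (\<integral>\<^sup>+r. ennreal (exp (- r)) * indicator {s..} r \<partial>lborel)"
    by (rule nn_integral_cong_AE) (use AE_lborel_singleton[of s] in eventually_elim, auto simp: indicator_def)
  also have "\<dots> = ennreal (0 - (- exp (- s)))"
  proof (rule nn_integral_FTC_atLeast)
    show "((\<lambda>r. - exp (- r)) has_real_derivative exp (- r)) (at r)" for r :: real
      by (auto intro!: derivative_eq_intros)
    show "((\<lambda>r. - exp (- r)) \<longlongrightarrow> 0) (at_top :: real filter)" by real_asymp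
  qed auto
  finally show ?thesis by simp
qed

lemma nn_integral_erfc2_kernel_tail: "(\<integral>\<^sup>+r. indicator {s<..} r * ennreal (erfc2_kernel r) \<partial>lborel) = ennreal (erfc2 s)"
proof -
  have "(\<integral>\<^sup>+r. indicator {s<..} r * ennreal (erfc2_kernel r) \<partial>lborel) = (\<integral>\<^sup>+r. ennreal (indicator {s<..} r * erfc2_kernel r) \<partial>lborel)"
    by (intro nn_integral_cong) (auto simp: indicator_def)
  also have "\<dots> = ennreal (erfc2 s)"
    unfolding erfc2_def by (intro nn_integral_eq_integral integrable_indicator_erfc2_kernel) (auto simp: erfc2_kernel_nonneg)
  finally show ?thesis .
qed

lemma sqrt_power_eq_powr: "0 < r \<Longrightarrow> sqrt r ^ n = r powr (real n / 2)"
  by (simp add: powr_half_sqrt[symmetric] powr_realpow[symmetric] powr_powr)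

lemma nn_integral_exp_moment:
  "(\<integral>\<^sup>+r. indicator {0<..} r * ennreal (exp (- r)) * ennreal (sqrt r ^ n) \<partial>lborel) = ennreal (Gamma (real n / 2 + 1))"
proof -
  have "(\<integral>\<^sup>+r. indicator {0<..} r * ennreal (exp (- r)) * ennreal (sqrt r ^ n) \<partial>lborel)
      = (\<integral>\<^sup>+r. ennreal (indicator {0..} r * r powr ((real n / 2 + 1) - 1) / exp r) \<partial>lborel)"
  proof (rule nn_integral_cong_AE)
    show "AE r in lborel. indicator {0<..} r * ennreal (exp (- r)) * ennreal (sqrt r ^ n)
        = ennreal (indicator {0..} r * r powr ((real n / 2 + 1) - 1) / exp r)"
      using AE_lborel_singleton[of "0::real"]
      by eventually_elim
         (auto simp: indicator_def sqrt_power_eq_powr exp_minus ennreal_mult[symmetric] field_simps)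
  qed
  also have "\<dots> = ennreal (Gamma (real n / 2 + 1))"
    by (rule Gamma_conv_nn_integral_real[symmetric]) (simp add: add_nonneg_pos)
  finally show ?thesis .
qed

text \<open>The substitution \<open>r = 2 * sqrt v\<close> turns
  \<open>exp (- r\<^sup>2 / 4)\<close> into \<open>exp (- v)\<close> and the moment into Euler's
  integral; the Jacobian \<open>1 / sqrt v\<close> accounts for the argument
  \<open>real n / 4 + 1 / 2\<close>.\<close>

lemma nn_integral_erfc2_kernel_moment:
  "(\<integral>\<^sup>+r. indicator {0<..} r * ennreal (erfc2_kernel r) * ennreal (sqrt r ^ n) \<partial>lborel)
    = ennreal (2 powr (real n / 2) / sqrt pi * Gamma (real n / 4 + 1 / 2))"
proof -
  define p where "p = real n / 2"
  define C where "C = 2 powr p / sqrt pi"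
  let ?f = "\<lambda>r. erfc2_kernel r * r powr p"
  let ?h = "\<lambda>v. C * (v powr ((real n / 4 + 1 / 2) - 1) / exp v)"
  have eq: "erfc2_kernel (2 * sqrt v) * (2 * sqrt v) powr p * (1 / sqrt v) = ?h v" if "0 < v" for v
  proof -
    have "(2 * sqrt v) powr p * (1 / sqrt v) = 2 powr p * (v powr (1/2)) powr p * v powr (- 1 / 2)"
      using that by (simp add: powr_mult powr_half_sqrt powr_minus_divide)
    also have "\<dots> = 2 powr p * v powr ((real n / 4 + 1 / 2) - 1)"
      unfolding powr_powr mult.assoc powr_add[symmetric] by (simp add: p_def)
    finally show ?thesis using that by (simp add: erfc2_kernel_def C_def exp_minus power_mult_distrib field_simps)
  qed
  have hbi: "has_bochner_integral lborel (\<lambda>v. indicator {0..} v * (v powr ((real n / 4 + 1 / 2) - 1) / exp v)) (Gamma (real n / 4 + 1 / 2))"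
  proof (rule has_bochner_integral_nn_integral)
    show "(\<integral>\<^sup>+v. ennreal (indicator {0..} v * (v powr ((real n / 4 + 1 / 2) - 1) / exp v)) \<partial>lborel) = ennreal (Gamma (real n / 4 + 1 / 2))"
      using Gamma_conv_nn_integral_real[of "real n / 4 + 1 / 2"] by (simp add: add_nonneg_pos)
  qed (auto simp: add_nonneg_pos Gamma_real_nonneg less_imp_le Gamma_real_pos)
  have ae: "AE v in lborel. indicator {0<..} v * (erfc2_kernel (2 * sqrt v) * (2 * sqrt v) powr p * (1 / sqrt v))
      = C * (indicator {0..} v * (v powr ((real n / 4 + 1 / 2) - 1) / exp v))"
    using AE_lborel_singleton[of "0::real"] by eventually_elim (use eq in \<open>auto simp: indicator_def\<close>)
  have hbi2: "has_bochner_integral lborel (\<lambda>v. indicator {0<..} v * (erfc2_kernel (2 * sqrt v) * (2 * sqrt v) powr p * (1 / sqrt v)))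
      (C * Gamma (real n / 4 + 1 / 2))"
    using has_bochner_integral_mult_right[OF hbi, of C]
    by (subst has_bochner_integral_cong_AE[OF _ _ ae]) simp_all
  have ein: "einterval (ereal 0) \<infinity> = {0<..}" by (auto simp: einterval_def)
  have int: "set_integrable lborel (einterval (ereal 0) \<infinity>) (\<lambda>v. ?f (2 * sqrt v) * (1 / sqrt v))"
    unfolding ein set_integrable_def using hbi2 by (simp add: has_bochner_integral_iff)
  have cont: "isCont ?f (2 * sqrt x)" if "ereal 0 < ereal x" for x
  proof -
    have "isCont erfc2_kernel y" for y using DERIV_erfc2_kernel by (rule DERIV_isCont)
    then show ?thesis using that by (intro continuous_intros) auto
  qed
  have "((\<lambda>v. 2 * sqrt v) \<longlongrightarrow> 2 * sqrt 0) (at_right 0)"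
    by (intro tendsto_intros tendsto_within_subset[OF tendsto_ident_at]) auto
  then have lim0: "((ereal \<circ> (\<lambda>v. 2 * sqrt v) \<circ> real_of_ereal) \<longlongrightarrow> ereal 0) (at_right (ereal 0))"
    unfolding ereal_tendsto_simps by simp
  have "filterlim (\<lambda>v. 2 * sqrt v) at_top (at_top :: real filter)" by real_asymp
  then have lim_inf: "((ereal \<circ> (\<lambda>v. 2 * sqrt v) \<circ> real_of_ereal) \<longlongrightarrow> \<infinity>) (at_left \<infinity>)"
    unfolding ereal_tendsto_simps .
  have der: "((\<lambda>v. 2 * sqrt v) has_real_derivative 1 / sqrt x) (at x)" if "ereal 0 < ereal x" for x
    using that by (auto intro!: derivative_eq_intros simp: field_simps)
  have nonneg: "0 \<le> 1 / sqrt x" if "ereal 0 \<le> ereal x" for x using that by simp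
  have cont': "isCont (\<lambda>v. 1 / sqrt v) x" if "ereal 0 < ereal x" for x
    using that by (intro continuous_intros) auto
  have f0: "0 \<le> ?f (2 * sqrt x)" for x by (simp add: erfc2_kernel_nonneg)
  note sub = interval_integral_substitution_nonneg[where a="ereal 0" and b=\<infinity> and f="?f" and
      g="\<lambda>v. 2 * sqrt v" and g'="\<lambda>v. 1 / sqrt v", OF _ der cont cont' f0 nonneg lim0 lim_inf int, simplified ereal_less]
  have "(\<integral>\<^sup>+r. indicator {0<..} r * ennreal (erfc2_kernel r) * ennreal (sqrt r ^ n) \<partial>lborel)
      = (\<integral>\<^sup>+r. ennreal (indicator {0<..} r * ?f r) \<partial>lborel)"
    by (intro nn_integral_cong)
       (auto simp: indicator_def sqrt_power_eq_powr p_def ennreal_mult erfc2_kernel_nonneg)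
  also have "\<dots> = ennreal (LINT r|lborel. indicator {0<..} r * ?f r)"
    by (intro nn_integral_eq_integral)
       (use sub(1) in \<open>auto simp: ein set_integrable_def erfc2_kernel_nonneg\<close>)
  also have "(LINT r|lborel. indicator {0<..} r * ?f r) = (LINT v|lborel. indicator {0<..} v * (?f (2 * sqrt v) * (1 / sqrt v)))"
    using sub(2) by (simp add: interval_lebesgue_integral_def ein set_lebesgue_integral_def)
  also have "\<dots> = C * Gamma (real n / 4 + 1 / 2)"
    using hbi2 by (simp add: has_bochner_integral_iff)
  finally show ?thesis by (simp add: C_def p_def)
qed

lemma Gamma_legendre_duplication_real:
  fixes z :: real
  assumes "0 < z"
  shows "Gamma z * Gamma (z + 1/2) = 2 powr (1 - 2 * z) * sqrt pi * Gamma (2 * z)"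
proof -
  have "complex_of_real (Gamma z * Gamma (z + 1/2)) = Gamma (complex_of_real z) * Gamma (complex_of_real z + 1/2)"
    using Gamma_complex_of_real[of z] Gamma_complex_of_real[of "z + 1/2"] by simp
  also have "\<dots> = exp ((1 - 2 * complex_of_real z) * of_real (ln 2)) * of_real (sqrt pi) * Gamma (2 * complex_of_real z)"
    by (rule Gamma_legendre_duplication) (use assms in \<open>auto elim!: nonpos_Ints_cases simp: complex_eq_iff\<close>)
  also have "\<dots> = complex_of_real (2 powr (1 - 2 * z) * sqrt pi * Gamma (2 * z))"
    using Gamma_complex_of_real[of "2 * z"] by (simp add: powr_def exp_of_real[symmetric])
  finally show ?thesis using of_real_eq_iff by blast
qed

text \<open>The level-one volume \<open>m\<close> is never computed directly: the exponential case
  gives \<open>g1 * m = V\<close>, and the integral sought is \<open>g2 * m\<close>. The duplication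
  formula at \<open>real n / 4 + 1 / 2\<close> yields \<open>g2 * g3 = g1\<close>.\<close>

lemma sector_integral_erfc2:
  fixes b :: "'a::euclidean_space"
  assumes b: "b \<in> Basis" and a: "\<And>i. i \<in> Basis - {b} \<Longrightarrow> 0 < a i" and R: "0 < R"
  shows "sector_integral b a R (\<lambda>s. ennreal (erfc2 s))
    = ennreal (sqrt (2 * pi) ^ (DIM('a) - 1) / sqrt (\<Prod>i\<in>Basis - {b}. a i) * R / real DIM('a)
        / Gamma (real (DIM('a) - 1) / 4 + 1))"
proof -
  define n where "n = DIM('a) - 1"
  define V where "V = sqrt (2 * pi) ^ n / sqrt (\<Prod>i\<in>Basis - {b}. a i) * R / real DIM('a)"
  define m where "m = (\<integral>\<^sup>+v. indicator {0<..<R} (v \<bullet> b) * indicator {(R / (v \<bullet> b))\<^sup>2 * tangential_form b a v<..} (1::real) \<partial>lborel)"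
  define g1 g2 where "g1 = Gamma (real n / 2 + 1)" and "g2 = 2 powr (real n / 2) / sqrt pi * Gamma (real n / 4 + 1 / 2)"
  define g3 where "g3 = Gamma (real n / 4 + 1)"
  have pos: "0 < g1" "0 < g2" "0 < g3"
    by (simp_all add: g1_def g2_def g3_def add_nonneg_pos Gamma_real_pos)
  have "0 \<le> (\<Prod>i\<in>Basis - {b}. a i)" by (intro prod_nonneg less_imp_le[OF a])
  then have V: "0 \<le> V" using R by (simp add: V_def)
  have "ennreal g1 * m = sector_integral b a R (\<lambda>s. ennreal (exp (- s)))"
    using sector_integral_layer_cake[where a=a and k="\<lambda>r. exp (- r)" and R=R, OF b a]
    by (simp add: nn_integral_exp_tail nn_integral_exp_moment m_def g1_def n_def)
  also have "\<dots> = ennreal V"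
    using sector_integral_exp[where a=a, OF b a R] by (simp add: V_def n_def)
  finally have m: "ennreal g1 * m = ennreal V" .
  \<comment> \<open>Finiteness of the volume is read off from the exponential integral.\<close>
  then have "m \<noteq> \<infinity>" using pos by (auto simp: ennreal_mult_top)
  then obtain m' where m': "0 \<le> m'" "m = ennreal m'" by (cases m) auto
  with m pos V have "g1 * m' = V" by (simp add: ennreal_mult[symmetric])
  then have m'V: "m' = V / g1" using pos by (simp add: field_simps)
  have "sector_integral b a R (\<lambda>s. ennreal (erfc2 s)) = ennreal g2 * m"
    using sector_integral_layer_cake[where a=a and k=erfc2_kernel and R=R, OF b a]
    by (simp add: nn_integral_erfc2_kernel_tail nn_integral_erfc2_kernel_moment m_def g2_def n_def)
  also have "\<dots> = ennreal (V * (g2 / g1))" using pos m' by (simp add: m'V ennreal_mult[symmetric] mult_ac)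
  also have "g2 / g1 = 1 / g3"
  proof -
    have "Gamma (real n / 4 + 1 / 2) * g3 = 2 powr (- (real n / 2)) * sqrt pi * g1"
      using Gamma_legendre_duplication_real[of "real n / 4 + 1 / 2"]
      by (simp add: g1_def g3_def add_nonneg_pos algebra_simps)
    then have "g2 * g3 = g1" by (simp add: g2_def powr_minus field_simps)
    then show ?thesis using pos by (simp add: field_simps)
  qed
  finally show ?thesis by (simp add: V_def g3_def n_def)
qed

section \<open>Integrals over spheres\<close>

lemma integral_sphere_measure:
  fixes g :: "'a::euclidean_space \<Rightarrow> real"
  assumes R: "0 < R" and g [measurable]: "g \<in> borel_measurable (restrict_space borel (sphere p R))"
  shows "(LINT x|sphere_measure p R. g x)
    = real DIM('a) / R * (LINT x|lborel. indicator (ball p R - {p}) x * g (p + R *\<^sub>R sgn (x - p)))"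
proof -
  note [measurable] = radial_projection_measurable[OF R, of p]
  let ?D = "distr (restrict_space lborel (ball p R - {p})) (restrict_space borel (sphere p R)) (\<lambda>x. p + R *\<^sub>R sgn (x - p))"
  have "(LINT x|sphere_measure p R. g x) = (LINT x|?D. (real DIM('a) / R) *\<^sub>R g x)"
    unfolding sphere_measure_def using R by (intro integral_density) (auto simp: g)
  also have "\<dots> = real DIM('a) / R * (LINT x|?D. g x)" by simp
  also have "(LINT x|?D. g x) = (LINT x|restrict_space lborel (ball p R - {p}). g (p + R *\<^sub>R sgn (x - p)))"
    by (rule integral_distr) measurable
  also have "\<dots> = (LINT x|lborel. indicator (ball p R - {p}) x *\<^sub>R g (p + R *\<^sub>R sgn (x - p)))"
    by (rule integral_restrict_space) simp
  finally show ?thesis by simp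
qed

text \<open>Translation by \<open>p\<close>, rotation by \<open>L\<close> and stretching by
  \<open>s\<close> are applied to the Lebesgue integral over the ball, so the scale enters only
  through the argument of \<open>F\<close> and the Jacobian.\<close>

lemma integral_sphere_stretch:
  fixes g :: "'a::euclidean_space \<Rightarrow> real" and L :: "'a \<Rightarrow> 'a"
  assumes R: "0 < R" and g: "continuous_on (sphere p R) g" and L: "orthogonal_transformation L"
    and b: "b \<in> Basis" and s: "0 < s"
  defines "F v \<equiv> indicator {v. v \<noteq> 0 \<and> norm v < R} v * g (p + R *\<^sub>R L (sgn v))"
  shows "F \<in> borel_measurable borel"
    and "(LINT x|sphere_measure p R. g x) = real DIM('a) / R * (s ^ (DIM('a) - 1) * (LINT v|lborel. F (stretch b s v)))"
proof -
  have lin: "linear L" using L by (rule orthogonal_transformation_linear)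
  have Ln: "norm (L x) = norm x" for x using orthogonal_transformation_norm[OF L] .
  have L0: "L x = 0 \<longleftrightarrow> x = 0" for x using Ln[of x] by (metis norm_eq_zero)
  have [measurable]: "L \<in> borel_measurable borel"
    using lin by (intro borel_measurable_continuous_onI linear_continuous_on linear_conv_bounded_linear[THEN iffD1])
  \<comment> \<open>\<open>g\<close> is controlled only on the sphere; its extension by zero is
    Borel on the whole space.\<close>
  define g' where "g' = (\<lambda>x. indicator (sphere p R) x *\<^sub>R g x)"
  have [measurable]: "g' \<in> borel_measurable borel"
    unfolding g'_def by (intro borel_measurable_continuous_on_indicator g) simp
  have sph: "p + R *\<^sub>R L (sgn v) \<in> sphere p R" if "v \<noteq> 0" for v
    using that R by (simp add: dist_norm Ln norm_sgn)
  have Fg: "F = (\<lambda>v. indicator {v. v \<noteq> 0 \<and> norm v < R} v * g' (p + R *\<^sub>R L (v /\<^sub>R norm v)))"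
    using sph by (auto simp: F_def g'_def indicator_def sgn_div_norm fun_eq_iff)
  show F_meas [measurable]: "F \<in> borel_measurable borel" unfolding Fg by measurable
  define F0 where "F0 x = indicator (ball p R - {p}) x * g' (p + R *\<^sub>R ((x - p) /\<^sub>R norm (x - p)))" for x
  have [measurable]: "ball p R - {p} \<in> sets borel" by simp
  have [measurable]: "(\<lambda>x. p + R *\<^sub>R ((x - p) /\<^sub>R norm (x - p))) \<in> borel_measurable borel" by measurable
  have [measurable]: "F0 \<in> borel_measurable borel" unfolding F0_def[abs_def] by measurable
  have "(LINT x|sphere_measure p R. g x) = real DIM('a) / R * (LINT x|lborel. indicator (ball p R - {p}) x * g (p + R *\<^sub>R sgn (x - p)))"
    by (intro integral_sphere_measure R borel_measurable_continuous_on_restrict g)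
  also have "(LINT x|lborel. indicator (ball p R - {p}) x * g (p + R *\<^sub>R sgn (x - p))) = (LINT x|lborel. F0 x)"
    using R by (intro Bochner_Integration.integral_cong)
      (auto simp: F0_def g'_def indicator_def sgn_div_norm dist_norm)
  also have "\<dots> = (LINT x|distr lborel borel ((+) p). F0 x)" by (simp add: lborel_distr_plus)
  also have "\<dots> = (LINT x|lborel. F0 (p + x))" by (subst integral_distr) auto
  also have "\<dots> = (LINT x|lborel. F0 (p + L x))" by (rule integral_orthogonal[OF L]) measurable
  also have "\<dots> = (LINT x|lborel. F x)"
    unfolding Fg F0_def
    by (intro Bochner_Integration.integral_cong)
       (auto simp: indicator_def dist_norm Ln L0 linear_scale[OF lin])
  also have "\<dots> = s ^ (DIM('a) - 1) * (LINT v|lborel. F (stretch b s v))"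
    by (rule integral_stretch[OF b s]) measurable
  finally show "(LINT x|sphere_measure p R. g x) = real DIM('a) / R * (s ^ (DIM('a) - 1) * (LINT v|lborel. F (stretch b s v)))" .
qed

text \<open>The majorant for dominated convergence. It is a product of functions of single
  coordinates: an interval indicator along \<open>b\<close>, Gaussians in the other
  directions.\<close>

lemma integrable_sector_gaussian:
  fixes b :: "'a::euclidean_space"
  assumes b: "b \<in> Basis" and c: "0 < c"
  shows "integrable lborel (\<lambda>v. indicator {-R..R} (v \<bullet> b) * exp (- c * (norm (v - (v \<bullet> b) *\<^sub>R b))\<^sup>2))"
proof (rule integrableI_nonneg)
  define h where "h i x = (if i = b then indicator {-R..R} x else exp (- c * x\<^sup>2))" for i and x :: real
  have n: "(norm (v - (v \<bullet> b) *\<^sub>R b))\<^sup>2 = (\<Sum>i\<in>Basis - {b}. (v \<bullet> i)\<^sup>2)" for v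
  proof -
    let ?w = "v - (v \<bullet> b) *\<^sub>R b"
    have bb: "b \<bullet> b = 1" using b by simp
    have "(norm ?w)\<^sup>2 = (\<Sum>i\<in>Basis. (?w \<bullet> i)\<^sup>2)"
      unfolding power2_norm_eq_inner by (subst euclidean_inner) (simp add: power2_eq_square)
    also have "\<dots> = (?w \<bullet> b)\<^sup>2 + (\<Sum>i\<in>Basis - {b}. (?w \<bullet> i)\<^sup>2)" using b by (simp add: sum.remove)
    also have "?w \<bullet> b = 0" by (simp add: inner_diff_left bb)
    also have "(\<Sum>i\<in>Basis - {b}. (?w \<bullet> i)\<^sup>2) = (\<Sum>i\<in>Basis - {b}. (v \<bullet> i)\<^sup>2)"
      using b by (intro sum.cong) (auto simp: inner_diff_left inner_Basis)
    finally show ?thesis by simp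
  qed
  have eq: "indicator {-R..R} (v \<bullet> b) * exp (- c * (norm (v - (v \<bullet> b) *\<^sub>R b))\<^sup>2) = (\<Prod>i\<in>Basis. h i (v \<bullet> i))" for v
  proof -
    have "(\<Prod>i\<in>Basis. h i (v \<bullet> i)) = h b (v \<bullet> b) * (\<Prod>i\<in>Basis - {b}. exp (- c * (v \<bullet> i)\<^sup>2))"
      using b by (subst prod.remove[of _ b]) (auto simp: h_def)
    then show ?thesis
      by (simp add: h_def n exp_sum[symmetric] sum_distrib_left sum_negf)
  qed
  have "(\<integral>\<^sup>+v. (\<Prod>i\<in>Basis. ennreal (h i (v \<bullet> i))) \<partial>lborel) = (\<Prod>i\<in>(Basis::'a set). \<integral>\<^sup>+x. ennreal (h i x) \<partial>lborel)"
    by (rule nn_integral_lborel_prod) (auto simp: h_def)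
  also have "\<dots> < \<infinity>"
  proof -
    have "(\<integral>\<^sup>+x. ennreal (h i x) \<partial>lborel) < \<infinity>" for i
    proof (cases "i = b")
      case True
      have "(\<integral>\<^sup>+x. ennreal (h i x) \<partial>lborel) = emeasure lborel {-R..R}"
        unfolding h_def using True by (simp add: ennreal_indicator)
      then show ?thesis by (simp add: emeasure_lborel_Icc_eq)
    next
      case False
      then show ?thesis using nn_integral_exp_minus_square[OF c] by (simp add: h_def)
    qed
    then show ?thesis by (simp add: ennreal_prod_eq_top less_top[symmetric])
  qed
  also have "(\<integral>\<^sup>+v. (\<Prod>i\<in>Basis. ennreal (h i (v \<bullet> i))) \<partial>lborel) = (\<integral>\<^sup>+v. ennreal (indicator {-R..R} (v \<bullet> b) * exp (- c * (norm (v - (v \<bullet> b) *\<^sub>R b))\<^sup>2)) \<partial>lborel)"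
    unfolding eq by (intro nn_integral_cong prod_ennreal) (auto simp: h_def)
  finally show "(\<integral>\<^sup>+v. ennreal (indicator {-R..R} (v \<bullet> b) * exp (- c * (norm (v - (v \<bullet> b) *\<^sub>R b))\<^sup>2)) \<partial>lborel) < \<infinity>" .
qed (auto simp: indicator_def)

text \<open>The cone defining surface measure is stretched by \<open>\<tau>\<close> in the tangential directions only: a linear
  change of variables that resolves the scale \<open>\<tau>\<close> on the sphere.\<close>

lemma sphere_integral_concentration:
  fixes G :: "nat \<Rightarrow> 'a::euclidean_space \<Rightarrow> real" and L :: "'a \<Rightarrow> 'a" and H :: "'a \<Rightarrow> real"
  assumes R: "0 < R" and L: "orthogonal_transformation L" and b: "b \<in> Basis"
    and \<tau>: "\<And>n. 0 < \<tau> n" "\<tau> \<longlonglongrightarrow> 0"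
    and cont: "\<And>n. continuous_on (sphere p R) (G n)"
    and bound: "\<And>n x. x \<in> sphere p R \<Longrightarrow> \<bar>G n x\<bar> \<le> C * exp (- c * (norm (x - (p + R *\<^sub>R L b)) / \<tau> n)\<^sup>2)"
    and c: "0 < c" and H [measurable]: "H \<in> borel_measurable borel"
    and lim: "\<And>X z. (\<And>n. X n \<in> sphere p R) \<Longrightarrow> z \<bullet> b = 0 \<Longrightarrow>
      (\<lambda>n. (X n - (p + R *\<^sub>R L b)) /\<^sub>R \<tau> n) \<longlonglongrightarrow> L z \<Longrightarrow> (\<lambda>n. G n (X n)) \<longlonglongrightarrow> H z"
  shows "(\<lambda>n. (LINT x|sphere_measure p R. G n x) / \<tau> n ^ (DIM('a) - 1)) \<longlonglongrightarrow>
     real DIM('a) / R * (LINT v|lborel. indicator {0<..<R} (v \<bullet> b) * H ((R / (v \<bullet> b)) *\<^sub>R (v - (v \<bullet> b) *\<^sub>R b)))"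
proof -
  have lin: "linear L" using L by (rule orthogonal_transformation_linear)
  have Ln: "norm (L x) = norm x" for x using orthogonal_transformation_norm[OF L] .
  have bb: "b \<bullet> b = 1" "norm b = 1" using b by auto
  define F where "F n v = indicator {v. v \<noteq> 0 \<and> norm v < R} v * G n (p + R *\<^sub>R L (sgn v))" for n v
  define S where "S n v = stretch b (\<tau> n) v" for n v
  have F_meas [measurable]: "F n \<in> borel_measurable borel" for n
    using integral_sphere_stretch(1)[OF R cont L b \<tau>(1)] unfolding F_def[abs_def] .
  have F_int: "(LINT x|sphere_measure p R. G n x) / \<tau> n ^ (DIM('a) - 1) = real DIM('a) / R * (LINT v|lborel. F n (S n v))" for n
    using integral_sphere_stretch(2)[OF R cont L b \<tau>(1), of n n] \<tau>(1)[of n]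
    unfolding F_def[abs_def] S_def by (simp add: field_simps)
  have C: "0 \<le> C"
  proof -
    have "0 \<le> C * exp (- c * (norm ((p + R *\<^sub>R b) - (p + R *\<^sub>R L b)) / \<tau> 0)\<^sup>2)"
      by (rule order.trans[OF abs_ge_zero bound]) (use R bb in \<open>simp add: dist_norm\<close>)
    then show ?thesis by (simp add: zero_le_mult_iff)
  qed
  have sph: "p + R *\<^sub>R L (sgn v) \<in> sphere p R" if "v \<noteq> 0" for v
    using that R by (simp add: dist_norm Ln norm_sgn)
  have dist_q: "norm (p + R *\<^sub>R L (sgn v) - (p + R *\<^sub>R L b)) = R * norm (sgn v - b)" for v
  proof -
    have "p + R *\<^sub>R L (sgn v) - (p + R *\<^sub>R L b) = R *\<^sub>R L (sgn v - b)"
      by (simp add: linear_diff[OF lin] algebra_simps)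
    then show ?thesis using R by (simp add: Ln)
  qed
  have Sb: "S n v \<bullet> b = v \<bullet> b" for n v
    by (simp add: S_def stretch_def inner_add_left inner_diff_left bb)
  have S_tan: "S n v - (S n v \<bullet> b) *\<^sub>R b = \<tau> n *\<^sub>R (v - (v \<bullet> b) *\<^sub>R b)" for n v
    unfolding Sb by (simp add: S_def stretch_def)
  have tan_le: "norm (w - (w \<bullet> b) *\<^sub>R b) \<le> norm w" for w
  proof -
    have "(norm (w - (w \<bullet> b) *\<^sub>R b))\<^sup>2 = (norm w)\<^sup>2 - (w \<bullet> b)\<^sup>2"
      unfolding power2_norm_eq_inner
      by (simp add: inner_diff_left inner_diff_right bb power2_eq_square inner_commute algebra_simps)
    then have "(norm (w - (w \<bullet> b) *\<^sub>R b))\<^sup>2 \<le> (norm w)\<^sup>2" by simp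
    then show ?thesis by (rule power2_le_imp_le) simp
  qed
  have F_bound: "norm (F n (S n v)) \<le> C * (indicator {-R..R} (v \<bullet> b) * exp (- c * (norm (v - (v \<bullet> b) *\<^sub>R b))\<^sup>2))" for n v
  proof (cases "S n v \<noteq> 0 \<and> norm (S n v) < R")
    case True
    have "\<bar>v \<bullet> b\<bar> \<le> norm (S n v)" using Basis_le_norm[OF b, of "S n v"] by (simp add: Sb)
    then have ind: "indicator {-R..R} (v \<bullet> b) = (1::real)" using True by (simp add: indicator_def abs_le_iff)
    \<comment> \<open>Projecting orthogonally to \<open>b\<close> does not increase the norm; it
      sends \<open>sgn (S n v) - b\<close> to the tangential part of \<open>S n v\<close> divided by
      its norm, which is less than \<open>R\<close>.\<close>
    have "\<tau> n * norm (v - (v \<bullet> b) *\<^sub>R b) \<le> R * norm (sgn (S n v) - b)"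
    proof -
      let ?w = "sgn (S n v) - b"
      have "?w - (?w \<bullet> b) *\<^sub>R b = (1 / norm (S n v)) *\<^sub>R (S n v - (S n v \<bullet> b) *\<^sub>R b)"
        by (simp add: sgn_div_norm inner_diff_left bb algebra_simps divide_inverse)
      then have "norm (?w - (?w \<bullet> b) *\<^sub>R b) = \<tau> n * norm (v - (v \<bullet> b) *\<^sub>R b) / norm (S n v)"
        using \<tau>(1)[of n] unfolding S_tan by simp
      with tan_le[of ?w] have "\<tau> n * norm (v - (v \<bullet> b) *\<^sub>R b) / norm (S n v) \<le> norm ?w" by simp
      then have "\<tau> n * norm (v - (v \<bullet> b) *\<^sub>R b) \<le> norm (S n v) * norm ?w"
        using True by (simp add: field_simps)
      also have "\<dots> \<le> R * norm ?w" using True by (intro mult_right_mono) auto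
      finally show ?thesis .
    qed
    then have "norm (v - (v \<bullet> b) *\<^sub>R b) \<le> R * norm (sgn (S n v) - b) / \<tau> n"
      using \<tau>(1)[of n] by (simp add: field_simps)
    then have "(norm (v - (v \<bullet> b) *\<^sub>R b))\<^sup>2 \<le> (R * norm (sgn (S n v) - b) / \<tau> n)\<^sup>2"
      by (intro power_mono) auto
    then have "C * exp (- c * (R * norm (sgn (S n v) - b) / \<tau> n)\<^sup>2) \<le> C * exp (- c * (norm (v - (v \<bullet> b) *\<^sub>R b))\<^sup>2)"
      using C c by (intro mult_left_mono) auto
    moreover have "norm (F n (S n v)) = \<bar>G n (p + R *\<^sub>R L (sgn (S n v)))\<bar>" using True by (simp add: F_def)
    moreover have "\<dots> \<le> C * exp (- c * (R * norm (sgn (S n v) - b) / \<tau> n)\<^sup>2)"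
      using bound[OF sph, of "S n v" n, unfolded dist_q] True by simp
    ultimately show ?thesis by (simp add: ind)
  next
    case False
    then have "F n (S n v) = 0" by (auto simp: F_def)
    then show ?thesis using C by simp
  qed
  have F_lim: "AE v in lborel. (\<lambda>n. F n (S n v)) \<longlonglongrightarrow> indicator {0<..<R} (v \<bullet> b) * H ((R / (v \<bullet> b)) *\<^sub>R (v - (v \<bullet> b) *\<^sub>R b))"
  proof -
    have hyp: "AE v in lborel. v \<bullet> b \<noteq> r" for r
    proof -
      have "negligible {v. v \<bullet> b = r}" using negligible_standard_hyperplane[OF b, of r] by simp
      then have "{v. v \<bullet> b = r} \<in> null_sets lebesgue" by (simp add: negligible_iff_null_sets)
      moreover have "{v. v \<bullet> b = r} \<in> sets lborel" by measurable
      ultimately have "{v. v \<bullet> b = r} \<in> null_sets lborel" using null_sets_completion_iff by blast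
      then show ?thesis by (auto dest: AE_not_in)
    qed
    show ?thesis using hyp[of 0] hyp[of R]
    proof eventually_elim
      case (elim v)
      define \<sigma> where "\<sigma> = v \<bullet> b"
      define z where "z = v - \<sigma> *\<^sub>R b"
      have zb: "z \<bullet> b = 0" by (simp add: z_def \<sigma>_def inner_diff_left bb)
      have S: "S n v = \<sigma> *\<^sub>R b + \<tau> n *\<^sub>R z" for n by (simp add: S_def stretch_def z_def \<sigma>_def)
      have nS: "norm (S n v) = sqrt (\<sigma>\<^sup>2 + (\<tau> n)\<^sup>2 * (norm z)\<^sup>2)" for n
      proof -
        have "(norm (S n v))\<^sup>2 = \<sigma>\<^sup>2 + (\<tau> n)\<^sup>2 * (norm z)\<^sup>2"
          unfolding S power2_norm_eq_inner
          by (simp add: inner_add_left inner_add_right bb zb inner_commute[of b z] power2_eq_square)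
        then show ?thesis by (metis norm_ge_zero real_sqrt_unique)
      qed
      have S0: "S n v \<noteq> 0" for n using Sb[of n v] elim(1) by auto
      have nS_lim: "(\<lambda>n. norm (S n v)) \<longlonglongrightarrow> \<bar>\<sigma>\<bar>"
      proof -
        have "(\<lambda>n. sqrt (\<sigma>\<^sup>2 + (\<tau> n)\<^sup>2 * (norm z)\<^sup>2)) \<longlonglongrightarrow> sqrt (\<sigma>\<^sup>2 + 0\<^sup>2 * (norm z)\<^sup>2)"
          by (intro tendsto_intros \<tau>(2))
        then show ?thesis unfolding nS by simp
      qed
      \<comment> \<open>For negative height the projected point is at distance at least
        \<open>R\<close> from \<open>p + R *\<^sub>R L b\<close>, and the Gaussian bound forces the
        limit 0. Above height \<open>R\<close> the point lies outside the ball. Only the sector in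
        between contributes.\<close>
      consider "\<sigma> < 0" | "\<sigma> > R" | "0 < \<sigma>" "\<sigma> < R" using elim by (force simp: \<sigma>_def)
      then show ?case
      proof cases
        case 1
        have le: "norm (F n (S n v)) \<le> C * exp (- c * (R / \<tau> n)\<^sup>2)" for n
        proof -
          have "(sgn (S n v) - b) \<bullet> b = \<sigma> / norm (S n v) - 1"
            by (simp add: sgn_div_norm inner_diff_left bb Sb \<sigma>_def divide_inverse mult.commute)
          moreover have "\<sigma> / norm (S n v) \<le> 0" using 1 by (simp add: divide_nonpos_nonneg)
          ultimately have "1 \<le> norm (sgn (S n v) - b)" using Basis_le_norm[OF b, of "sgn (S n v) - b"] by linarith
          then have "R / \<tau> n \<le> R * norm (sgn (S n v) - b) / \<tau> n" using R \<tau>(1)[of n] by (simp add: divide_right_mono)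
          then have "(R / \<tau> n)\<^sup>2 \<le> (R * norm (sgn (S n v) - b) / \<tau> n)\<^sup>2"
            using R \<tau>(1)[of n] by (intro power_mono) auto
          then have "C * exp (- c * (R * norm (sgn (S n v) - b) / \<tau> n)\<^sup>2) \<le> C * exp (- c * (R / \<tau> n)\<^sup>2)"
            using C c by (intro mult_left_mono) auto
          moreover have "norm (F n (S n v)) \<le> \<bar>G n (p + R *\<^sub>R L (sgn (S n v)))\<bar>" by (simp add: F_def indicator_def)
          moreover have "\<dots> \<le> C * exp (- c * (R * norm (sgn (S n v) - b) / \<tau> n)\<^sup>2)"
            using bound[OF sph[OF S0], of n n, unfolded dist_q] by simp
          ultimately show ?thesis by linarith
        qed
        have to0: "(\<lambda>n. C * exp (- c * (R / \<tau> n)\<^sup>2)) \<longlonglongrightarrow> 0"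
        proof -
          have "filterlim \<tau> (at_right 0) sequentially"
            using \<tau> by (auto simp: filterlim_at intro!: always_eventually less_imp_neq[THEN not_sym])
          moreover have "((\<lambda>t. C * exp (- c * (R / t)\<^sup>2)) \<longlongrightarrow> 0) (at_right 0)"
            using c R by real_asymp
          ultimately show ?thesis by (rule filterlim_compose[rotated])
        qed
        have "(\<lambda>n. F n (S n v)) \<longlonglongrightarrow> 0"
          by (rule Lim_null_comparison[OF always_eventually[OF allI, OF le] to0])
        then show ?thesis using 1 by (simp add: \<sigma>_def)
      next
        case 2
        have "F n (S n v) = 0" for n
        proof -
          have "R < norm (S n v)" using Basis_le_norm[OF b, of "S n v"] 2 by (simp add: Sb \<sigma>_def)
          then show ?thesis by (simp add: F_def)
        qed
        then show ?thesis using 2 by (simp add: \<sigma>_def)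
      next
        case 3
        define X where "X n = p + R *\<^sub>R L (sgn (S n v))" for n
        have X: "X n \<in> sphere p R" for n unfolding X_def by (rule sph[OF S0])
        \<comment> \<open>The component along \<open>b\<close> involves
          \<open>\<sigma> - norm (S n v)\<close>, which a difference of squares shows to be of
          second order in \<tau>; it disappears even after division by \<tau>, and the tangential
          part \<open>z /\<^sub>R \<sigma>\<close> remains.\<close>
        have "(\<lambda>n. (sgn (S n v) - b) /\<^sub>R \<tau> n) \<longlonglongrightarrow> z /\<^sub>R \<sigma>"
        proof -
          have eq: "(sgn (S n v) - b) /\<^sub>R \<tau> n
              = (- \<tau> n * (norm z)\<^sup>2 / (norm (S n v) * (\<sigma> + norm (S n v)))) *\<^sub>R b + z /\<^sub>R norm (S n v)" for n
          proof -
            let ?m = "norm (S n v)"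
            have m: "0 < ?m" using S0 by simp
            have "?m\<^sup>2 = \<sigma>\<^sup>2 + (\<tau> n)\<^sup>2 * (norm z)\<^sup>2" unfolding nS by simp
            then have "(\<sigma> - ?m) * (\<sigma> + ?m) = - (\<tau> n)\<^sup>2 * (norm z)\<^sup>2" by (simp add: algebra_simps power2_eq_square)
            then have "\<sigma> - ?m = - (\<tau> n)\<^sup>2 * (norm z)\<^sup>2 / (\<sigma> + ?m)"
              using add_pos_pos[OF 3(1) m] by (intro eq_divide_imp) simp_all
            then have "(\<sigma> - ?m) / (?m * \<tau> n) = - \<tau> n * (norm z)\<^sup>2 / (?m * (\<sigma> + ?m))"
              using m 3 \<tau>(1)[of n] by (simp add: power2_eq_square)
            moreover have "(sgn (S n v) - b) /\<^sub>R \<tau> n = ((\<sigma> - ?m) / (?m * \<tau> n)) *\<^sub>R b + z /\<^sub>R ?m"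
            proof -
              have "sgn (S n v) = (\<sigma> / ?m) *\<^sub>R b + (\<tau> n / ?m) *\<^sub>R z"
                unfolding sgn_div_norm by (subst (2) S) (simp add: scaleR_add_right divide_inverse mult.commute)
              then have "sgn (S n v) - b = (\<sigma> / ?m - 1) *\<^sub>R b + (\<tau> n / ?m) *\<^sub>R z" by (simp add: scaleR_diff_left)
              then have "(sgn (S n v) - b) /\<^sub>R \<tau> n = ((\<sigma> / ?m - 1) / \<tau> n) *\<^sub>R b + ((\<tau> n / ?m) / \<tau> n) *\<^sub>R z"
                by (simp add: scaleR_add_right divide_inverse mult.commute)
              moreover have "(\<sigma> / ?m - 1) / \<tau> n = (\<sigma> - ?m) / (?m * \<tau> n)" using m by (simp add: diff_divide_distrib)
              moreover have "(\<tau> n / ?m) / \<tau> n = inverse ?m" using \<tau>(1)[of n] by (simp add: divide_inverse)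
              ultimately show ?thesis by simp
            qed
            ultimately show ?thesis by simp
          qed
          have "(\<lambda>n. (- \<tau> n * (norm z)\<^sup>2 / (norm (S n v) * (\<sigma> + norm (S n v)))) *\<^sub>R b + z /\<^sub>R norm (S n v))
              \<longlonglongrightarrow> (- 0 * (norm z)\<^sup>2 / (\<bar>\<sigma>\<bar> * (\<sigma> + \<bar>\<sigma>\<bar>))) *\<^sub>R b + z /\<^sub>R \<bar>\<sigma>\<bar>"
            using 3 by (intro tendsto_intros \<tau>(2) nS_lim) auto
          then show ?thesis unfolding eq using 3 by simp
        qed
        then have "(\<lambda>n. R *\<^sub>R L ((sgn (S n v) - b) /\<^sub>R \<tau> n)) \<longlonglongrightarrow> R *\<^sub>R L (z /\<^sub>R \<sigma>)"
          by (rule tendsto_scaleR[OF tendsto_const bounded_linear.tendsto[OF linear_conv_bounded_linear[THEN iffD1, OF lin]]])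
        moreover have "R *\<^sub>R L ((sgn (S n v) - b) /\<^sub>R \<tau> n) = (X n - (p + R *\<^sub>R L b)) /\<^sub>R \<tau> n" for n
          by (simp add: X_def linear_scale[OF lin] linear_diff[OF lin] scaleR_diff_right mult.commute)
        moreover have "R *\<^sub>R L (z /\<^sub>R \<sigma>) = L ((R / \<sigma>) *\<^sub>R z)"
          by (simp add: linear_scale[OF lin] divide_inverse)
        ultimately have "(\<lambda>n. (X n - (p + R *\<^sub>R L b)) /\<^sub>R \<tau> n) \<longlonglongrightarrow> L ((R / \<sigma>) *\<^sub>R z)" by simp
        then have "(\<lambda>n. G n (X n)) \<longlonglongrightarrow> H ((R / \<sigma>) *\<^sub>R z)"
          by (intro lim X) (simp add: zb)
        moreover have "\<forall>\<^sub>F n in sequentially. G n (X n) = F n (S n v)"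
        proof -
          have "\<forall>\<^sub>F n in sequentially. norm (S n v) < R" using order_tendstoD(2)[OF nS_lim, of R] 3 by simp
          then show ?thesis by eventually_elim (use S0 in \<open>simp add: F_def X_def\<close>)
        qed
        ultimately have "(\<lambda>n. F n (S n v)) \<longlonglongrightarrow> H ((R / \<sigma>) *\<^sub>R z)" by (rule Lim_transform_eventually)
        then show ?thesis using 3 by (simp add: \<sigma>_def z_def)
      qed
    qed
  qed
  have "(\<lambda>n. LINT v|lborel. F n (S n v)) \<longlonglongrightarrow> (LINT v|lborel. indicator {0<..<R} (v \<bullet> b) * H ((R / (v \<bullet> b)) *\<^sub>R (v - (v \<bullet> b) *\<^sub>R b)))"
  proof (rule integral_dominated_convergence[where w="\<lambda>v. C * (indicator {-R..R} (v \<bullet> b) * exp (- c * (norm (v - (v \<bullet> b) *\<^sub>R b))\<^sup>2))"])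
    show "integrable lborel (\<lambda>v. C * (indicator {-R..R} (v \<bullet> b) * exp (- c * (norm (v - (v \<bullet> b) *\<^sub>R b))\<^sup>2)))"
      by (intro integrable_mult_right integrable_sector_gaussian[OF b c])
    show "(\<lambda>v. F n (S n v)) \<in> borel_measurable lborel" for n unfolding S_def by measurable
    show "AE v in lborel. norm (F n (S n v)) \<le> C * (indicator {-R..R} (v \<bullet> b) * exp (- c * (norm (v - (v \<bullet> b) *\<^sub>R b))\<^sup>2))" for n
      using F_bound by simp
  qed (use F_lim in auto)
  then show ?thesis unfolding F_int by (intro tendsto_intros)
qed

section \<open>Geometry at the touching point\<close>

text \<open>The mean value theorem is applied to the second-order remainder along the segment from 0
  to \<open>v\<close>; its derivative is the first-order error of the gradient, paired with
  \<open>v\<close>, and differentiability of the gradient at 0 makes that error small.\<close>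

lemma C2_on_taylor2:
  fixes \<phi> :: "'a::euclidean_space \<Rightarrow> real"
  assumes \<phi>: "C2_on (ball 0 r) \<phi>" and r: "0 < r" and \<eta>: "0 < \<eta>"
  shows "\<exists>\<delta>>0. \<delta> \<le> r \<and> (\<forall>v. norm v < \<delta> \<longrightarrow> \<bar>\<phi> v - \<phi> 0 - grad \<phi> 0 \<bullet> v - (hess \<phi> 0 v \<bullet> v) / 2\<bar> \<le> \<eta> * (norm v)\<^sup>2)"
proof -
  have diff: "\<phi> differentiable (at x)" "grad \<phi> differentiable (at x)" if "norm x < r" for x
    using \<phi> that unfolding C2_on_def by auto
  have der: "(grad \<phi> has_derivative hess \<phi> 0) (at 0)"
    unfolding hess_def using diff(2)[of 0] r frechet_derivative_works by auto
  then have lin: "linear (hess \<phi> 0)" using has_derivative_linear by blast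
  obtain d where d: "d > 0" "\<And>y. norm y < d \<Longrightarrow> norm (grad \<phi> y - grad \<phi> 0 - hess \<phi> 0 y) \<le> \<eta> * norm y"
    using der \<eta> unfolding has_derivative_at_alt by (metis diff_zero)
  have "\<bar>\<phi> v - \<phi> 0 - grad \<phi> 0 \<bullet> v - (hess \<phi> 0 v \<bullet> v) / 2\<bar> \<le> \<eta> * (norm v)\<^sup>2" if v: "norm v < min d r" for v
  proof -
    define \<psi> where "\<psi> s = \<phi> (0 + s *\<^sub>R v) - s * (grad \<phi> 0 \<bullet> v) - s\<^sup>2 * (hess \<phi> 0 v \<bullet> v) / 2" for s
    define \<psi>' where "\<psi>' s = (grad \<phi> (0 + s *\<^sub>R v) - grad \<phi> 0 - hess \<phi> 0 (s *\<^sub>R v)) \<bullet> v" for s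
    have "(\<psi> has_real_derivative \<psi>' s) (at s)" if s: "0 \<le> s" "s \<le> 1" for s
    proof -
      have "norm (0 + s *\<^sub>R v) \<le> norm v" using s by (simp add: mult_left_le_one_le)
      then have "\<phi> differentiable (at (0 + s *\<^sub>R v))" using v by (intro diff(1)) auto
      note D = DERIV_along_line[OF this]
      have D1: "((\<lambda>s. s * (grad \<phi> 0 \<bullet> v)) has_real_derivative grad \<phi> 0 \<bullet> v) (at s)"
        and D2: "((\<lambda>s. s\<^sup>2 * (hess \<phi> 0 v \<bullet> v) / 2) has_real_derivative s * (hess \<phi> 0 v \<bullet> v)) (at s)"
        by (auto intro!: derivative_eq_intros)
      show ?thesis unfolding \<psi>_def[abs_def] \<psi>'_def
        using DERIV_diff[OF DERIV_diff[OF D D1] D2] by (simp add: linear_scale[OF lin] inner_diff_left)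
    qed
    then obtain s where s: "0 < s" "s < 1" "\<psi> 1 - \<psi> 0 = (1 - 0) * \<psi>' s"
      using MVT2[of 0 1 \<psi> \<psi>'] by auto
    have sv: "norm (s *\<^sub>R v) \<le> norm v" using s by (simp add: mult_left_le_one_le)
    have "\<bar>\<psi>' s\<bar> \<le> norm (grad \<phi> (s *\<^sub>R v) - grad \<phi> 0 - hess \<phi> 0 (s *\<^sub>R v)) * norm v"
      unfolding \<psi>'_def using Cauchy_Schwarz_ineq2 by simp
    also have "\<dots> \<le> (\<eta> * norm (s *\<^sub>R v)) * norm v"
      using sv v by (intro mult_right_mono d(2)) auto
    also have "\<dots> \<le> (\<eta> * norm v) * norm v" using sv \<eta> by (intro mult_right_mono mult_left_mono) auto
    finally have "\<bar>\<psi>' s\<bar> \<le> \<eta> * (norm v)\<^sup>2" by (simp add: power2_eq_square mult.assoc)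
    moreover have "\<psi>' s = \<phi> v - \<phi> 0 - grad \<phi> 0 \<bullet> v - (hess \<phi> 0 v \<bullet> v) / 2"
      using s(3) by (simp add: \<psi>_def)
    ultimately show ?thesis by simp
  qed
  then show ?thesis using d(1) r by (intro exI[of _ "min d r"]) auto
qed

section \<open>The tangential projection and the local graph\<close>

definition tang :: "'a::euclidean_space \<Rightarrow> 'a \<Rightarrow> 'a" where
  "tang \<nu> x = x - (x \<bullet> \<nu>) *\<^sub>R \<nu>"

lemma tang_inner: "norm \<nu> = 1 \<Longrightarrow> tang \<nu> x \<bullet> \<nu> = 0"
  by (simp add: tang_def inner_diff_left dot_square_norm)

lemma norm_tang_pythagoras: "norm \<nu> = 1 \<Longrightarrow> (norm x)\<^sup>2 = (norm (tang \<nu> x))\<^sup>2 + (x \<bullet> \<nu>)\<^sup>2"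
proof -
  assume "norm \<nu> = 1"
  then have "\<nu> \<bullet> \<nu> = 1" by (simp add: dot_square_norm)
  then show ?thesis
    unfolding power2_norm_eq_inner tang_def
    by (simp add: inner_diff_left inner_diff_right power2_eq_square inner_commute[of \<nu> x])
qed

lemma norm_tang_le: "norm \<nu> = 1 \<Longrightarrow> norm (tang \<nu> x) \<le> norm x"
  by (rule power2_le_imp_le) (simp_all add: norm_tang_pythagoras[of \<nu> x])

lemma norm_diff_unit:
  assumes "norm \<nu> = 1"
  shows "(norm (x - c *\<^sub>R \<nu>))\<^sup>2 = (norm x)\<^sup>2 - 2 * c * (x \<bullet> \<nu>) + c\<^sup>2"
proof -
  have "\<nu> \<bullet> \<nu> = 1" using assms by (simp add: dot_square_norm)
  then show ?thesis
    unfolding power2_norm_eq_inner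
    by (simp add: inner_diff_left inner_diff_right inner_commute[of \<nu> x] power2_eq_square algebra_simps)
qed

lemma tang_diff: "tang \<nu> (x - y) = tang \<nu> x - tang \<nu> y"
  by (simp add: tang_def inner_diff_left algebra_simps)

lemma tang_scale: "tang \<nu> (c *\<^sub>R x) = c *\<^sub>R tang \<nu> x"
  by (simp add: tang_def algebra_simps)

lemma tang_id: "x \<bullet> \<nu> = 0 \<Longrightarrow> tang \<nu> x = x"
  by (simp add: tang_def)

text \<open>The part of the ball strictly below the graph is open and misses \<Omega>, hence misses
  its closure. Frontier points are in the closure but not in \<Omega>, which leaves only the graph
  itself.\<close>

lemma epigraph_frontier:
  fixes \<Omega> :: "'a::euclidean_space set"
  assumes \<Omega>: "open \<Omega>" and ep: "C2_epigraph_near \<Omega> q r \<nu> \<phi>" and y: "y \<in> ball q r"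
  shows "y \<in> frontier \<Omega> \<Longrightarrow> \<phi> (tang \<nu> (y - q)) = (y - q) \<bullet> \<nu>"
    and "y \<in> closure \<Omega> \<Longrightarrow> \<phi> (tang \<nu> (y - q)) \<le> (y - q) \<bullet> \<nu>"
proof -
  have r: "0 < r" "norm \<nu> = 1" and C2: "C2_on (ball 0 r) \<phi>"
    and iff: "\<And>x. x \<in> ball q r \<Longrightarrow> x \<in> \<Omega> \<longleftrightarrow> \<phi> (tang \<nu> (x - q)) < (x - q) \<bullet> \<nu>"
    using ep unfolding C2_epigraph_near_def tang_def by auto
  have "continuous_on (ball 0 r) \<phi>"
    using C2 unfolding C2_on_def by (meson continuous_at_imp_continuous_on differentiable_imp_continuous_within)
  then have cont: "continuous_on (ball q r) (\<lambda>x. \<phi> (tang \<nu> (x - q)))"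
  proof (rule continuous_on_compose2)
    show "continuous_on (ball q r) (\<lambda>x. tang \<nu> (x - q))" unfolding tang_def by (intro continuous_intros)
    show "(\<lambda>x. tang \<nu> (x - q)) ` ball q r \<subseteq> ball 0 r"
    proof (clarsimp simp: dist_norm)
      fix x assume "norm (q - x) < r"
      then show "norm (tang \<nu> (x - q)) < r"
        using norm_tang_le[OF r(2), of "x - q"] by (simp add: norm_minus_commute)
    qed
  qed
  define A where "A = {x \<in> ball q r. (x - q) \<bullet> \<nu> < \<phi> (tang \<nu> (x - q))}"
  have "open (ball q r \<inter> (\<lambda>x. \<phi> (tang \<nu> (x - q)) - (x - q) \<bullet> \<nu>) -` {0<..})"
    by (intro continuous_open_preimage continuous_intros cont) auto
  also have "ball q r \<inter> (\<lambda>x. \<phi> (tang \<nu> (x - q)) - (x - q) \<bullet> \<nu>) -` {0<..} = A"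
    by (auto simp: A_def)
  finally have "open A" .
  show fr: "\<phi> (tang \<nu> (y - q)) = (y - q) \<bullet> \<nu>" if "y \<in> frontier \<Omega>"
  proof (rule ccontr)
    assume ne: "\<phi> (tang \<nu> (y - q)) \<noteq> (y - q) \<bullet> \<nu>"
    have "y \<notin> \<Omega>" "y \<in> closure \<Omega>" using that \<Omega> by (auto simp: frontier_def interior_open)
    then have "y \<in> A" using iff[OF y] ne y by (auto simp: A_def)
    moreover have "A \<inter> \<Omega> = {}" using iff by (auto simp: A_def)
    ultimately show False using \<open>open A\<close> \<open>y \<in> closure \<Omega>\<close> by (metis disjoint_iff open_Int_closure_eq_empty)
  qed
  show "\<phi> (tang \<nu> (y - q)) \<le> (y - q) \<bullet> \<nu>" if "y \<in> closure \<Omega>"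
    using that fr iff[OF y] \<Omega> by (cases "y \<in> \<Omega>") (auto simp: frontier_def interior_open)
qed

text \<open>The tangential eigenbasis is transported to the standard basis, with \<open>b\<close> playing the role of
  the exterior normal, so that the rest of the argument is indexed by \<open>Basis\<close>.\<close>

lemma principal_frame:
  fixes q :: "'a::euclidean_space" and \<kappa> :: "nat \<Rightarrow> real"
  assumes pc: "principal_curvatures \<Omega> q \<kappa>"
  obtains r \<nu> \<phi> b and L :: "'a \<Rightarrow> 'a" and k :: "'a \<Rightarrow> real" where "C2_epigraph_near \<Omega> q r \<nu> \<phi>" "\<And>v. v \<bullet> \<nu> = 0 \<Longrightarrow> grad \<phi> 0 \<bullet> v = 0"
    "orthogonal_transformation L" "b \<in> Basis" "L b = - \<nu>"
    "\<And>v. v \<bullet> \<nu> = 0 \<Longrightarrow> hess \<phi> 0 v \<bullet> v = (\<Sum>i\<in>Basis - {b}. k i * (v \<bullet> L i)\<^sup>2)"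
    "\<And>i. i \<in> Basis - {b} \<Longrightarrow> \<exists>j\<in>{1..DIM('a) - 1}. k i = \<kappa> j"
    "\<And>g. (\<Prod>i\<in>Basis - {b}. g (k i)) = (\<Prod>j\<in>{1..DIM('a) - 1}. (g (\<kappa> j) :: real))"
proof -
  let ?J = "{1..DIM('a) - 1}"
  obtain r \<nu> \<phi> e where ep: "C2_epigraph_near \<Omega> q r \<nu> \<phi>" and gr: "\<And>v. v \<bullet> \<nu> = 0 \<Longrightarrow> grad \<phi> 0 \<bullet> v = 0"
    and e\<nu>: "\<And>i. i \<in> ?J \<Longrightarrow> e i \<bullet> \<nu> = 0"
    and ee: "\<And>i j. i \<in> ?J \<Longrightarrow> j \<in> ?J \<Longrightarrow> e i \<bullet> e j = (if i = j then 1 else 0)"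
    and he: "\<And>i v. i \<in> ?J \<Longrightarrow> v \<bullet> \<nu> = 0 \<Longrightarrow> hess \<phi> 0 (e i) \<bullet> v = \<kappa> i * (e i \<bullet> v)"
    using pc unfolding principal_curvatures_def by blast
  have \<nu>: "norm \<nu> = 1" "\<nu> \<bullet> \<nu> = 1" and r: "0 < r" and C2: "C2_on (ball 0 r) \<phi>"
    using ep unfolding C2_epigraph_near_def by (auto simp: dot_square_norm)
  obtain b :: 'a where b: "b \<in> Basis" using nonempty_Basis by blast
  have "card (Basis - {b}) = card ?J" using b by simp
  then obtain \<beta> where \<beta>: "bij_betw \<beta> (Basis - {b}) ?J"
    using finite_same_card_bij[of "Basis - {b}" ?J] by auto
  \<comment> \<open>The minus sign makes \<open>p + R *\<^sub>R L b\<close> the touching point,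
    since \<open>p\<close> will lie at \<open>q + R *\<^sub>R \<nu>\<close>.\<close>
  define E where "E i = (if i = b then - \<nu> else e (\<beta> i))" for i
  have \<beta>J: "\<beta> i \<in> ?J" if "i \<in> Basis" "i \<noteq> b" for i using \<beta> that by (auto simp: bij_betw_def)
  have E: "E i \<bullet> E j = (if i = j then 1 else 0)" if "i \<in> Basis" "j \<in> Basis" for i j
  proof -
    have "\<beta> i = \<beta> j \<longleftrightarrow> i = j" if "i \<noteq> b" "j \<noteq> b"
      using \<beta> that \<open>i \<in> Basis\<close> \<open>j \<in> Basis\<close> by (auto simp: bij_betw_def inj_on_def)
    then show ?thesis
      using that ee[OF \<beta>J \<beta>J, of i j] e\<nu>[OF \<beta>J, of i] e\<nu>[OF \<beta>J, of j] \<nu>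
      by (auto simp: E_def inner_commute)
  qed
  define L where "L x = (\<Sum>i\<in>Basis. (x \<bullet> i) *\<^sub>R E i)" for x
  have linL: "linear L" unfolding L_def
    by (intro linearI) (simp_all add: inner_add_left scaleR_add_left sum.distrib scaleR_sum_right)
  have orth: "orthogonal_transformation L"
    unfolding orthogonal_transformation_def
  proof (intro conjI allI linL)
    fix v w
    have "L v \<bullet> L w = (\<Sum>i\<in>Basis. \<Sum>j\<in>Basis. (v \<bullet> i) * (w \<bullet> j) * (E i \<bullet> E j))"
      by (simp add: L_def inner_sum_left inner_sum_right sum_distrib_left mult_ac) (subst sum.swap, rule refl)
    also have "\<dots> = (\<Sum>i\<in>Basis. \<Sum>j\<in>Basis. if i = j then (v \<bullet> i) * (w \<bullet> j) else 0)"
      by (intro sum.cong refl) (simp add: E)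
    also have "\<dots> = v \<bullet> w" by (subst euclidean_inner) (simp add: sum.delta)
    finally show "L v \<bullet> L w = v \<bullet> w" .
  qed
  have Li: "L i = E i" if "i \<in> Basis" for i
  proof -
    have "L i = (\<Sum>j\<in>Basis. if j = i then E j else 0)"
      unfolding L_def using that by (intro sum.cong refl) (auto simp: inner_Basis)
    then show ?thesis using that by simp
  qed
  define k where "k i = \<kappa> (\<beta> i)" for i
  have "grad \<phi> differentiable (at 0)" using C2 r unfolding C2_on_def by auto
  then have linH: "linear (hess \<phi> 0)" unfolding hess_def by (rule linear_frechet_derivative)
  have hess: "hess \<phi> 0 v \<bullet> v = (\<Sum>i\<in>Basis - {b}. k i * (v \<bullet> L i)\<^sup>2)" if v: "v \<bullet> \<nu> = 0" for v
  proof -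
    obtain w where w: "v = L w" using orthogonal_transformation_surj[OF orth] by (metis surjD)
    have "w \<bullet> b = L w \<bullet> L b" using orth by (simp add: orthogonal_transformation_def)
    then have "w \<bullet> b = 0" using v w b by (simp add: Li E_def)
    then have "v = (\<Sum>i\<in>Basis - {b}. (w \<bullet> i) *\<^sub>R L i)"
    proof -
      have "v = (\<Sum>i\<in>Basis - {b}. (w \<bullet> i) *\<^sub>R E i)"
        unfolding w using b \<open>w \<bullet> b = 0\<close> by (subst L_def) (simp add: sum.remove[of Basis b])
      also have "\<dots> = (\<Sum>i\<in>Basis - {b}. (w \<bullet> i) *\<^sub>R L i)"
        by (intro sum.cong refl) (simp add: Li)
      finally show ?thesis .
    qed
    moreover have "w \<bullet> i = v \<bullet> L i" for i using orth by (simp add: w orthogonal_transformation_def)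
    ultimately have vs: "v = (\<Sum>i\<in>Basis - {b}. (v \<bullet> L i) *\<^sub>R L i)" by simp
    have "hess \<phi> 0 v = (\<Sum>i\<in>Basis - {b}. (v \<bullet> L i) *\<^sub>R hess \<phi> 0 (L i))"
      by (subst vs) (simp add: linear_sum[OF linH] linear_scale[OF linH])
    then have "hess \<phi> 0 v \<bullet> v = (\<Sum>i\<in>Basis - {b}. (v \<bullet> L i) * (hess \<phi> 0 (L i) \<bullet> v))"
      by (simp add: inner_sum_left)
    also have "\<dots> = (\<Sum>i\<in>Basis - {b}. k i * (v \<bullet> L i)\<^sup>2)"
    proof (intro sum.cong refl)
      fix i assume i: "i \<in> Basis - {b}"
      then have "hess \<phi> 0 (L i) \<bullet> v = k i * (L i \<bullet> v)"
        using he[OF \<beta>J v, of i] by (simp add: Li E_def k_def)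
      then show "(v \<bullet> L i) * (hess \<phi> 0 (L i) \<bullet> v) = k i * (v \<bullet> L i)\<^sup>2"
        by (simp add: power2_eq_square inner_commute)
    qed
    finally show ?thesis .
  qed
  show ?thesis
  proof (rule that[OF ep _ orth b])
    show "\<And>v. v \<bullet> \<nu> = 0 \<Longrightarrow> grad \<phi> 0 \<bullet> v = 0" by (rule gr)
    show "\<And>v. v \<bullet> \<nu> = 0 \<Longrightarrow> hess \<phi> 0 v \<bullet> v = (\<Sum>i\<in>Basis - {b}. k i * (v \<bullet> L i)\<^sup>2)" by (rule hess)
    show "L b = - \<nu>" using b by (simp add: Li E_def)
    show "\<exists>j\<in>?J. k i = \<kappa> j" if "i \<in> Basis - {b}" for i using that \<beta>J by (auto simp: k_def)
    show "(\<Prod>i\<in>Basis - {b}. g (k i)) = (\<Prod>j\<in>?J. (g (\<kappa> j) :: real))" for g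
      using prod.reindex_bij_betw[OF \<beta>, of "\<lambda>j. g (\<kappa> j)"] by (simp add: k_def)
  qed
qed

lemma norm_sum_orthogonal_frame:
  fixes v :: "'a::euclidean_space" and L :: "'a \<Rightarrow> 'a"
  assumes L: "orthogonal_transformation L" and b: "b \<in> Basis" and v: "v \<bullet> L b = 0"
  shows "(norm v)\<^sup>2 = (\<Sum>i\<in>Basis - {b}. (v \<bullet> L i)\<^sup>2)"
proof -
  obtain w where w: "v = L w" using orthogonal_transformation_surj[OF L] by (metis surjD)
  have wi: "w \<bullet> i = v \<bullet> L i" for i using L by (simp add: w orthogonal_transformation_def)
  have "(norm v)\<^sup>2 = (norm w)\<^sup>2" unfolding w using orthogonal_transformation_norm[OF L] by simp
  also have "\<dots> = (\<Sum>i\<in>Basis. (w \<bullet> i)\<^sup>2)"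
    unfolding power2_norm_eq_inner by (subst euclidean_inner) (simp add: power2_eq_square)
  also have "\<dots> = (\<Sum>i\<in>Basis - {b}. (w \<bullet> i)\<^sup>2)" using b v by (simp add: sum.remove[of Basis b] wi)
  finally show ?thesis by (simp add: wi)
qed

text \<open>If the direction \<open>m\<close> from \<open>q\<close> to \<open>p\<close> were not
  \<nu>, then \<open>w = m - \<nu>\<close> would form the positive product \<gamma> with
  \<open>m\<close> and \<open>- \<gamma>\<close> with \<nu>. Moving along \<open>w\<close> thus
  enters the ball while descending linearly, whereas the graph leaves its tangent plane only
  quadratically.\<close>

lemma touching_ball_center:
  fixes \<Omega> :: "'a::euclidean_space set"
  assumes \<Omega>: "open \<Omega>" and ep: "C2_epigraph_near \<Omega> q r \<nu> \<phi>" and gr: "\<And>v. v \<bullet> \<nu> = 0 \<Longrightarrow> grad \<phi> 0 \<bullet> v = 0"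
    and q: "q \<in> frontier \<Omega>" and R: "0 < R" and ball: "ball p R \<subseteq> \<Omega>" and qs: "q \<in> sphere p R"
  shows "p = q + R *\<^sub>R \<nu>"
proof (rule ccontr)
  have r: "0 < r" and \<nu>: "norm \<nu> = 1" and C2: "C2_on (ball 0 r) \<phi>"
    using ep unfolding C2_epigraph_near_def by auto
  have \<phi>0: "\<phi> 0 = 0" using epigraph_frontier(1)[OF \<Omega> ep _ q] r by (simp add: tang_def)
  define m where "m = (p - q) /\<^sub>R R"
  have m: "norm m = 1" "p = q + R *\<^sub>R m" using qs R by (auto simp: m_def dist_norm)
  assume "p \<noteq> q + R *\<^sub>R \<nu>"
  then have "m \<noteq> \<nu>" using m by auto
  define w where "w = m - \<nu>"
  define \<gamma> where "\<gamma> = 1 - m \<bullet> \<nu>"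
  have w2: "(norm w)\<^sup>2 = 2 * \<gamma>"
    using norm_diff_unit[OF \<nu>, of m 1] m(1) by (simp add: w_def \<gamma>_def)
  have "0 < (norm w)\<^sup>2" using \<open>m \<noteq> \<nu>\<close> by (simp add: w_def)
  then have \<gamma>: "0 < \<gamma>" using w2 by simp
  have "m \<bullet> m = 1" "\<nu> \<bullet> \<nu> = 1" using m(1) \<nu> by (simp_all add: dot_square_norm)
  then have wm: "w \<bullet> m = \<gamma>" "w \<bullet> \<nu> = - \<gamma>"
    by (simp_all add: w_def \<gamma>_def inner_diff_left inner_commute[of \<nu> m])
  obtain \<delta> where \<delta>: "\<delta> > 0" "\<delta> \<le> r" and T:
    "\<And>v. norm v < \<delta> \<Longrightarrow> \<bar>\<phi> v - \<phi> 0 - grad \<phi> 0 \<bullet> v - (hess \<phi> 0 v \<bullet> v) / 2\<bar> \<le> 1 * (norm v)\<^sup>2"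
    using C2_on_taylor2[OF C2 r, of 1] by auto
  have "grad \<phi> differentiable (at 0)" using C2 r unfolding C2_on_def by auto
  then have "bounded_linear (hess \<phi> 0)" unfolding hess_def using frechet_derivative_works has_derivative_bounded_linear by blast
  then have linH: "linear (hess \<phi> 0)" by (rule bounded_linear.linear)
  define t where "t = tang \<nu> w"
  \<comment> \<open>Bounds the quadratic Taylor part together with its error: the graph at
    \<open>s *\<^sub>R t\<close> is at most \<open>s\<^sup>2 * B\<close> away from the tangent
    plane.\<close>
  define B where "B = \<bar>hess \<phi> 0 t \<bullet> t\<bar> / 2 + (norm t)\<^sup>2"
  have B: "0 \<le> B" by (simp add: B_def)
  have tw: "norm t \<le> norm w" unfolding t_def by (rule norm_tang_le[OF \<nu>])
  text \<open>For small \<open>s\<close> the point \<open>q + s w\<close> lies in the ball, but below the graph.\<close>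
  define s where "s = min (R / 2) (min (\<delta> / (2 * (norm w + 1))) (\<gamma> / (2 * (B + 1))))"
  have s: "0 < s" "s \<le> R / 2" "s \<le> \<delta> / (2 * (norm w + 1))" "s \<le> \<gamma> / (2 * (B + 1))"
    unfolding s_def using R \<delta> \<gamma> B by (simp_all only: min.cobounded1 min.coboundedI2 min.cobounded2)
      (auto intro!: divide_pos_pos simp: add_nonneg_pos)
  have "0 < 2 * (norm w + 1)" by (simp add: add_nonneg_pos)
  then have "s * (2 * (norm w + 1)) \<le> \<delta>" using s(3) by (simp only: pos_le_divide_eq)
  then have sw: "s * norm w < \<delta>"
    using s(1) mult_nonneg_nonneg[OF less_imp_le[OF s(1)] norm_ge_zero[of w]]
    unfolding distrib_left mult.left_commute[of s] mult_1_right by linarith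
  have sB: "s * B < \<gamma>"
  proof -
    have "0 < 2 * (B + 1)" using B by simp
    then have "s * (2 * (B + 1)) \<le> \<gamma>" using s(4) by (simp only: pos_le_divide_eq)
    then show ?thesis using s(1) mult_nonneg_nonneg[OF less_imp_le[OF s(1)] B]
      unfolding distrib_left mult.left_commute[of s] mult_1_right by linarith
  qed
  have "(norm (s *\<^sub>R w - R *\<^sub>R m))\<^sup>2 = s\<^sup>2 * (norm w)\<^sup>2 - 2 * s * R * (w \<bullet> m) + R\<^sup>2"
    using norm_diff_unit[OF m(1), of "s *\<^sub>R w" R] by (simp add: power_mult_distrib)
  also have "\<dots> = R\<^sup>2 - 2 * s * \<gamma> * (R - s)"
    unfolding w2 wm by (simp add: algebra_simps power2_eq_square)
  also have "\<dots> < R\<^sup>2" using s R \<gamma> by simp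
  finally have "norm (s *\<^sub>R w - R *\<^sub>R m) < R" using R by (meson less_imp_le power_less_imp_less_base)
  then have "q + s *\<^sub>R w \<in> ball p R" by (simp add: m(2) dist_norm norm_minus_commute)
  then have "q + s *\<^sub>R w \<in> \<Omega>" using ball by blast
  moreover have "q + s *\<^sub>R w \<in> ball q r" using sw \<delta> s(1) by (simp add: dist_norm)
  ultimately have "\<phi> (tang \<nu> (s *\<^sub>R w)) < s * (w \<bullet> \<nu>)"
    using ep unfolding C2_epigraph_near_def tang_def by (metis add_diff_cancel_left' inner_scaleR_left)
  then have lt: "\<phi> (s *\<^sub>R t) < - s * \<gamma>" by (simp add: tang_scale t_def wm)
  have "s * norm t \<le> s * norm w" using tw s(1) by (intro mult_left_mono) auto
  also note sw
  finally have "norm (s *\<^sub>R t) < \<delta>" using s(1) by simp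
  from T[OF this] have "\<bar>\<phi> (s *\<^sub>R t) - grad \<phi> 0 \<bullet> (s *\<^sub>R t) - (s\<^sup>2 * (hess \<phi> 0 t \<bullet> t)) / 2\<bar> \<le> s\<^sup>2 * (norm t)\<^sup>2"
    by (simp add: \<phi>0 linear_scale[OF linH] power2_eq_square power_mult_distrib mult_ac)
  moreover have "grad \<phi> 0 \<bullet> (s *\<^sub>R t) = 0" using gr[of "s *\<^sub>R t"] tang_inner[OF \<nu>] by (simp add: t_def)
  moreover have "\<bar>s\<^sup>2 * (hess \<phi> 0 t \<bullet> t) / 2\<bar> = s\<^sup>2 * (\<bar>hess \<phi> 0 t \<bullet> t\<bar> / 2)" by (simp add: abs_mult)
  ultimately have "\<bar>\<phi> (s *\<^sub>R t)\<bar> \<le> s\<^sup>2 * (\<bar>hess \<phi> 0 t \<bullet> t\<bar> / 2) + s\<^sup>2 * (norm t)\<^sup>2" by linarith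
  then have "\<bar>\<phi> (s *\<^sub>R t)\<bar> \<le> s * (s * B)" by (simp add: B_def algebra_simps power2_eq_square)
  also have "\<dots> < s * \<gamma>" using sB s(1) by simp
  finally show False using lt by simp
qed

text \<open>Near \<open>q\<close>, with tangential part \<open>w\<close> and height
  \<open>h\<close>, the right-hand side is \<open>(norm w)\<^sup>2 + h\<^sup>2 - 2 * R * h\<close>,
  and the curvature gap keeps \<open>2 * R * h\<close> below a fraction of
  \<open>(norm w)\<^sup>2\<close> less than 1. Away from \<open>q\<close> the frontier is compact
  and strictly outside the closed ball.\<close>

lemma frontier_quadratic_separation:
  fixes \<Omega> :: "'a::euclidean_space set" and L :: "'a \<Rightarrow> 'a" and k :: "'a \<Rightarrow> real"
  assumes \<Omega>: "open \<Omega>" "bounded \<Omega>" and ep: "C2_epigraph_near \<Omega> q r \<nu> \<phi>"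
    and gr: "\<And>v. v \<bullet> \<nu> = 0 \<Longrightarrow> grad \<phi> 0 \<bullet> v = 0"
    and q: "q \<in> frontier \<Omega>" and R: "0 < R" and ball: "ball p R \<subseteq> \<Omega>" and fr: "sphere p R \<inter> frontier \<Omega> = {q}"
    and L: "orthogonal_transformation L" "b \<in> Basis" "L b = - \<nu>"
    and hess: "\<And>v. v \<bullet> \<nu> = 0 \<Longrightarrow> hess \<phi> 0 v \<bullet> v = (\<Sum>i\<in>Basis - {b}. k i * (v \<bullet> L i)\<^sup>2)"
    and k: "\<And>i. i \<in> Basis - {b} \<Longrightarrow> k i < 1 / R"
  shows "\<exists>c>0. \<forall>z\<in>frontier \<Omega>. c * (norm (z - q))\<^sup>2 \<le> (norm (z - p))\<^sup>2 - R\<^sup>2"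
proof -
  have r: "0 < r" and \<nu>: "norm \<nu> = 1" and C2: "C2_on (ball 0 r) \<phi>"
    using ep unfolding C2_epigraph_near_def by auto
  have \<phi>0: "\<phi> 0 = 0" using epigraph_frontier(1)[OF \<Omega>(1) ep _ q] r by (simp add: tang_def)
  have qs: "q \<in> sphere p R" using fr by blast
  have p: "p = q + R *\<^sub>R \<nu>"
    by (rule touching_ball_center[OF \<Omega>(1) ep _ q R ball qs]) (rule gr)
  \<comment> \<open>The least curvature gap; inserting 1 keeps the finite set nonempty.\<close>
  define m where "m = Min (insert 1 ((\<lambda>i. 1 / R - k i) ` (Basis - {b})))"
  have m: "0 < m" unfolding m_def using k by (subst Min_gr_iff) auto
  have mle: "m \<le> 1 / R - k i" if "i \<in> Basis - {b}" for i
    unfolding m_def using that by (intro Min_le) auto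
  \<comment> \<open>The tolerance \<open>m / 4\<close> uses up half of the gap in
    \<open>2 * h\<close> and leaves the margin \<open>m / 2\<close>.\<close>
  obtain \<delta> where \<delta>: "\<delta> > 0" "\<delta> \<le> r" and T:
    "\<And>v. norm v < \<delta> \<Longrightarrow> \<bar>\<phi> v - \<phi> 0 - grad \<phi> 0 \<bullet> v - (hess \<phi> 0 v \<bullet> v) / 2\<bar> \<le> m / 4 * (norm v)\<^sup>2"
    using C2_on_taylor2[OF C2 r, of "m / 4"] m by auto
  define c1 where "c1 = min 1 (R * m / 2)"
  have c1: "0 < c1" "c1 \<le> 1" "c1 \<le> R * m / 2" using R m by (auto simp: c1_def)
  have local: "c1 * (norm (z - q))\<^sup>2 \<le> (norm (z - p))\<^sup>2 - R\<^sup>2" if z: "z \<in> frontier \<Omega>" "norm (z - q) < \<delta>" for z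
  proof -
    define w where "w = tang \<nu> (z - q)"
    define h where "h = (z - q) \<bullet> \<nu>"
    have w\<nu>: "w \<bullet> \<nu> = 0" unfolding w_def by (rule tang_inner[OF \<nu>])
    have "norm w < \<delta>" using norm_tang_le[OF \<nu>, of "z - q"] z(2) by (simp add: w_def)
    from T[OF this] have "\<phi> w \<le> (\<Sum>i\<in>Basis - {b}. k i * (w \<bullet> L i)\<^sup>2) / 2 + m / 4 * (norm w)\<^sup>2"
      unfolding hess[OF w\<nu>] gr[OF w\<nu>] \<phi>0 by linarith
    moreover have "\<phi> w = h"
      using epigraph_frontier(1)[OF \<Omega>(1) ep _ z(1)] z(2) \<delta> by (simp add: w_def h_def dist_norm norm_minus_commute)
    ultimately have h: "2 * h \<le> (\<Sum>i\<in>Basis - {b}. k i * (w \<bullet> L i)\<^sup>2) + m / 2 * (norm w)\<^sup>2" by simp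
    have nw: "(norm w)\<^sup>2 = (\<Sum>i\<in>Basis - {b}. (w \<bullet> L i)\<^sup>2)"
      using norm_sum_orthogonal_frame[OF L(1,2), of w] w\<nu> L(3) by simp
    have "(\<Sum>i\<in>Basis - {b}. k i * (w \<bullet> L i)\<^sup>2) \<le> (\<Sum>i\<in>Basis - {b}. (1 / R - m) * (w \<bullet> L i)\<^sup>2)"
      by (intro sum_mono mult_right_mono) (use mle in force)+
    also have "\<dots> = (1 / R - m) * (norm w)\<^sup>2" by (simp add: nw sum_distrib_left)
    finally have "2 * h \<le> (1 / R - m / 2) * (norm w)\<^sup>2" using h by (simp add: algebra_simps)
    then have "R * (2 * h) \<le> R * ((1 / R - m / 2) * (norm w)\<^sup>2)" using R by (intro mult_left_mono) auto
    also have "\<dots> = (norm w)\<^sup>2 - R * m / 2 * (norm w)\<^sup>2" using R by (simp add: algebra_simps)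
    finally have hR: "2 * R * h \<le> (norm w)\<^sup>2 - R * m / 2 * (norm w)\<^sup>2" by simp
    have zq: "(norm (z - q))\<^sup>2 = (norm w)\<^sup>2 + h\<^sup>2" unfolding w_def h_def by (rule norm_tang_pythagoras[OF \<nu>])
    have "z - p = (z - q) - R *\<^sub>R \<nu>" by (simp add: p)
    then have "(norm (z - p))\<^sup>2 = (norm (z - q))\<^sup>2 - 2 * R * h + R\<^sup>2"
      unfolding h_def by (simp only: norm_diff_unit[OF \<nu>])
    then have "(norm (z - p))\<^sup>2 - R\<^sup>2 \<ge> R * m / 2 * (norm w)\<^sup>2 + 1 * h\<^sup>2" using hR zq by simp
    moreover have "c1 * (norm w)\<^sup>2 \<le> R * m / 2 * (norm w)\<^sup>2" "c1 * h\<^sup>2 \<le> 1 * h\<^sup>2"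
      by (rule mult_right_mono[OF c1(3)], simp) (rule mult_right_mono[OF c1(2)], simp)
    ultimately show ?thesis by (simp add: zq algebra_simps)
  qed
  have pos: "0 < (norm (z - p))\<^sup>2 - R\<^sup>2" if "z \<in> frontier \<Omega>" "z \<noteq> q" for z
  proof -
    have "z \<notin> \<Omega>" using that \<Omega> by (simp add: frontier_def interior_open)
    then have "z \<notin> ball p R" using ball by blast
    moreover have "z \<notin> sphere p R" using that fr by blast
    ultimately have "R < norm (z - p)" by (simp add: dist_norm norm_minus_commute)
    then show ?thesis using R by (simp add: power_strict_mono)
  qed
  define Z where "Z = frontier \<Omega> - ball q \<delta>"
  have "compact Z" unfolding Z_def using \<Omega>(2) by (intro compact_diff compact_frontier_bounded open_ball)
  obtain c2 where c2: "0 < c2" "\<And>z. z \<in> Z \<Longrightarrow> c2 * (norm (z - q))\<^sup>2 \<le> (norm (z - p))\<^sup>2 - R\<^sup>2"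
  proof (cases "Z = {}")
    case True
    then show ?thesis using that[of 1] by simp
  next
    case False
    have Zq: "z \<noteq> q" "z \<in> frontier \<Omega>" if "z \<in> Z" for z using that \<delta> by (auto simp: Z_def)
    \<comment> \<open>A positive continuous function on the compact set \<open>Z\<close>; its
      minimum is the constant away from \<open>q\<close>.\<close>
    let ?g = "\<lambda>z. ((norm (z - p))\<^sup>2 - R\<^sup>2) / (norm (z - q))\<^sup>2"
    have "continuous_on Z ?g" using Zq by (intro continuous_intros) auto
    then obtain z0 where z0: "z0 \<in> Z" "\<And>z. z \<in> Z \<Longrightarrow> ?g z0 \<le> ?g z"
      using continuous_attains_inf[OF \<open>compact Z\<close> False] by blast
    show ?thesis
    proof (rule that)
      show "0 < ?g z0" using pos[OF Zq(2,1)] Zq(1) z0(1) by simp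
      fix z assume z: "z \<in> Z"
      have "0 < (norm (z - q))\<^sup>2" using Zq(1)[OF z] by simp
      then show "?g z0 * (norm (z - q))\<^sup>2 \<le> (norm (z - p))\<^sup>2 - R\<^sup>2"
        using z0(2)[OF z] by (simp add: pos_le_divide_eq)
    qed
  qed
  show ?thesis
  proof (intro exI[of _ "min c1 c2"] conjI ballI)
    show "0 < min c1 c2" using c1 c2 by simp
    fix z assume z: "z \<in> frontier \<Omega>"
    show "min c1 c2 * (norm (z - q))\<^sup>2 \<le> (norm (z - p))\<^sup>2 - R\<^sup>2"
    proof (cases "norm (z - q) < \<delta>")
      case True
      have "min c1 c2 * (norm (z - q))\<^sup>2 \<le> c1 * (norm (z - q))\<^sup>2" by (intro mult_right_mono) auto
      then show ?thesis using local[OF z True] by linarith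
    next
      case False
      then have "z \<in> Z" using z by (simp add: Z_def dist_norm norm_minus_commute)
      moreover have "min c1 c2 * (norm (z - q))\<^sup>2 \<le> c2 * (norm (z - q))\<^sup>2" by (intro mult_right_mono) auto
      ultimately show ?thesis using c2(2)[of z] by linarith
    qed
  qed
qed

lemma sphere_subset_closure:
  fixes \<Omega> :: "'a::euclidean_space set"
  assumes \<Omega>: "open \<Omega>" and R: "0 < R" and ball: "ball p R \<subseteq> \<Omega>" and fr: "sphere p R \<inter> frontier \<Omega> = {q}" and x: "x \<in> sphere p R"
  shows "x \<in> closure \<Omega>" and "x \<noteq> q \<Longrightarrow> x \<in> \<Omega>"
proof -
  have "x \<in> closure (ball p R)" using x R by simp
  then show "x \<in> closure \<Omega>" using closure_mono[OF ball] by blast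
  moreover have "x \<notin> frontier \<Omega>" if "x \<noteq> q" using fr x that by blast
  ultimately show "x \<in> \<Omega>" if "x \<noteq> q" using that by (simp add: frontier_def interior_open[OF \<Omega>])
qed

text \<open>If such a ball left \<Omega>, the segment from its centre would meet the frontier at a
  point \<open>z\<close> within \<open>d\<close> of \<open>x\<close>. Then
  \<open>norm (z - q)\<close> is at least \<open>\<rho> / 2\<close>, so separation demands
  \<open>c0 * \<rho>\<^sup>2 / 4\<close>, while the triangle inequality allows only
  \<open>(R + d)\<^sup>2 - R\<^sup>2\<close>.\<close>

lemma cball_in_domain:
  fixes \<Omega> :: "'a::euclidean_space set"
  assumes \<Omega>: "open \<Omega>" and R: "0 < R" and ball: "ball p R \<subseteq> \<Omega>" and fr: "sphere p R \<inter> frontier \<Omega> = {q}"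
    and c0: "0 < c0" and sep: "\<And>z. z \<in> frontier \<Omega> \<Longrightarrow> c0 * (norm (z - q))\<^sup>2 \<le> (norm (z - p))\<^sup>2 - R\<^sup>2"
  shows "\<exists>c>0. \<forall>x\<in>sphere p R. x \<noteq> q \<longrightarrow> cball x (c * (norm (x - q))\<^sup>2) \<subseteq> \<Omega>"
\<comment> \<open>The first term gives \<open>d \<le> \<rho> / 2\<close> since
  \<open>\<rho> \<le> 2 * R\<close>; the second bounds \<open>3 * R * d\<close> by
  \<open>3 / 16 * c0 * \<rho>\<^sup>2\<close>, which is less than a quarter of
  \<open>c0 * \<rho>\<^sup>2\<close>.\<close>
proof (intro exI[of _ "min (1 / (4 * R)) (c0 / (16 * R))"] conjI ballI impI subsetI)
  define c where "c = min (1 / (4 * R)) (c0 / (16 * R))"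
  have c: "0 < c" "c \<le> 1 / (4 * R)" "c \<le> c0 / (16 * R)" using R c0 by (auto simp: c_def)
  then show "0 < min (1 / (4 * R)) (c0 / (16 * R))" by (simp add: c_def)
  fix x y assume x: "x \<in> sphere p R" "x \<noteq> q" and y: "y \<in> cball x (min (1 / (4 * R)) (c0 / (16 * R)) * (norm (x - q))\<^sup>2)"
  define \<rho> where "\<rho> = norm (x - q)"
  define d where "d = c * \<rho>\<^sup>2"
  have yd: "dist x y \<le> d" using y by (simp add: d_def c_def \<rho>_def)
  show "y \<in> \<Omega>"
  proof (rule ccontr)
    assume "y \<notin> \<Omega>"
    have "x \<in> \<Omega>" by (rule sphere_subset_closure(2)[OF \<Omega> R ball fr x])
    then have "closed_segment x y \<inter> frontier \<Omega> \<noteq> {}"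
      using \<open>y \<notin> \<Omega>\<close> by (intro connected_Int_frontier) auto
    then obtain z where z: "z \<in> closed_segment x y" "z \<in> frontier \<Omega>" by blast
    have "dist x z \<le> d"
      using z(1) yd dist_in_closed_segment[of z x y] by (simp add: dist_commute)
    then have xz: "norm (x - z) \<le> d" by (simp add: dist_norm)
    have \<rho>: "0 < \<rho>" using x by (simp add: \<rho>_def)
    have "norm (x - q) \<le> norm (x - p) + norm (q - p)"
      using dist_triangle[of x q p] by (simp add: dist_norm norm_minus_commute)
    moreover have "q \<in> sphere p R" using fr by blast
    ultimately have \<rho>2: "\<rho> \<le> 2 * R" using x(1) by (simp add: \<rho>_def dist_norm norm_minus_commute)
    have "c * \<rho> \<le> 1 / (4 * R) * (2 * R)" using c \<rho> \<rho>2 R by (intro mult_mono) auto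
    then have c\<rho>: "c * \<rho> \<le> 1 / 2" using R by simp
    have d: "0 \<le> d" "d \<le> \<rho> / 2" using c\<rho> c(1) \<rho> mult_right_mono[OF c\<rho>, of \<rho>]
      by (simp_all add: d_def power2_eq_square)
    have "norm (x - q) \<le> norm (x - z) + norm (z - q)"
      using dist_triangle[of x q z] by (simp add: dist_norm)
    then have "\<rho> / 2 \<le> norm (z - q)" using xz d by (simp add: \<rho>_def)
    then have "(\<rho> / 2)\<^sup>2 \<le> (norm (z - q))\<^sup>2" using \<rho> by (intro power_mono) auto
    then have "c0 * (\<rho> / 2)\<^sup>2 \<le> c0 * (norm (z - q))\<^sup>2" using c0 by (intro mult_left_mono) auto
    also have "\<dots> \<le> (norm (z - p))\<^sup>2 - R\<^sup>2" by (rule sep[OF z(2)])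
    also have "\<dots> \<le> (R + d)\<^sup>2 - R\<^sup>2"
    proof -
      have "norm (z - p) \<le> norm (z - x) + norm (x - p)"
        using dist_triangle[of z p x] by (simp add: dist_norm)
      then have "norm (z - p) \<le> R + d" using xz x(1) by (simp add: dist_norm norm_minus_commute)
      then show ?thesis by (simp add: power_mono)
    qed
    also have "\<dots> = 2 * R * d + d * d" by (simp add: power2_eq_square algebra_simps)
    also have "\<dots> \<le> 2 * R * d + R * d" using d \<rho>2 by (intro add_left_mono mult_right_mono) auto
    also have "\<dots> = 3 * (R * c) * \<rho>\<^sup>2" by (simp add: d_def)
    also have "\<dots> \<le> 3 * (c0 / 16) * \<rho>\<^sup>2" using c(3) R by (intro mult_right_mono mult_left_mono) (auto simp: field_simps)
    also have "\<dots> < c0 * (\<rho> / 2)\<^sup>2" using c0 \<rho> by (simp add: power2_eq_square)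
    finally show False by simp
  qed
qed

section \<open>Blow-up at the touching point\<close>

text \<open>In tangential units of \<tau> the ball of radius \<open>K * (\<tau> n)\<^sup>2\<close>
  shrinks to one point, so the Hessian form is nearly constant on it and the graph stays within a
  small multiple of \<open>(\<tau> n)\<^sup>2\<close> of a hyperplane parallel to the tangent plane.
  The point \<open>a n\<close> marks the height of that hyperplane.\<close>

lemma frontier_blowup:
  fixes \<Omega> :: "'a::euclidean_space set" and L :: "'a \<Rightarrow> 'a" and k :: "'a \<Rightarrow> real" and X :: "nat \<Rightarrow> 'a"
  assumes \<Omega>: "open \<Omega>" and ep: "C2_epigraph_near \<Omega> q r \<nu> \<phi>"
    and gr: "\<And>v. v \<bullet> \<nu> = 0 \<Longrightarrow> grad \<phi> 0 \<bullet> v = 0"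
    and q: "q \<in> frontier \<Omega>"
    and L: "orthogonal_transformation L" "b \<in> Basis" "L b = - \<nu>"
    and hess: "\<And>v. v \<bullet> \<nu> = 0 \<Longrightarrow> hess \<phi> 0 v \<bullet> v = (\<Sum>i\<in>Basis - {b}. k i * (v \<bullet> L i)\<^sup>2)"
    and f: "continuous_on (frontier \<Omega>) f"
    and \<tau>: "\<And>n. 0 < \<tau> n" "\<tau> \<longlonglongrightarrow> 0"
    and X: "(\<lambda>n. (X n - q) /\<^sub>R \<tau> n) \<longlonglongrightarrow> L z" and z: "z \<bullet> b = 0"
    and K: "0 < K" and \<eta>: "0 < \<eta>"
  defines "a n \<equiv> q + ((\<tau> n)\<^sup>2 * ((\<Sum>i\<in>Basis - {b}. k i * (z \<bullet> i)\<^sup>2) / 2)) *\<^sub>R \<nu>"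
  shows "\<forall>\<^sub>F n in sequentially. \<forall>y\<in>cball (X n) (K * (\<tau> n)\<^sup>2).
    (y \<in> frontier \<Omega> \<longrightarrow> \<bar>(y - a n) \<bullet> \<nu>\<bar> \<le> \<eta> * (\<tau> n)\<^sup>2 \<and> \<bar>f y - f q\<bar> \<le> \<eta>) \<and>
    (y \<in> closure \<Omega> \<longrightarrow> - \<eta> * (\<tau> n)\<^sup>2 \<le> (y - a n) \<bullet> \<nu>)"
proof -
  have r: "0 < r" and \<nu>: "norm \<nu> = 1" and C2: "C2_on (ball 0 r) \<phi>"
    using ep unfolding C2_epigraph_near_def by auto
  have \<nu>\<nu>: "\<nu> \<bullet> \<nu> = 1" using \<nu> by (simp add: dot_square_norm)
  have \<phi>0: "\<phi> 0 = 0" using epigraph_frontier(1)[OF \<Omega> ep _ q] r by (simp add: tang_def)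
  define Q where "Q w = hess \<phi> 0 w \<bullet> w" for w
  \<comment> \<open>Bounds the rescaled points \<open>(y - q) /\<^sub>R \<tau> n\<close> and their
    tangential parts once they are within 1 of \<open>L z\<close>.\<close>
  define m where "m = norm (L z) + 1"
  have m: "0 < m" by (simp add: m_def add_nonneg_pos)
  have LL: "L v \<bullet> L w = v \<bullet> w" for v w using L(1) by (simp add: orthogonal_transformation_def)
  have Lz\<nu>: "L z \<bullet> \<nu> = 0"
  proof -
    have "L z \<bullet> L b = 0" using LL z by simp
    then show ?thesis by (simp add: L(3))
  qed
  have QLz: "Q (L z) = (\<Sum>i\<in>Basis - {b}. k i * (z \<bullet> i)\<^sup>2)"
    unfolding Q_def hess[OF Lz\<nu>] by (simp add: LL)
  have "grad \<phi> differentiable (at 0)" using C2 r unfolding C2_on_def by auto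
  then have bl: "bounded_linear (hess \<phi> 0)"
    unfolding hess_def using frechet_derivative_works has_derivative_bounded_linear by blast
  have Qcont: "isCont Q w" for w
    unfolding Q_def[abs_def] by (intro continuous_intros bounded_linear.isCont[OF bl])
  have Qscale: "Q (c *\<^sub>R w) = c\<^sup>2 * Q w" for c w
    using linear_scale[OF bounded_linear.linear[OF bl]] by (simp add: Q_def power2_eq_square)
  obtain \<delta>1 where \<delta>1: "0 < \<delta>1" "\<delta>1 \<le> 1" "\<And>w. norm (w - L z) < \<delta>1 \<Longrightarrow> \<bar>Q w - Q (L z)\<bar> < \<eta>"
  proof -
    obtain d where d: "0 < d" "\<And>w. dist w (L z) < d \<Longrightarrow> dist (Q w) (Q (L z)) < \<eta>"
      using Qcont[of "L z"] \<eta> unfolding continuous_at_eps_delta by blast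
    show ?thesis by (rule that[of "min d 1"]) (use d in \<open>auto simp: dist_norm\<close>)
  qed
  \<comment> \<open>Half of \<eta> is spent on the Taylor remainder at distance at most
    \<open>m\<close>, the other half on the variation of \<open>Q / 2\<close>.\<close>
  define \<eta>1 where "\<eta>1 = \<eta> / (2 * m\<^sup>2)"
  have \<eta>1: "0 < \<eta>1" "\<eta>1 * m\<^sup>2 = \<eta> / 2" using \<eta> m by (simp_all add: \<eta>1_def)
  obtain \<delta> where \<delta>: "\<delta> > 0" "\<delta> \<le> r" and T:
    "\<And>v. norm v < \<delta> \<Longrightarrow> \<bar>\<phi> v - \<phi> 0 - grad \<phi> 0 \<bullet> v - (hess \<phi> 0 v \<bullet> v) / 2\<bar> \<le> \<eta>1 * (norm v)\<^sup>2"
    using C2_on_taylor2[OF C2 r \<eta>1(1)] by auto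
  obtain \<delta>2 where \<delta>2: "0 < \<delta>2" "\<And>y. y \<in> frontier \<Omega> \<Longrightarrow> dist y q < \<delta>2 \<Longrightarrow> dist (f y) (f q) < \<eta>"
    using f q \<eta> unfolding continuous_on_iff by metis
  define \<rho> where "\<rho> = min \<delta> \<delta>2"
  have \<rho>: "0 < \<rho>" using \<delta> \<delta>2 by (simp add: \<rho>_def)
  have ev1: "\<forall>\<^sub>F n in sequentially. norm ((X n - q) /\<^sub>R \<tau> n - L z) < \<delta>1 / 2"
    using tendstoD[OF X, of "\<delta>1 / 2"] \<delta>1(1) by (simp add: dist_norm)
  have "(\<lambda>n. K * \<tau> n) \<longlonglongrightarrow> K * 0" by (intro tendsto_intros \<tau>(2))
  then have ev2: "\<forall>\<^sub>F n in sequentially. K * \<tau> n < \<delta>1 / 2"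
    using \<delta>1(1) by (intro order_tendstoD(2)) auto
  have "(\<lambda>n. \<tau> n * m) \<longlonglongrightarrow> 0 * m" by (intro tendsto_intros \<tau>(2))
  then have ev3: "\<forall>\<^sub>F n in sequentially. \<tau> n * m < \<rho>"
    using \<rho> by (intro order_tendstoD(2)) auto
  show ?thesis
    using ev1 ev2 ev3
  proof eventually_elim
    case (elim n)
    define t where "t = \<tau> n"
    have t: "0 < t" by (simp add: t_def \<tau>)
    show ?case
    proof
      fix y assume y: "y \<in> cball (X n) (K * (\<tau> n)\<^sup>2)"
      define w where "w = tang \<nu> (y - q)"
      define w' where "w' = w /\<^sub>R t"
      have near: "norm ((y - q) /\<^sub>R t - L z) < \<delta>1"
      proof -
        have eq: "(y - q) /\<^sub>R t - L z = (y - X n) /\<^sub>R t + ((X n - q) /\<^sub>R t - L z)"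
          by (simp add: algebra_simps)
        have "norm ((y - X n) /\<^sub>R t) \<le> K * t"
        proof -
          have "norm (y - X n) \<le> (K * t) * t"
            using y by (simp add: dist_norm norm_minus_commute t_def power2_eq_square mult.assoc)
          then have "norm (y - X n) / t \<le> K * t" using t by (simp only: pos_divide_le_eq)
          then show ?thesis using t by (simp add: divide_inverse mult.commute)
        qed
        moreover have "norm ((y - X n) /\<^sub>R t + ((X n - q) /\<^sub>R t - L z)) \<le> norm ((y - X n) /\<^sub>R t) + norm ((X n - q) /\<^sub>R t - L z)"
          by (rule norm_triangle_ineq)
        ultimately show ?thesis unfolding eq using elim(1,2)[folded t_def] by linarith
      qed
      have "norm ((y - q) /\<^sub>R t) \<le> norm ((y - q) /\<^sub>R t - L z) + norm (L z)"
        by (metis diff_add_cancel norm_triangle_ineq)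
      also have "\<dots> \<le> m" using near \<delta>1(2) by (simp add: m_def)
      finally have "norm (y - q) / t \<le> m" using t by (simp add: divide_inverse mult.commute)
      then have "norm (y - q) \<le> t * m" using t by (simp only: pos_divide_le_eq mult.commute[of t])
      then have yq: "norm (y - q) < \<delta>" "norm (y - q) < \<delta>2" "norm (y - q) < r"
        using elim(3) \<delta>(2) by (auto simp: \<rho>_def t_def)
      have w\<nu>: "w \<bullet> \<nu> = 0" unfolding w_def by (rule tang_inner[OF \<nu>])
      have "norm w < \<delta>" using norm_tang_le[OF \<nu>, of "y - q"] yq(1) by (simp add: w_def)
      from T[OF this] have Tw: "\<bar>\<phi> w - Q w / 2\<bar> \<le> \<eta>1 * (norm w)\<^sup>2"
        using gr[OF w\<nu>] by (simp add: \<phi>0 Q_def)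
      have "w' - L z = tang \<nu> ((y - q) /\<^sub>R t - L z)"
        by (simp add: w'_def w_def tang_diff tang_scale tang_id[OF Lz\<nu>])
      then have w'near: "norm (w' - L z) < \<delta>1"
        using norm_tang_le[OF \<nu>, of "(y - q) /\<^sub>R t - L z"] near by simp
      have "norm w' \<le> norm (w' - L z) + norm (L z)"
        by (metis diff_add_cancel norm_triangle_ineq)
      then have "norm w' \<le> m" using w'near \<delta>1(2) by (simp add: m_def)
      then have "(norm w')\<^sup>2 \<le> m\<^sup>2" by (intro power_mono) auto
      then have "\<eta>1 * (norm w')\<^sup>2 \<le> \<eta> / 2" 
        using mult_left_mono[of "(norm w')\<^sup>2" "m\<^sup>2" \<eta>1] \<eta>1 by linarith
      then have "t\<^sup>2 * (\<eta>1 * (norm w')\<^sup>2) \<le> t\<^sup>2 * (\<eta> / 2)" by (intro mult_left_mono) auto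
      moreover have w: "w = t *\<^sub>R w'" using t by (simp add: w'_def)
      ultimately have 1: "\<bar>\<phi> w - t\<^sup>2 * Q w' / 2\<bar> \<le> t\<^sup>2 * (\<eta> / 2)"
        using Tw by (simp add: w Qscale power_mult_distrib mult_ac)
      have "t\<^sup>2 * \<bar>Q w' - Q (L z)\<bar> \<le> t\<^sup>2 * \<eta>" using \<delta>1(3)[OF w'near] by (intro mult_left_mono) auto
      then have 2: "\<bar>t\<^sup>2 * Q w' - t\<^sup>2 * Q (L z)\<bar> \<le> t\<^sup>2 * \<eta>"
        by (simp add: abs_mult flip: right_diff_distrib)
      have "\<bar>\<phi> w - t\<^sup>2 * (Q (L z) / 2)\<bar> \<le> t\<^sup>2 * \<eta>" using 1 2 by linarith
      then have \<phi>w: "\<bar>\<phi> w - (\<tau> n)\<^sup>2 * (Q (L z) / 2)\<bar> \<le> \<eta> * (\<tau> n)\<^sup>2" by (simp add: t_def mult.commute)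
      have ya: "(y - a n) \<bullet> \<nu> = (y - q) \<bullet> \<nu> - (\<tau> n)\<^sup>2 * (Q (L z) / 2)"
        by (simp add: a_def QLz inner_diff_left inner_add_left \<nu>\<nu>)
      have yb: "y \<in> ball q r" using yq(3) by (simp add: dist_norm norm_minus_commute)
      show "(y \<in> frontier \<Omega> \<longrightarrow> \<bar>(y - a n) \<bullet> \<nu>\<bar> \<le> \<eta> * (\<tau> n)\<^sup>2 \<and> \<bar>f y - f q\<bar> \<le> \<eta>) \<and>
        (y \<in> closure \<Omega> \<longrightarrow> - \<eta> * (\<tau> n)\<^sup>2 \<le> (y - a n) \<bullet> \<nu>)"
      proof (intro conjI impI)
        assume fr: "y \<in> frontier \<Omega>"
        show "\<bar>(y - a n) \<bullet> \<nu>\<bar> \<le> \<eta> * (\<tau> n)\<^sup>2"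
          using epigraph_frontier(1)[OF \<Omega> ep yb fr] \<phi>w by (simp add: ya w_def)
        show "\<bar>f y - f q\<bar> \<le> \<eta>"
          using \<delta>2(2)[OF fr] yq(2) by (simp add: dist_norm)
      next
        assume "y \<in> closure \<Omega>"
        then have "\<phi> w \<le> (y - q) \<bullet> \<nu>" unfolding w_def by (rule epigraph_frontier(2)[OF \<Omega> ep yb])
        then show "- \<eta> * (\<tau> n)\<^sup>2 \<le> (y - a n) \<bullet> \<nu>" using \<phi>w by (simp add: ya)
      qed
    qed
  qed
qed

text \<open>On a sphere the height above the tangent plane at \<open>q\<close> is exactly
  \<open>(norm (x - q))\<^sup>2 / (2 * R)\<close>. Subtracting the height of the limiting boundary
  hyperplane leaves the form with the curvature gaps as coefficients.\<close>

lemma blowup_height: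
  fixes L :: "'a::euclidean_space \<Rightarrow> 'a" and k :: "'a \<Rightarrow> real" and X :: "nat \<Rightarrow> 'a"
  assumes R: "0 < R" and \<nu>: "norm \<nu> = 1" and p: "p = q + R *\<^sub>R \<nu>"
    and L: "orthogonal_transformation L" "b \<in> Basis" and \<tau>: "\<And>n. 0 < \<tau> n"
    and X: "\<And>n. X n \<in> sphere p R" "(\<lambda>n. (X n - q) /\<^sub>R \<tau> n) \<longlonglongrightarrow> L z" and z: "z \<bullet> b = 0"
  defines "a n \<equiv> q + ((\<tau> n)\<^sup>2 * ((\<Sum>i\<in>Basis - {b}. k i * (z \<bullet> i)\<^sup>2) / 2)) *\<^sub>R \<nu>"
  shows "(\<lambda>n. ((X n - a n) \<bullet> \<nu>) / (\<tau> n)\<^sup>2) \<longlonglongrightarrow> tangential_form b (\<lambda>i. 1 / R - k i) z"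
proof -
  let ?Q = "\<Sum>i\<in>Basis - {b}. k i * (z \<bullet> i)\<^sup>2"
  have \<nu>\<nu>: "\<nu> \<bullet> \<nu> = 1" using \<nu> by (simp add: dot_square_norm)
  have eq: "((X n - a n) \<bullet> \<nu>) / (\<tau> n)\<^sup>2 = (norm ((X n - q) /\<^sub>R \<tau> n))\<^sup>2 / (2 * R) - ?Q / 2" for n
  proof -
    have "norm ((X n - q) - R *\<^sub>R \<nu>) = R" using X(1)[of n] by (simp add: p dist_norm norm_minus_commute algebra_simps)
    then have "R\<^sup>2 = (norm (X n - q))\<^sup>2 - 2 * R * ((X n - q) \<bullet> \<nu>) + R\<^sup>2"
      using norm_diff_unit[OF \<nu>, of "X n - q" R] by simp
    then have h: "(X n - q) \<bullet> \<nu> = (norm (X n - q))\<^sup>2 / (2 * R)" using R by (simp add: field_simps)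
    have "(X n - a n) \<bullet> \<nu> = (X n - q) \<bullet> \<nu> - (\<tau> n)\<^sup>2 * (?Q / 2)"
      by (simp add: a_def inner_diff_left inner_add_left \<nu>\<nu>)
    moreover have "norm ((X n - q) /\<^sub>R \<tau> n) = norm (X n - q) / \<tau> n"
      using \<tau>[of n] by (simp add: divide_inverse mult.commute)
    ultimately show ?thesis using \<tau>[of n] R by (simp only: h) (simp add: power_divide field_simps)
  qed
  have "(\<lambda>n. (norm ((X n - q) /\<^sub>R \<tau> n))\<^sup>2 / (2 * R) - ?Q / 2) \<longlonglongrightarrow> (norm (L z))\<^sup>2 / (2 * R) - ?Q / 2"
    by (intro tendsto_intros X(2)) (use R in auto)
  moreover have "(norm (L z))\<^sup>2 = (\<Sum>i\<in>Basis - {b}. (z \<bullet> i)\<^sup>2)"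
    using norm_sum_orthogonal_frame[of "\<lambda>x. x" b z] L(2) z orthogonal_transformation_norm[OF L(1)]
    by (simp add: orthogonal_transformation_def linear_id[unfolded id_def])
  moreover have "(\<Sum>i\<in>Basis - {b}. (z \<bullet> i)\<^sup>2) / (2 * R) - ?Q / 2 = tangential_form b (\<lambda>i. 1 / R - k i) z"
    by (simp add: tangential_form_def sum_divide_distrib sum_subtractf diff_divide_distrib algebra_simps)
  ultimately show ?thesis unfolding eq by simp
qed

text \<open>Common to both problems: the equation enters only through the assumptions on
  \<open>V\<close>, with \<open>(\<tau> n)\<^sup>2\<close> as length scale and \<open>F\<close> as
  half-space profile. Interior balls of radius proportional to \<open>(norm (x - q))\<^sup>2\<close>
  turn \<open>V_decay\<close> into a Gaussian majorant; blow-up and \<open>V_approx\<close> give the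
  pointwise limit.\<close>

lemma sphere_integral_limit:
  fixes \<Omega> :: "'a::euclidean_space set" and L :: "'a \<Rightarrow> 'a" and k :: "'a \<Rightarrow> real" and V :: "nat \<Rightarrow> 'a \<Rightarrow> real"
    and F :: "real \<Rightarrow> real"
  assumes \<Omega>: "open \<Omega>" "bounded \<Omega>" and ep: "C2_epigraph_near \<Omega> q r \<nu> \<phi>"
    and gr: "\<And>v. v \<bullet> \<nu> = 0 \<Longrightarrow> grad \<phi> 0 \<bullet> v = 0"
    and q: "q \<in> frontier \<Omega>" and R: "0 < R" and ball: "ball p R \<subseteq> \<Omega>" and fr: "sphere p R \<inter> frontier \<Omega> = {q}"
    and L: "orthogonal_transformation L" "b \<in> Basis" "L b = - \<nu>"
    and hess: "\<And>v. v \<bullet> \<nu> = 0 \<Longrightarrow> hess \<phi> 0 v \<bullet> v = (\<Sum>i\<in>Basis - {b}. k i * (v \<bullet> L i)\<^sup>2)"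
    and k: "\<And>i. i \<in> Basis - {b} \<Longrightarrow> k i < 1 / R"
    and f: "continuous_on (frontier \<Omega>) f"
    and \<tau>: "\<And>n. 0 < \<tau> n" "\<tau> \<longlonglongrightarrow> 0"
    and F: "continuous_on UNIV F" "\<And>s. 0 \<le> F s"
    and V_cont: "\<And>n. continuous_on (closure \<Omega>) (V n)"
    and V_bound: "\<And>n x. x \<in> closure \<Omega> \<Longrightarrow> \<bar>V n x\<bar> \<le> M"
    and V_decay: "\<And>n x d. 0 < d \<Longrightarrow> cball x d \<subseteq> \<Omega> \<Longrightarrow> \<bar>V n x\<bar> \<le> A * exp (- d / (sqrt (real DIM('a)) * (\<tau> n)\<^sup>2))"
    and V_approx: "\<And>n x a K \<eta>. x \<in> closure \<Omega> \<Longrightarrow> 0 < K \<Longrightarrow> 0 < \<eta> \<Longrightarrow> \<eta> \<le> 1 \<Longrightarrow>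
      (\<And>y. y \<in> frontier \<Omega> \<Longrightarrow> y \<in> cball x (K * (\<tau> n)\<^sup>2) \<Longrightarrow> \<bar>(y - a) \<bullet> \<nu>\<bar> \<le> \<eta> * (\<tau> n)\<^sup>2 \<and> \<bar>f y - f q\<bar> \<le> \<eta>) \<Longrightarrow>
      (\<And>y. y \<in> closure \<Omega> \<Longrightarrow> y \<in> cball x (K * (\<tau> n)\<^sup>2) \<Longrightarrow> - \<eta> * (\<tau> n)\<^sup>2 \<le> (y - a) \<bullet> \<nu>) \<Longrightarrow>
      \<bar>V n x - f q * F ((x - a) \<bullet> \<nu> / (\<tau> n)\<^sup>2)\<bar> \<le> B * (\<eta> + 1 / K\<^sup>2)"
    and sec: "sector_integral b (\<lambda>i. 1 / R - k i) R (\<lambda>s. ennreal (F s)) = ennreal J" "0 \<le> J"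
  shows "(\<lambda>n. (LINT x|sphere_measure p R. V n x) / \<tau> n ^ (DIM('a) - 1)) \<longlonglongrightarrow> real DIM('a) / R * (f q * J)"
proof -
  have \<nu>: "norm \<nu> = 1" using ep unfolding C2_epigraph_near_def by auto
  have qs: "q \<in> sphere p R" using fr by blast
  have p: "p = q + R *\<^sub>R \<nu>"
    by (rule touching_ball_center[OF \<Omega>(1) ep _ q R ball qs]) (rule gr)
  have q_eq: "p + R *\<^sub>R L b = q" by (simp add: p L(3))
  have sub: "sphere p R \<subseteq> closure \<Omega>" using sphere_subset_closure(1)[OF \<Omega>(1) R ball fr] by blast
  have "\<exists>c>0. \<forall>z\<in>frontier \<Omega>. c * (norm (z - q))\<^sup>2 \<le> (norm (z - p))\<^sup>2 - R\<^sup>2"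
    by (rule frontier_quadratic_separation[OF \<Omega> ep _ q R ball fr L]) (fact gr hess k)+
  then obtain c0 where "0 < c0" "\<And>z. z \<in> frontier \<Omega> \<Longrightarrow> c0 * (norm (z - q))\<^sup>2 \<le> (norm (z - p))\<^sup>2 - R\<^sup>2" by blast
  from cball_in_domain[OF \<Omega>(1) R ball fr this]
  obtain c1 where c1: "0 < c1" "\<And>x. x \<in> sphere p R \<Longrightarrow> x \<noteq> q \<Longrightarrow> cball x (c1 * (norm (x - q))\<^sup>2) \<subseteq> \<Omega>" by blast
  define c where "c = c1 / sqrt (real DIM('a))"
  have c: "0 < c" using c1 by (simp add: c_def)
  \<comment> \<open>At \<open>x = q\<close> there is no interior ball and the bound \<open>M\<close>
    is used; elsewhere the decay constant \<open>A\<close> applies.\<close>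
  define C where "C = \<bar>A\<bar> + \<bar>M\<bar>"
  have bound: "\<bar>V n x\<bar> \<le> C * exp (- c * (norm (x - (p + R *\<^sub>R L b)) / \<tau> n)\<^sup>2)" if x: "x \<in> sphere p R" for n x
  proof (cases "x = q")
    case True
    then show ?thesis using V_bound[of x n] x sub by (force simp: q_eq C_def)
  next
    case False
    have "\<bar>V n x\<bar> \<le> A * exp (- (c1 * (norm (x - q))\<^sup>2) / (sqrt (real DIM('a)) * (\<tau> n)\<^sup>2))"
      by (rule V_decay[OF _ c1(2)[OF x False]]) (use c1 False in simp)
    also have "- (c1 * (norm (x - q))\<^sup>2) / (sqrt (real DIM('a)) * (\<tau> n)\<^sup>2) = - c * (norm (x - q) / \<tau> n)\<^sup>2"
      by (simp add: c_def power_divide)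
    also have "A * exp (- c * (norm (x - q) / \<tau> n)\<^sup>2) \<le> C * exp (- c * (norm (x - q) / \<tau> n)\<^sup>2)"
      by (intro mult_right_mono) (auto simp: C_def)
    finally show ?thesis by (simp add: q_eq)
  qed
  define H where "H z = f q * F (tangential_form b (\<lambda>i. 1 / R - k i) z)" for z
  have [measurable]: "F \<in> borel_measurable borel" using F(1) by (rule borel_measurable_continuous_onI)
  have H_meas: "H \<in> borel_measurable borel" unfolding H_def[abs_def] by measurable
  have lim: "(\<lambda>n. V n (X n)) \<longlonglongrightarrow> H z" if X: "\<And>n. X n \<in> sphere p R" and z: "z \<bullet> b = 0"
    and Xlim: "(\<lambda>n. (X n - (p + R *\<^sub>R L b)) /\<^sub>R \<tau> n) \<longlonglongrightarrow> L z" for X z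
  proof -
    have Xlim': "(\<lambda>n. (X n - q) /\<^sub>R \<tau> n) \<longlonglongrightarrow> L z" using Xlim by (simp only: q_eq)
    define a where "a n = q + ((\<tau> n)\<^sup>2 * ((\<Sum>i\<in>Basis - {b}. k i * (z \<bullet> i)\<^sup>2) / 2)) *\<^sub>R \<nu>" for n
    have "(\<lambda>n. ((X n - a n) \<bullet> \<nu>) / (\<tau> n)\<^sup>2) \<longlonglongrightarrow> tangential_form b (\<lambda>i. 1 / R - k i) z"
      unfolding a_def by (rule blowup_height[OF R \<nu> p L(1,2) \<tau>(1) X Xlim' z])
    moreover have "isCont F s" for s using F(1) by (simp add: continuous_on_eq_continuous_at)
    ultimately have lim1: "(\<lambda>n. f q * F (((X n - a n) \<bullet> \<nu>) / (\<tau> n)\<^sup>2)) \<longlonglongrightarrow> H z"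
      unfolding H_def by (intro tendsto_intros isCont_tendsto_compose[of _ F])
    have "(\<lambda>n. V n (X n) - f q * F (((X n - a n) \<bullet> \<nu>) / (\<tau> n)\<^sup>2)) \<longlonglongrightarrow> 0"
      unfolding tendsto_iff
    proof (intro allI impI)
      fix e :: real assume e: "0 < e"
      \<comment> \<open>\<open>K\<close> is chosen to make the two error terms equal; the
        denominator then keeps their sum \<open>2 * (B * \<eta>)\<close> below \<open>e\<close>,
        whatever the sign of \<open>B\<close>.\<close>
      define \<eta> where "\<eta> = min 1 (e / (3 * (\<bar>B\<bar> + 1)))"
      define K where "K = sqrt (1 / \<eta>)"
      have \<eta>: "0 < \<eta>" "\<eta> \<le> 1" "\<eta> \<le> e / (3 * (\<bar>B\<bar> + 1))"
        using e unfolding \<eta>_def by (simp_all add: add_nonneg_pos)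
      have K: "0 < K" "1 / K\<^sup>2 = \<eta>" using \<eta> by (simp_all add: K_def)
      have small: "B * (\<eta> + 1 / K\<^sup>2) < e"
      proof -
        have "\<eta> * (3 * (\<bar>B\<bar> + 1)) \<le> e"
          using \<eta>(3) by (subst (asm) pos_le_divide_eq) (auto simp: add_nonneg_pos)
        then have "3 * (\<bar>B\<bar> * \<eta>) + 3 * \<eta> \<le> e" by (simp add: algebra_simps)
        moreover have "B * \<eta> \<le> \<bar>B\<bar> * \<eta>" using \<eta> by (intro mult_right_mono) auto
        moreover have "0 \<le> \<bar>B\<bar> * \<eta>" using \<eta> by simp
        moreover have "B * (\<eta> + 1 / K\<^sup>2) = 2 * (B * \<eta>)" unfolding K(2) by simp
        ultimately show ?thesis using \<eta>(1) by linarith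
      qed
      have "\<forall>\<^sub>F n in sequentially. \<forall>y\<in>cball (X n) (K * (\<tau> n)\<^sup>2).
        (y \<in> frontier \<Omega> \<longrightarrow> \<bar>(y - a n) \<bullet> \<nu>\<bar> \<le> \<eta> * (\<tau> n)\<^sup>2 \<and> \<bar>f y - f q\<bar> \<le> \<eta>) \<and>
        (y \<in> closure \<Omega> \<longrightarrow> - \<eta> * (\<tau> n)\<^sup>2 \<le> (y - a n) \<bullet> \<nu>)"
        unfolding a_def
        by (rule frontier_blowup[OF \<Omega>(1) ep _ q L _ f \<tau> Xlim' z K(1) \<eta>(1)]) (fact gr hess)+
      then show "\<forall>\<^sub>F n in sequentially. dist (V n (X n) - f q * F (((X n - a n) \<bullet> \<nu>) / (\<tau> n)\<^sup>2)) 0 < e"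
      proof eventually_elim
        case (elim n)
        have "\<bar>V n (X n) - f q * F ((X n - a n) \<bullet> \<nu> / (\<tau> n)\<^sup>2)\<bar> \<le> B * (\<eta> + 1 / K\<^sup>2)"
          by (rule V_approx) (use X sub K \<eta> elim in auto)
        then show ?case using small by (simp add: dist_real_def)
      qed
    qed
    from tendsto_add[OF this lim1] show ?thesis by simp
  qed
  have "(\<lambda>n. (LINT x|sphere_measure p R. V n x) / \<tau> n ^ (DIM('a) - 1)) \<longlonglongrightarrow>
     real DIM('a) / R * (LINT v|lborel. indicator {0<..<R} (v \<bullet> b) * H ((R / (v \<bullet> b)) *\<^sub>R (v - (v \<bullet> b) *\<^sub>R b)))"
    by (rule sphere_integral_concentration[OF R L(1,2) \<tau> continuous_on_subset[OF V_cont sub] bound c H_meas lim])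
  also have "(LINT v|lborel. indicator {0<..<R} (v \<bullet> b) * H ((R / (v \<bullet> b)) *\<^sub>R (v - (v \<bullet> b) *\<^sub>R b))) = f q * J"
  proof -
    let ?g = "\<lambda>v. indicator {0<..<R} (v \<bullet> b) * F ((R / (v \<bullet> b))\<^sup>2 * tangential_form b (\<lambda>i. 1 / R - k i) v)"
    have tf: "tangential_form b a' (s *\<^sub>R (v - (v \<bullet> b) *\<^sub>R b)) = s\<^sup>2 * tangential_form b a' v" for s v a'
    proof -
      have "s *\<^sub>R (v - (v \<bullet> b) *\<^sub>R b) \<bullet> i = s * (v \<bullet> i)" if "i \<in> Basis - {b}" for i
        using that L(2) by (auto simp: inner_diff_left inner_Basis)
      then have "(\<Sum>i\<in>Basis - {b}. a' i * (s *\<^sub>R (v - (v \<bullet> b) *\<^sub>R b) \<bullet> i)\<^sup>2) = (\<Sum>i\<in>Basis - {b}. s\<^sup>2 * (a' i * (v \<bullet> i)\<^sup>2))"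
        by (intro sum.cong refl) (simp only: power_mult_distrib mult.left_commute)
      then show ?thesis by (simp only: tangential_form_def sum_distrib_left times_divide_eq_right)
    qed
    have "(\<integral>\<^sup>+v. ennreal (?g v) \<partial>lborel) = ennreal J"
      unfolding sec(1)[symmetric] sector_integral_def
      by (intro nn_integral_cong) (auto simp: indicator_def)
    then have "(LINT v|lborel. ?g v) = J"
      by (intro integral_eq_nn_integral[THEN trans]) (use F(2) sec(2) in auto)
    then show ?thesis by (simp add: H_def tf mult.left_commute[of _ "f q"])
  qed
  finally show ?thesis .
qed

section \<open>Bounds on the solutions and the conclusion\<close>

lemma exp_le_1_plus_2:
  fixes x :: real
  assumes "0 \<le> x" "x \<le> 1"
  shows "exp x - 1 \<le> 2 * x"
proof -
  have "exp x \<le> 1 + x + x\<^sup>2" using assms by (rule exp_bound)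
  moreover have "x\<^sup>2 \<le> x" using assms by (simp add: power2_eq_square mult_left_le)
  ultimately show ?thesis by simp
qed

text \<open>Each \<epsilon> has its own solution, and boundedness of each would not give a common
  bound. The maximum principle provides one that depends on the data alone.\<close>

lemma resolvent_solution_bounded_by_data:
  fixes \<Omega> :: "'a::euclidean_space set"
  assumes \<Omega>: "open \<Omega>" "bounded \<Omega>" and sol: "resolvent_solution \<Omega> f \<epsilon> U" and \<epsilon>: "0 < \<epsilon>"
    and M: "\<And>y. y \<in> frontier \<Omega> \<Longrightarrow> \<bar>f y\<bar> \<le> M" "0 \<le> M" and x: "x \<in> closure \<Omega>"
  shows "\<bar>U x\<bar> \<le> M"
proof -
  have U: "C2_on \<Omega> U" "continuous_on (closure \<Omega>) U" "\<And>y. y \<in> \<Omega> \<Longrightarrow> \<epsilon>\<^sup>2 * laplacian U y = U y"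
      "\<And>y. y \<in> frontier \<Omega> \<Longrightarrow> U y = f y"
    using sol unfolding resolvent_solution_def by auto
  have main: "\<sigma> * U x - M \<le> 0" if \<sigma>: "\<bar>\<sigma>\<bar> = 1" for \<sigma>
  proof (rule elliptic_max_principle[OF \<Omega> _ _ _ x, of "\<lambda>y. \<sigma> * U y - M"])
    show "continuous_on (closure \<Omega>) (\<lambda>y. \<sigma> * U y - M)" by (intro continuous_intros U(2))
    show "\<sigma> * U y - M \<le> 0" if "y \<in> frontier \<Omega>" for y
      using M(1)[OF that] U(4)[OF that] \<sigma> by (auto simp: abs_if split: if_splits)
    fix y assume y: "y \<in> \<Omega>" and pos: "\<sigma> * U y - M > 0"
    have "has_laplacian (\<lambda>y. \<sigma> * U y - M) y (\<sigma> * laplacian U y - 0)"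
      by (intro has_laplacian_diff has_laplacian_cmult has_laplacian_const C2_on_has_laplacian[OF \<Omega>(1) U(1) y])
    moreover have "\<epsilon>\<^sup>2 * (\<sigma> * laplacian U y) > 0" using pos M(2) U(3)[OF y] by (simp add: mult.left_commute)
    then have "\<sigma> * laplacian U y > 0" using \<epsilon> by (simp add: zero_less_mult_iff)
    ultimately show "\<exists>l>0. has_laplacian (\<lambda>y. \<sigma> * U y - M) y l" by auto
  qed
  show ?thesis using main[of 1] main[of "-1"] by (simp add: abs_le_iff)
qed

lemma continuous_on_heat_solution_slice:
  assumes "heat_solution \<Omega> f u" "0 < t"
  shows "continuous_on (closure \<Omega>) (\<lambda>x. u x t)"
proof -
  have "continuous_on (closure \<Omega>) (\<lambda>x. (x, t))" by (intro continuous_intros)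
  moreover have "(\<lambda>x. (x, t)) ` closure \<Omega> \<subseteq> closure \<Omega> \<times> {0<..}" using assms(2) by auto
  ultimately show ?thesis
    using continuous_on_compose2[OF continuous_on_heat_solution[OF assms(1) order.refl]] by fastforce
qed

text \<open>A single solution covers all times, so the bound in its definition is already uniform;
  continuity in space at fixed time carries it to the closure.\<close>

lemma heat_solution_bounded:
  assumes sol: "heat_solution \<Omega> f u"
  obtains M where "\<And>x t. x \<in> closure \<Omega> \<Longrightarrow> 0 < t \<Longrightarrow> \<bar>u x t\<bar> \<le> M"
proof -
  obtain M where M: "\<And>x t. x \<in> \<Omega> \<Longrightarrow> 0 < t \<Longrightarrow> \<bar>u x t\<bar> \<le> M"
    using sol unfolding heat_solution_def bounded_iff by fastforce
  have "\<bar>u x t\<bar> \<le> M" if "x \<in> closure \<Omega>" "0 < t" for x t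
  proof -
    have "continuous_on (closure \<Omega>) (\<lambda>x. u x t)"
      by (rule continuous_on_heat_solution_slice[OF sol that(2)])
    moreover have "(\<lambda>x. u x t) ` \<Omega> \<subseteq> {-M..M}"
      using M[OF _ that(2)] by (force simp: abs_le_iff)
    ultimately have "(\<lambda>x. u x t) ` closure \<Omega> \<subseteq> {-M..M}"
      by (intro image_closure_subset) auto
    then have "u x t \<in> {-M..M}" using that(1) by blast
    then show ?thesis by (simp add: abs_le_iff)
  qed
  then show ?thesis using that by blast
qed

theorem theorem1p3:
  fixes \<Omega> :: "'a::euclidean_space set"
    and q p :: 'a
    and R :: real
    and \<kappa> :: "nat \<Rightarrow> real"
    and f :: "'a \<Rightarrow> real"
    and u :: "'a \<Rightarrow> real \<Rightarrow> real"
    and U :: "real \<Rightarrow> 'a \<Rightarrow> real"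
  assumes "DIM('a) \<ge> 2"
    and "open \<Omega>" and "connected \<Omega>" and "bounded \<Omega>"
    and "q \<in> frontier \<Omega>"
    and "C2_boundary_near \<Omega> q"
    and "R > 0" and "ball p R \<subseteq> \<Omega>"
    and "sphere p R \<inter> frontier \<Omega> = {q}"
    and "principal_curvatures \<Omega> q \<kappa>"
    and "\<And>j. j \<in> {1..DIM('a) - 1} \<Longrightarrow> \<kappa> j < 1 / R"
    and "continuous_on (frontier \<Omega>) f"
    and "\<And>x. x \<in> frontier \<Omega> \<Longrightarrow> f x \<ge> 0"
    and "heat_solution \<Omega> f u"
    and "\<And>\<epsilon>. \<epsilon> > 0 \<Longrightarrow> resolvent_solution \<Omega> f \<epsilon> (U \<epsilon>)"
  shows "((\<lambda>t. (4 * pi\<^sup>2 * t) powr (- (real DIM('a) - 1) / 4)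
              * (LINT x|sphere_measure p R. u x t))
           \<longlongrightarrow> (f q / Gamma ((real DIM('a) + 3) / 4))
                 / sqrt (\<Prod>i\<in>{1..DIM('a) - 1}. (1 / R - \<kappa> i))) (at_right 0)
       \<and> ((\<lambda>\<epsilon>. (2 * pi * \<epsilon>) powr (- (real DIM('a) - 1) / 2)
              * (LINT x|sphere_measure p R. U \<epsilon> x))
           \<longlongrightarrow> f q / sqrt (\<Prod>i\<in>{1..DIM('a) - 1}. (1 / R - \<kappa> i))) (at_right 0)"
proof
  note \<Omega> = \<open>open \<Omega>\<close> \<open>bounded \<Omega>\<close> and q = \<open>q \<in> frontier \<Omega>\<close> and R = \<open>R > 0\<close> and ball = \<open>ball p R \<subseteq> \<Omega>\<close>
    and fr = \<open>sphere p R \<inter> frontier \<Omega> = {q}\<close> and f = \<open>continuous_on (frontier \<Omega>) f\<close>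
    and heat = \<open>heat_solution \<Omega> f u\<close> and res = \<open>\<And>\<epsilon>. \<epsilon> > 0 \<Longrightarrow> resolvent_solution \<Omega> f \<epsilon> (U \<epsilon>)\<close>
    and \<kappa> = \<open>\<And>j. j \<in> {1..DIM('a) - 1} \<Longrightarrow> \<kappa> j < 1 / R\<close>
  define N where "N = DIM('a)"
  define n where "n = N - 1"
  have N: "0 < N" "real N - 1 = real n" by (simp_all add: N_def n_def of_nat_diff)
  obtain r \<nu> \<phi> b and L :: "'a \<Rightarrow> 'a" and k :: "'a \<Rightarrow> real"
    where ep: "C2_epigraph_near \<Omega> q r \<nu> \<phi>" and gr: "\<And>v. v \<bullet> \<nu> = 0 \<Longrightarrow> grad \<phi> 0 \<bullet> v = 0"
      and L: "orthogonal_transformation L" "b \<in> Basis" "L b = - \<nu>"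
      and hess: "\<And>v. v \<bullet> \<nu> = 0 \<Longrightarrow> hess \<phi> 0 v \<bullet> v = (\<Sum>i\<in>Basis - {b}. k i * (v \<bullet> L i)\<^sup>2)"
      and k\<kappa>: "\<And>i. i \<in> Basis - {b} \<Longrightarrow> \<exists>j\<in>{1..DIM('a) - 1}. k i = \<kappa> j"
      and prod: "\<And>g. (\<Prod>i\<in>Basis - {b}. g (k i)) = (\<Prod>j\<in>{1..DIM('a) - 1}. (g (\<kappa> j) :: real))"
  proof (rule principal_frame[OF \<open>principal_curvatures \<Omega> q \<kappa>\<close>], goal_cases)
    case 1
    show ?case by (rule that[OF 1(2-)])
  qed
  have \<nu>: "norm \<nu> = 1" using ep unfolding C2_epigraph_near_def by auto
  have k: "k i < 1 / R" if "i \<in> Basis - {b}" for i using k\<kappa>[OF that] \<kappa> by auto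
  then have a: "0 < 1 / R - k i" if "i \<in> Basis - {b}" for i using that by simp
  define P where "P = sqrt (\<Prod>i\<in>{1..DIM('a) - 1}. (1 / R - \<kappa> i))"
  have P: "0 < P" unfolding P_def using \<kappa> by (auto intro!: prod_pos)
  have P': "sqrt (\<Prod>i\<in>Basis - {b}. 1 / R - k i) = P" unfolding P_def using prod[of "\<lambda>s. 1 / R - s"] by simp
  have "compact (f ` frontier \<Omega>)" using f \<Omega>(2) by (intro compact_continuous_image compact_frontier_bounded)
  then have "\<exists>Mf. \<forall>y\<in>frontier \<Omega>. \<bar>f y\<bar> \<le> Mf"
    by (auto dest!: compact_imp_bounded simp: bounded_iff)
  then obtain Mf where Mf: "\<And>y. y \<in> frontier \<Omega> \<Longrightarrow> \<bar>f y\<bar> \<le> Mf" by blast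
  have Mf0: "0 \<le> Mf" using Mf[OF q] by linarith
  define c where "c = \<bar>f q\<bar>"
  have c0: "0 \<le> c" by (simp add: c_def)
  \<comment> \<open>Merges the error terms in \<eta> and \<open>1 / K\<^sup>2\<close> under one
    constant, the form that \<open>sphere_integral_limit\<close> expects.\<close>
  have combine: "v * x + w * y \<le> (v + w) * (x + y)" if "0 \<le> v" "0 \<le> w" "0 \<le> x" "0 \<le> y" for v w x y :: real
  proof -
    have "0 \<le> v * y" "0 \<le> w * x" using that by simp_all
    then show ?thesis by (simp add: algebra_simps)
  qed
  note limit = sphere_integral_limit[OF \<Omega> ep _ q R ball fr L _ _ f]
  \<comment> \<open>The tangential scale is \<open>sqrt (\<epsilon> i)\<close>, whose square is the
    length scale of the equation.\<close>
  have step: "(\<lambda>i. (LINT x|sphere_measure p R. U (\<epsilon> i) x) / sqrt (\<epsilon> i) ^ (DIM('a) - 1))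
      \<longlonglongrightarrow> real DIM('a) / R * (f q * (sqrt (2 * pi) ^ n / P * R / real N))"
    if \<epsilon>: "\<And>i. 0 < \<epsilon> i" "\<epsilon> \<longlonglongrightarrow> 0" for \<epsilon> :: "nat \<Rightarrow> real"
  proof (rule limit[where F="\<lambda>s. exp (- s)" and k=k and M=Mf and A="2 * real DIM('a) * Mf"
        and B="1 + 2 * c + (Mf + 3 * c) * 2 * real DIM('a)"])
    fix i
    have \<epsilon>i: "0 < \<epsilon> i" "(sqrt (\<epsilon> i))\<^sup>2 = \<epsilon> i" using \<epsilon>(1)[of i] by auto
    note sol = res[OF \<epsilon>i(1)]
    have bd: "\<bar>U (\<epsilon> i) x\<bar> \<le> Mf" if "x \<in> closure \<Omega>" for x
      by (rule resolvent_solution_bounded_by_data[OF \<Omega> sol \<epsilon>i(1) Mf Mf0 that])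
    then show "\<bar>U (\<epsilon> i) x\<bar> \<le> Mf" if "x \<in> closure \<Omega>" for x using that .
    show "0 < sqrt (\<epsilon> i)" using \<epsilon>i by simp
    show "continuous_on (closure \<Omega>) (U (\<epsilon> i))" using sol unfolding resolvent_solution_def by auto
    show "\<bar>U (\<epsilon> i) x\<bar> \<le> 2 * real DIM('a) * Mf * exp (- d / (sqrt (real DIM('a)) * (sqrt (\<epsilon> i))\<^sup>2))"
      if "0 < d" "cball x d \<subseteq> \<Omega>" for x d
      unfolding \<epsilon>i(2) by (rule resolvent_interior_decay[OF \<Omega>(1) sol \<epsilon>i(1) bd that]) (use closure_subset in blast)
    fix x a K \<eta>
    assume x: "x \<in> closure \<Omega>" and K: "0 < K" and \<eta>: "0 < \<eta>" "\<eta> \<le> 1"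
      and y: "\<And>y. y \<in> frontier \<Omega> \<Longrightarrow> y \<in> cball x (K * (sqrt (\<epsilon> i))\<^sup>2) \<Longrightarrow> \<bar>(y - a) \<bullet> \<nu>\<bar> \<le> \<eta> * (sqrt (\<epsilon> i))\<^sup>2 \<and> \<bar>f y - f q\<bar> \<le> \<eta>"
        "\<And>y. y \<in> closure \<Omega> \<Longrightarrow> y \<in> cball x (K * (sqrt (\<epsilon> i))\<^sup>2) \<Longrightarrow> - \<eta> * (sqrt (\<epsilon> i))\<^sup>2 \<le> (y - a) \<bullet> \<nu>"
    have "\<bar>U (\<epsilon> i) x - f q * exp (- ((x - a) \<bullet> \<nu>) / \<epsilon> i)\<bar>
        \<le> \<eta> + c * (exp \<eta> - 1) + (Mf + 3 * c) * 2 * real DIM('a) / K\<^sup>2"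
      unfolding c_def
      by (rule resolvent_half_space_approx[OF \<Omega> sol \<epsilon>i(1) bd \<nu> K \<eta> _ _ x]) (use y[unfolded \<epsilon>i(2)] in auto)
    also have "\<dots> \<le> \<eta> + c * (2 * \<eta>) + (Mf + 3 * c) * 2 * real DIM('a) * (1 / K\<^sup>2)"
      using exp_le_1_plus_2[of \<eta>] \<eta> by (simp add: c_def mult_left_mono)
    also have "\<dots> \<le> (1 + 2 * c + (Mf + 3 * c) * 2 * real DIM('a)) * (\<eta> + 1 / K\<^sup>2)"
      using combine[of "1 + 2 * c" "(Mf + 3 * c) * 2 * real DIM('a)" \<eta> "1 / K\<^sup>2"] Mf0 c0 \<eta>
      by (simp add: distrib_right mult.assoc)
    finally show "\<bar>U (\<epsilon> i) x - f q * exp (- ((x - a) \<bullet> \<nu> / (sqrt (\<epsilon> i))\<^sup>2))\<bar>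
        \<le> (1 + 2 * c + (Mf + 3 * c) * 2 * real DIM('a)) * (\<eta> + 1 / K\<^sup>2)" unfolding \<epsilon>i(2) by simp
  next
    show "(\<lambda>i. sqrt (\<epsilon> i)) \<longlonglongrightarrow> 0" using tendsto_real_sqrt[OF \<epsilon>(2)] by simp
    show "continuous_on UNIV (\<lambda>s::real. exp (- s))" by (intro continuous_intros)
    show "sector_integral b (\<lambda>i. 1 / R - k i) R (\<lambda>s. ennreal (exp (- s))) = ennreal (sqrt (2 * pi) ^ n / P * R / real N)"
      using sector_integral_exp[of b "\<lambda>i. 1 / R - k i", OF L(2) a R] by (simp add: P' n_def N_def)
    show "0 \<le> sqrt (2 * pi) ^ n / P * R / real N" using P R by simp
  qed (use gr hess k in auto)
  show "((\<lambda>\<epsilon>. (2 * pi * \<epsilon>) powr (- (real DIM('a) - 1) / 2) * (LINT x|sphere_measure p R. U \<epsilon> x))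
      \<longlongrightarrow> f q / sqrt (\<Prod>i\<in>{1..DIM('a) - 1}. (1 / R - \<kappa> i))) (at_right 0)"
    \<comment> \<open>Dominated convergence was applied along sequences, so the one-sided limit is
      tested on arbitrary positive null sequences.\<close>
    unfolding tendsto_at_iff_sequentially
  proof (intro allI impI)
    fix \<epsilon> :: "nat \<Rightarrow> real"
    assume "\<forall>i. \<epsilon> i \<in> {0<..} - {0}" and lim: "\<epsilon> \<longlonglongrightarrow> 0"
    then have \<epsilon>: "0 < \<epsilon> i" for i by auto
    have "(2 * pi * \<epsilon> i) powr (- (real DIM('a) - 1) / 2) = 1 / sqrt (2 * pi) ^ n / sqrt (\<epsilon> i) ^ (DIM('a) - 1)" for i
    proof -
      have "(2 * pi * \<epsilon> i) powr (- (real DIM('a) - 1) / 2) = 1 / (2 * pi * \<epsilon> i) powr (real n / 2)"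
        using N(2) by (simp add: N_def powr_minus_divide)
      also have "(2 * pi * \<epsilon> i) powr (real n / 2) = sqrt (2 * pi * \<epsilon> i) ^ n"
        using \<epsilon>[of i] by (simp add: sqrt_power_eq_powr)
      finally show ?thesis by (simp add: real_sqrt_mult power_mult_distrib n_def N_def)
    qed
    then have eq: "((\<lambda>\<epsilon>. (2 * pi * \<epsilon>) powr (- (real DIM('a) - 1) / 2) * (LINT x|sphere_measure p R. U \<epsilon> x)) \<circ> \<epsilon>)
      = (\<lambda>i. 1 / sqrt (2 * pi) ^ n * ((LINT x|sphere_measure p R. U (\<epsilon> i) x) / sqrt (\<epsilon> i) ^ (DIM('a) - 1)))"
      by (simp add: fun_eq_iff)
    have "(\<lambda>i. 1 / sqrt (2 * pi) ^ n * ((LINT x|sphere_measure p R. U (\<epsilon> i) x) / sqrt (\<epsilon> i) ^ (DIM('a) - 1)))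
      \<longlonglongrightarrow> 1 / sqrt (2 * pi) ^ n * (real DIM('a) / R * (f q * (sqrt (2 * pi) ^ n / P * R / real N)))"
      by (intro tendsto_intros step \<epsilon> lim)
    also have "1 / sqrt (2 * pi) ^ n * (real DIM('a) / R * (f q * (sqrt (2 * pi) ^ n / P * R / real N))) = f q / P"
      using R N(1) by (simp add: N_def)
    finally show "((\<lambda>\<epsilon>. (2 * pi * \<epsilon>) powr (- (real DIM('a) - 1) / 2) * (LINT x|sphere_measure p R. U \<epsilon> x)) \<circ> \<epsilon>)
      \<longlonglongrightarrow> f q / sqrt (\<Prod>i\<in>{1..DIM('a) - 1}. (1 / R - \<kappa> i))" unfolding eq P_def .
  qed
  obtain M where M: "\<And>x t. x \<in> closure \<Omega> \<Longrightarrow> 0 < t \<Longrightarrow> \<bar>u x t\<bar> \<le> M"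
    using heat_solution_bounded[OF heat] by blast
  have M0: "0 \<le> M" using M[of q 1] q by (force simp: frontier_def)
  define G where "G = Gamma ((real DIM('a) + 3) / 4)"
  have G: "0 < G" by (simp add: G_def Gamma_real_pos add_nonneg_pos)
  have G': "Gamma (real (DIM('a) - 1) / 4 + 1) = G"
    using N unfolding G_def by (intro arg_cong[where f=Gamma]) (simp add: N_def n_def field_simps of_nat_diff)
  \<comment> \<open>The length scale is now \<open>sqrt (t i)\<close>, so the tangential scale is
    the fourth root of \<open>t i\<close>.\<close>
  have step2: "(\<lambda>i. (LINT x|sphere_measure p R. u x (t i)) / sqrt (sqrt (t i)) ^ (DIM('a) - 1))
      \<longlonglongrightarrow> real DIM('a) / R * (f q * (sqrt (2 * pi) ^ n / P * R / real N / G))"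
    if t: "\<And>i. 0 < t i" "t \<longlonglongrightarrow> 0" for t :: "nat \<Rightarrow> real"
  proof (rule limit[where V="\<lambda>i x. u x (t i)" and F=erfc2 and k=k and M=M and A="2 * real DIM('a) * (M + 1) * exp 1"
        and B="1 + 5 * (M + 2 * c) + (M + 2 * c) * 2 * real DIM('a)"])
    fix i
    have ti: "0 < t i" "(sqrt (sqrt (t i)))\<^sup>2 = sqrt (t i)" using t(1)[of i] by auto
    show "\<bar>u x (t i)\<bar> \<le> M" if "x \<in> closure \<Omega>" for x using M[OF that ti(1)] .
    show "0 < sqrt (sqrt (t i))" using ti by simp
    show "continuous_on (closure \<Omega>) (\<lambda>x. u x (t i))" by (rule continuous_on_heat_solution_slice[OF heat ti(1)])
    show "\<bar>u x (t i)\<bar> \<le> 2 * real DIM('a) * (M + 1) * exp 1 * exp (- d / (sqrt (real DIM('a)) * (sqrt (sqrt (t i)))\<^sup>2))"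
      if "0 < d" "cball x d \<subseteq> \<Omega>" for x d
      unfolding ti(2) by (rule heat_interior_decay[OF \<Omega>(1) heat ti(1) M that]) (use closure_subset in blast)
    fix x a K \<eta>
    assume x: "x \<in> closure \<Omega>" and K: "0 < K" and \<eta>: "0 < \<eta>" "\<eta> \<le> 1"
      and y: "\<And>y. y \<in> frontier \<Omega> \<Longrightarrow> y \<in> cball x (K * (sqrt (sqrt (t i)))\<^sup>2) \<Longrightarrow> \<bar>(y - a) \<bullet> \<nu>\<bar> \<le> \<eta> * (sqrt (sqrt (t i)))\<^sup>2 \<and> \<bar>f y - f q\<bar> \<le> \<eta>"
        "\<And>y. y \<in> closure \<Omega> \<Longrightarrow> y \<in> cball x (K * (sqrt (sqrt (t i)))\<^sup>2) \<Longrightarrow> - \<eta> * (sqrt (sqrt (t i)))\<^sup>2 \<le> (y - a) \<bullet> \<nu>"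
    have "\<bar>u x (t i) - f q * erfc2 ((x - a) \<bullet> \<nu> / sqrt (t i))\<bar>
        \<le> \<eta> + (M + 2 * c) * 2 * real DIM('a) / K\<^sup>2 + 5 * (M + 2 * c) * \<eta>"
      unfolding c_def
      by (rule heat_half_space_approx[OF \<Omega> heat ti(1) M \<nu> K \<eta>(1) _ _ x]) (use y[unfolded ti(2)] in auto)
    also have "\<dots> \<le> (1 + 5 * (M + 2 * c) + (M + 2 * c) * 2 * real DIM('a)) * (\<eta> + 1 / K\<^sup>2)"
      using combine[of "1 + 5 * (M + 2 * c)" "(M + 2 * c) * 2 * real DIM('a)" \<eta> "1 / K\<^sup>2"] M0 c0 \<eta>
      by (simp add: distrib_right mult.assoc)
    finally show "\<bar>u x (t i) - f q * erfc2 ((x - a) \<bullet> \<nu> / (sqrt (sqrt (t i)))\<^sup>2)\<bar>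
        \<le> (1 + 5 * (M + 2 * c) + (M + 2 * c) * 2 * real DIM('a)) * (\<eta> + 1 / K\<^sup>2)" unfolding ti(2) .
  next
    show "(\<lambda>i. sqrt (sqrt (t i))) \<longlonglongrightarrow> 0" using tendsto_real_sqrt[OF tendsto_real_sqrt[OF t(2)]] by simp
    show "continuous_on UNIV erfc2" by (rule continuous_on_erfc2)
    show "0 \<le> erfc2 s" for s by (rule erfc2_nonneg)
    show "sector_integral b (\<lambda>i. 1 / R - k i) R (\<lambda>s. ennreal (erfc2 s)) = ennreal (sqrt (2 * pi) ^ n / P * R / real N / G)"
      using sector_integral_erfc2[of b "\<lambda>i. 1 / R - k i", OF L(2) a R] by (simp only: P' G' n_def N_def)
    show "0 \<le> sqrt (2 * pi) ^ n / P * R / real N / G" using P R G by simp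
  qed (use gr hess k in auto)
  show "((\<lambda>t. (4 * pi\<^sup>2 * t) powr (- (real DIM('a) - 1) / 4) * (LINT x|sphere_measure p R. u x t))
      \<longlongrightarrow> (f q / Gamma ((real DIM('a) + 3) / 4)) / sqrt (\<Prod>i\<in>{1..DIM('a) - 1}. (1 / R - \<kappa> i))) (at_right 0)"
    unfolding tendsto_at_iff_sequentially
  proof (intro allI impI)
    fix t :: "nat \<Rightarrow> real"
    assume "\<forall>i. t i \<in> {0<..} - {0}" and lim: "t \<longlonglongrightarrow> 0"
    then have t: "0 < t i" for i by auto
    have "(4 * pi\<^sup>2 * t i) powr (- (real DIM('a) - 1) / 4) = 1 / sqrt (2 * pi) ^ n / sqrt (sqrt (t i)) ^ (DIM('a) - 1)" for i
    proof -
      have "(4 * pi\<^sup>2 * t i) powr (- (real DIM('a) - 1) / 4) = 1 / (4 * pi\<^sup>2 * t i) powr (real n / 4)"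
        using N(2) by (simp add: N_def powr_minus_divide)
      \<comment> \<open>The square root of \<open>4 * pi\<^sup>2 * t i\<close> is
        \<open>2 * pi * sqrt (t i)\<close>, so the normalization is the elliptic one at
        \<open>\<epsilon> = sqrt (t i)\<close>.\<close>
      also have "(4 * pi\<^sup>2 * t i) powr (real n / 4) = ((4 * pi\<^sup>2 * t i) powr (1 / 2)) powr (real n / 2)"
        by (simp add: powr_powr)
      also have "(4 * pi\<^sup>2 * t i) powr (1 / 2) = sqrt ((2 * pi)\<^sup>2 * t i)"
        using t[of i] by (subst powr_half_sqrt) (auto simp: power_mult_distrib)
      also have "sqrt ((2 * pi)\<^sup>2 * t i) = 2 * pi * sqrt (t i)" by (simp add: real_sqrt_mult)
      also have "(2 * pi * sqrt (t i)) powr (real n / 2) = sqrt (2 * pi * sqrt (t i)) ^ n"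
        using t[of i] by (simp add: sqrt_power_eq_powr)
      finally show ?thesis by (simp add: real_sqrt_mult power_mult_distrib n_def N_def)
    qed
    then have eq: "((\<lambda>t. (4 * pi\<^sup>2 * t) powr (- (real DIM('a) - 1) / 4) * (LINT x|sphere_measure p R. u x t)) \<circ> t)
      = (\<lambda>i. 1 / sqrt (2 * pi) ^ n * ((LINT x|sphere_measure p R. u x (t i)) / sqrt (sqrt (t i)) ^ (DIM('a) - 1)))"
      by (simp add: fun_eq_iff)
    have "(\<lambda>i. 1 / sqrt (2 * pi) ^ n * ((LINT x|sphere_measure p R. u x (t i)) / sqrt (sqrt (t i)) ^ (DIM('a) - 1)))
      \<longlonglongrightarrow> 1 / sqrt (2 * pi) ^ n * (real DIM('a) / R * (f q * (sqrt (2 * pi) ^ n / P * R / real N / G)))"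
      by (intro tendsto_intros step2 t lim)
    also have "1 / sqrt (2 * pi) ^ n * (real DIM('a) / R * (f q * (sqrt (2 * pi) ^ n / P * R / real N / G))) = f q / G / P"
      using R N(1) by (simp add: N_def)
    finally show "((\<lambda>t. (4 * pi\<^sup>2 * t) powr (- (real DIM('a) - 1) / 4) * (LINT x|sphere_measure p R. u x t)) \<circ> t)
      \<longlonglongrightarrow> (f q / Gamma ((real DIM('a) + 3) / 4)) / sqrt (\<Prod>i\<in>{1..DIM('a) - 1}. (1 / R - \<kappa> i))" unfolding eq P_def G_def .
  qed
qed

end
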